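(* Let $n\geq 2$ and $F=\mathbb{C}(x_1,\ldots,x_n)$ be the field of rational functions in $n$ indeterminates over $\mathbb{C}$. Then $I^nF$ is $3$-linked but not $2^n$-linked. That is: any three bilinear $n$-fold Pfister forms over $F$ share a common $(n-1)$-fold factor, but there exist $2^n$ bilinear $n$-fold Pfister forms over $F$ which do not share a common $(n-1)$-fold factor.
   Context: For a field $F$, $W F$ is the Witt ring of symmetric bilinear forms over $F$ and $IF$ its ideal of even-dimensional forms; $I^nF$ is its $n$-th power, generated by bilinear $n$-fold Pfister forms. For $a\in F^\times$, $\langle\langle a\rangle\rangle$ denotes the bilinear form $\langle 1,-a\rangle$, and a bilinear $n$-fold Pfister form is one of the form $\langle\langle a_1,\ldots,a_n\rangle\rangle=\langle 1,-a_1\rangle\otimes\cdots\otimes\langle 1,-a_n\rangle$ with $a_i\in F^\times$. A collection of bilinear $n$-fold Pfister forms $\varphi_1,\dots,\varphi_m$ shares a common $(n-1)$-fold factor if there is a bilinear $(n-1)$-fold Pfister form $\pi$ and elements $b_1,\dots,b_m\in F^\times$ with $\varphi_j\cong \pi\otimes\langle\langle b_j\rangle\rangle$ (isometry of bilinear forms) for all $j$. For $m,n\geq 2$, $I^nF$ is called $m$-linked if every $m$ bilinear $n$-fold Pfister forms over $F$ share a common $(n-1)$-fold factor. *)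

theory Defs
  imports "HOL-Library.Poly_Mapping" "HOL-Computational_Algebra.Fraction_Field"
    "Jordan_Normal_Form.Determinant"
begin

text \<open>Multivariate polynomials over C in the variables x_0, x_1, ... are finitely
supported maps from monomials (finitely supported exponent vectors) to coefficients.
This is an integral domain; its fraction field is the ambient field.\<close>

type_synonym mpoly = "(nat \<Rightarrow>\<^sub>0 nat) \<Rightarrow>\<^sub>0 complex"
type_synonym ratfun = "mpoly fract"

definition poly_vars :: "mpoly \<Rightarrow> nat set" where
  "poly_vars p = (\<Union>m \<in> Poly_Mapping.keys p. Poly_Mapping.keys m)"

text \<open>C(x_1,...,x_n) realised as the subfield of quotients p/q of polynomials in
the first n variables (indices 0..n-1).\<close>
definition rat_fun_field :: "nat \<Rightarrow> ratfun set" where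
  "rat_fun_field n = {Fract p q | p q. q \<noteq> 0 \<and> poly_vars p \<subseteq> {..<n} \<and> poly_vars q \<subseteq> {..<n}}"

section \<open>Symmetric bilinear forms as Gram matrices\<close>

definition kron :: "'a::times mat \<Rightarrow> 'a mat \<Rightarrow> 'a mat" where
  "kron A B = mat (dim_row A * dim_row B) (dim_col A * dim_col B)
     (\<lambda>(i,j). A $$ (i div dim_row B, j div dim_col B) * B $$ (i mod dim_row B, j mod dim_col B))"

definition diag_form :: "'a::zero list \<Rightarrow> 'a mat" where
  "diag_form as = mat_diag (length as) (\<lambda>i. as ! i)"

definition pf1 :: "'a::{zero,one,uminus} \<Rightarrow> 'a mat" where
  "pf1 a = diag_form [1, - a]"

fun pfister :: "'a::comm_ring_1 list \<Rightarrow> 'a mat" where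
  "pfister [] = 1\<^sub>m 1"
| "pfister (a # as) = kron (pf1 a) (pfister as)"

definition isometric_over :: "'a::field set \<Rightarrow> 'a mat \<Rightarrow> 'a mat \<Rightarrow> bool" where
  "isometric_over F A B \<longleftrightarrow>
     (\<exists>M. M \<in> carrier_mat (dim_row A) (dim_row A) \<and>
          (\<forall>i < dim_row A. \<forall>j < dim_row A. M $$ (i,j) \<in> F) \<and>
          det M \<noteq> 0 \<and> transpose_mat M * A * M = B)"

definition is_pfister_over :: "'a::field set \<Rightarrow> nat \<Rightarrow> 'a mat \<Rightarrow> bool" where
  "is_pfister_over F n \<phi> \<longleftrightarrow> (\<exists>as. length as = n \<and> set as \<subseteq> F - {0} \<and> \<phi> = pfister as)"

definition share_common_factor :: "'a::field set \<Rightarrow> nat \<Rightarrow> 'a mat list \<Rightarrow> bool" where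
  "share_common_factor F n \<phi>s \<longleftrightarrow>
     (\<exists>\<pi> bs. is_pfister_over F (n - 1) \<pi> \<and> length bs = length \<phi>s \<and> set bs \<subseteq> F - {0} \<and>
        (\<forall>j < length \<phi>s. isometric_over F (\<phi>s ! j) (kron \<pi> (pf1 (bs ! j)))))"

definition linked :: "'a::field set \<Rightarrow> nat \<Rightarrow> nat \<Rightarrow> bool" where
  "linked F m n \<longleftrightarrow>
     (\<forall>\<phi>s. length \<phi>s = m \<and> (\<forall>\<phi> \<in> set \<phi>s. is_pfister_over F n \<phi>) \<longrightarrow> share_common_factor F n \<phi>s)"

end

theory Submission
  imports Defs "HOL-Library.Function_Algebras" "HOL-Library.FuncSet"
    "HOL-Computational_Algebra.Fundamental_Theorem_Algebra"
    "HOL-Analysis.Continuum_Not_Denumerable"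
begin

text \<open>For 3-linkage, suppose three \<open>n\<close>-fold Pfister forms share an \<open>r\<close>-fold factor \<open>\<pi>\<close> with \<open>r \<le> n - 2\<close>.
  The complements of \<open>\<pi>\<close> in them have dimension \<open>2\<^sup>n - 2\<^sup>r\<close>, and \<open>3 (2\<^sup>n - 2\<^sup>r) > 2 \<cdot> 2\<^sup>n\<close>, so by
  Tsen-Lang for two quadratic forms they represent a common nonzero value, which by the pure subform
  theorem is a further common slot. Tsen-Lang is reduced by counting coefficients to the fact that
  fewer homogeneous equations than unknowns over \<open>\<complex>\<close> have a nontrivial common zero.

  For the negative part take \<open>\<langle>\<langle>-(x\<^sub>1 + \<epsilon>\<^sub>1), \<dots>, -(x\<^sub>n + \<epsilon>\<^sub>n)\<rangle>\<rangle>\<close> with \<open>\<epsilon> \<in> {0,1}\<^sup>n\<close>. A slot of a common factor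
  would be a common value of their pure parts. Extend the dyadic valuation to \<open>\<complex>\<close> and reduce: over
  the residue field \<open>k\<close>, of characteristic 2, every value of the pure part is \<open>f(x)\<close> for a multilinear
  polynomial \<open>f\<close> over \<open>k(x)\<^sup>2\<close> with \<open>f(\<epsilon>) = 0\<close>. This \<open>f\<close> is determined by the value, and a multilinear polynomial that vanishes on \<open>{0,1}\<^sup>n\<close> is zero.\<close>

section \<open>Polynomial functions\<close>

text \<open>Equality of three values is two quadratic equations, whence the bound 2 * 2^n. The
  inequality 3 (2^n - 2^r) > 2 * 2^n says 2^n > 3 * 2^r, so it holds exactly up to r = n - 2; the
  same count for four forms already fails at r = n - 2. A common value may come out as 0; then one
  of the forms is isotropic, hence universal, and can be set aside. The slots carry minus signs so
  that the diagonal entries are the products of the x_i + \<epsilon>_i over S, without signs.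
  Reduction needs a valuation on all of \<complex>, obtained by Zorn from a maximal subring without
  1/2. Squarefree monomials are a basis of k(x) over k(x)^2, so one f serves all \<epsilon>; the
  term of each nonempty S vanishes at \<epsilon> because \<epsilon>_i + \<epsilon>_i = 0 in k. The
  reduced value could be 0 to begin with, so the contradiction is drawn from the coefficients:
  scaled jointly to be integral with a unit among them, they are all forced into the maximal
  ideal.\<close>

interpretation fvs: vector_space "\<lambda>(c::'a::field) (f::'b \<Rightarrow> 'a) z. c * f z"
  by unfold_locales (auto simp: algebra_simps fun_eq_iff)

lemma sum_fun_apply: "(\<Sum>s\<in>S. f s) x = (\<Sum>s\<in>S. f s x)"
  for f :: "'s \<Rightarrow> 'b \<Rightarrow> 'a::comm_monoid_add"
  by (induction S rule: infinite_finite_induct) auto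

text \<open>Indexed by \<open>Q\<close> rather than by a set of functions, so that a repeated member
  already yields a relation; injectivity need not be shown for the families to which this is
  applied.\<close>

lemma fvs_family_relation:
  fixes g :: "'q \<Rightarrow> 'b \<Rightarrow> 'a::field"
  assumes "finite Q" "finite T" "card T < card Q" "\<And>q. q \<in> Q \<Longrightarrow> g q \<in> fvs.span T"
  shows "\<exists>c. (\<exists>q\<in>Q. c q \<noteq> 0) \<and> (\<forall>z. (\<Sum>q\<in>Q. c q * g q z) = 0)"
proof (cases "inj_on g Q")
  case True
  have "fvs.dependent (g ` Q)"
  proof (rule ccontr)
    assume "\<not> fvs.dependent (g ` Q)"
    then have "card (g ` Q) \<le> card T"
      using fvs.independent_span_bound[OF assms(2), of "g ` Q"] assms(4) by blast
    with True assms(3) show False by (simp add: card_image)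
  qed
  then obtain u where u: "\<exists>v\<in>g ` Q. u v \<noteq> 0" "(\<Sum>v\<in>g ` Q. (\<lambda>z. u v * v z)) = 0"
    using fvs.dependent_finite[of "g ` Q"] assms(1) by auto
  have "(\<Sum>q\<in>Q. (\<lambda>z. u (g q) * g q z)) = 0"
    using u(2) True by (simp add: sum.reindex)
  then have "(\<Sum>q\<in>Q. u (g q) * g q z) = 0" for z
    using sum_fun_apply[of "\<lambda>q z. u (g q) * g q z" Q z] by simp
  then show ?thesis using u(1) by (intro exI[of _ "u \<circ> g"]) auto
next
  case False
  then obtain p q where pq: "p \<in> Q" "q \<in> Q" "p \<noteq> q" "g p = g q"
    by (auto simp: inj_on_def)
  define c where "c = (\<lambda>r. if r = p then 1 else if r = q then -1 else (0::'a))"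
  have "(\<Sum>r\<in>Q. c r * g r z) = (\<Sum>r\<in>{p,q}. c r * g r z)" for z
    by (rule sum.mono_neutral_right) (use assms(1) pq in \<open>auto simp: c_def\<close>)
  then have "(\<Sum>r\<in>Q. c r * g r z) = 0" for z
    using pq by (simp add: c_def)
  then show ?thesis using pq by (intro exI[of _ c]) (auto simp: c_def)
qed

inductive polyfun :: "'i set \<Rightarrow> (('i \<Rightarrow> 'a::comm_ring_1) \<Rightarrow> 'a) \<Rightarrow> bool" for I where
  const: "polyfun I (\<lambda>_. c)"
| var: "i \<in> I \<Longrightarrow> polyfun I (\<lambda>z. z i)"
| add: "polyfun I f \<Longrightarrow> polyfun I g \<Longrightarrow> polyfun I (\<lambda>z. f z + g z)"
| mult: "polyfun I f \<Longrightarrow> polyfun I g \<Longrightarrow> polyfun I (\<lambda>z. f z * g z)"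

text \<open>Polynomials are represented by the functions they define, which loses nothing over an
  infinite field. The rule \<open>zero\<close> gives the zero function every degree, so that empty
  sums fit any degree.\<close>

inductive hpolyfun :: "'i set \<Rightarrow> nat \<Rightarrow> (('i \<Rightarrow> 'a::comm_ring_1) \<Rightarrow> 'a) \<Rightarrow> bool" for I where
  zero: "hpolyfun I d (\<lambda>_. 0)"
| const: "hpolyfun I 0 (\<lambda>_. c)"
| var: "i \<in> I \<Longrightarrow> hpolyfun I 1 (\<lambda>z. z i)"
| add: "hpolyfun I d f \<Longrightarrow> hpolyfun I d g \<Longrightarrow> hpolyfun I d (\<lambda>z. f z + g z)"
| mult: "hpolyfun I d f \<Longrightarrow> hpolyfun I e g \<Longrightarrow> hpolyfun I (d + e) (\<lambda>z. f z * g z)"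

lemma hpolyfun_imp_polyfun: "hpolyfun I d f \<Longrightarrow> polyfun I f"
  by (induction rule: hpolyfun.induct) (auto intro: polyfun.intros)

lemma hpolyfun_sum:
  assumes "\<And>s. s \<in> S \<Longrightarrow> hpolyfun I d (f s)"
  shows "hpolyfun I d (\<lambda>z. \<Sum>s\<in>S. f s z)"
  using assms by (induction S rule: infinite_finite_induct) (auto intro: hpolyfun.intros)

lemma polyfun_sum:
  assumes "\<And>s. s \<in> S \<Longrightarrow> polyfun I (f s)"
  shows "polyfun I (\<lambda>z. \<Sum>s\<in>S. f s z)"
  using assms by (induction S rule: infinite_finite_induct) (auto intro: polyfun.intros)

lemma hpolyfun_power:
  assumes "hpolyfun I d f"
  shows "hpolyfun I (d * k) (\<lambda>z. f z ^ k)"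
proof (induction k)
  case (Suc k)
  then show ?case using hpolyfun.mult[OF assms Suc] by simp
qed (simp add: hpolyfun.const)

lemma hpolyfun_prod:
  assumes "\<And>s. s \<in> S \<Longrightarrow> hpolyfun I (d s) (f s)" "finite S"
  shows "hpolyfun I (\<Sum>s\<in>S. d s) (\<lambda>z. \<Prod>s\<in>S. f s z)"
  using assms(2,1) by (induction S rule: finite_induct) (auto intro: hpolyfun.intros)

lemma hpolyfun_scale: "hpolyfun I d f \<Longrightarrow> hpolyfun I d (\<lambda>z. c * f z)"
  using hpolyfun.mult[OF hpolyfun.const[of I c], of d f] by simp

text \<open>\<open>G\<close> is f(z / z i) with denominators cleared, so the formula is confined to
  z i \<noteq> 0. Every d from some D on is provided because the cofactors of different equations
  need prescribed degrees.\<close>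

lemma hpolyfun_homogenize:
  fixes f :: "('i \<Rightarrow> 'a::field) \<Rightarrow> 'a"
  assumes "polyfun I f" "i \<in> I"
  shows "\<exists>D. \<forall>d\<ge>D. \<exists>G. hpolyfun I d G \<and> (\<forall>z. z i \<noteq> 0 \<longrightarrow> G z = z i ^ d * f (\<lambda>j. z j / z i))"
  using assms(1)
proof (induction rule: polyfun.induct)
  case (const c)
  have "hpolyfun I d (\<lambda>z. c * z i ^ d)" for d
    using hpolyfun_scale[OF hpolyfun_power[OF hpolyfun.var[OF assms(2)], of d]] by simp
  then show ?case
    by (intro exI[of _ 0] allI impI exI[of _ "\<lambda>z. c * z i ^ _"] conjI) (auto simp: mult.commute)
next
  case (var j)
  have "hpolyfun I d (\<lambda>z. z j * z i ^ (d - 1))" if "d \<ge> 1" for d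
    using hpolyfun.mult[OF hpolyfun.var[OF var] hpolyfun_power[OF hpolyfun.var[OF assms(2)], of "d-1"]] that
    by simp
  moreover have "z j * z i ^ (d - 1) = z i ^ d * (z j / z i)" if "d \<ge> 1" "z i \<noteq> 0" for d and z :: "'i \<Rightarrow> 'a"
    using that by (cases d) auto
  ultimately show ?case
    by (intro exI[of _ 1] allI impI exI[of _ "\<lambda>z. z j * z i ^ (_ - 1)"] conjI) auto
next
  case (add f g)
  then obtain D1 D2 where
    D1: "\<forall>d\<ge>D1. \<exists>G. hpolyfun I d G \<and> (\<forall>z. z i \<noteq> 0 \<longrightarrow> G z = z i ^ d * f (\<lambda>j. z j / z i))" and
    D2: "\<forall>d\<ge>D2. \<exists>G. hpolyfun I d G \<and> (\<forall>z. z i \<noteq> 0 \<longrightarrow> G z = z i ^ d * g (\<lambda>j. z j / z i))"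
    by blast
  show ?case
  proof (intro exI[of _ "max D1 D2"] allI impI)
    fix d assume "d \<ge> max D1 D2"
    then obtain G1 G2 where
      "hpolyfun I d G1" "\<forall>z. z i \<noteq> 0 \<longrightarrow> G1 z = z i ^ d * f (\<lambda>j. z j / z i)"
      "hpolyfun I d G2" "\<forall>z. z i \<noteq> 0 \<longrightarrow> G2 z = z i ^ d * g (\<lambda>j. z j / z i)"
      using D1[rule_format, of d] D2[rule_format, of d] by auto
    then show "\<exists>G. hpolyfun I d G \<and> (\<forall>z. z i \<noteq> 0 \<longrightarrow>
        G z = z i ^ d * (f (\<lambda>j. z j / z i) + g (\<lambda>j. z j / z i)))"
      by (intro exI[of _ "\<lambda>z. G1 z + G2 z"]) (auto intro: hpolyfun.add simp: algebra_simps)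
  qed
next
  case (mult f g)
  then obtain D1 D2 where
    D1: "\<forall>d\<ge>D1. \<exists>G. hpolyfun I d G \<and> (\<forall>z. z i \<noteq> 0 \<longrightarrow> G z = z i ^ d * f (\<lambda>j. z j / z i))" and
    D2: "\<forall>d\<ge>D2. \<exists>G. hpolyfun I d G \<and> (\<forall>z. z i \<noteq> 0 \<longrightarrow> G z = z i ^ d * g (\<lambda>j. z j / z i))"
    by blast
  show ?case
  proof (intro exI[of _ "D1 + D2"] allI impI)
    fix d assume d: "d \<ge> D1 + D2"
    then obtain G1 G2 where
      G: "hpolyfun I D1 G1" "\<forall>z. z i \<noteq> 0 \<longrightarrow> G1 z = z i ^ D1 * f (\<lambda>j. z j / z i)"
      "hpolyfun I (d - D1) G2" "\<forall>z. z i \<noteq> 0 \<longrightarrow> G2 z = z i ^ (d - D1) * g (\<lambda>j. z j / z i)"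
      using D1[rule_format, of D1] D2[rule_format, of "d - D1"] d by (auto simp: le_diff_conv2)
    have "hpolyfun I d (\<lambda>z. G1 z * G2 z)" using hpolyfun.mult[OF G(1,3)] d by simp
    moreover have "z i ^ D1 * z i ^ (d - D1) = z i ^ d" for z :: "'i \<Rightarrow> 'a"
      using d by (simp flip: power_add)
    ultimately show "\<exists>G. hpolyfun I d G \<and> (\<forall>z. z i \<noteq> 0 \<longrightarrow>
        G z = z i ^ d * (f (\<lambda>j. z j / z i) * g (\<lambda>j. z j / z i)))"
      using G by (intro exI[of _ "\<lambda>z. G1 z * G2 z"]) (auto simp: algebra_simps)
  qed
qed

section \<open>Spanning and independence of monomial functions\<close>

definition monfun :: "'i set \<Rightarrow> ('i \<Rightarrow> nat) \<Rightarrow> ('i \<Rightarrow> 'a::comm_ring_1) \<Rightarrow> 'a" where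
  "monfun I e z = (\<Prod>i\<in>I. z i ^ e i)"

lemma monfun_cong: "(\<And>i. i \<in> I \<Longrightarrow> e i = e' i) \<Longrightarrow> monfun I e = monfun I e'"
  by (auto simp: monfun_def fun_eq_iff)

lemma monfun_add: "monfun I (\<lambda>i. e i + e' i) z = monfun I e z * monfun I e' z"
  by (simp add: monfun_def power_add prod.distrib)

lemma hpolyfun_monfun: "finite I \<Longrightarrow> hpolyfun I (\<Sum>i\<in>I. e i) (monfun I e)"
  unfolding monfun_def[abs_def]
  by (rule hpolyfun_prod) (use hpolyfun_power[OF hpolyfun.var] in auto)

lemma fvs_span_mult:
  fixes f g :: "'b \<Rightarrow> 'a::field"
  assumes "f \<in> fvs.span S" "g \<in> fvs.span T"
    and ST: "\<And>s t. s \<in> S \<Longrightarrow> t \<in> T \<Longrightarrow> (\<lambda>z. s z * t z) \<in> fvs.span U"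
  shows "(\<lambda>z. f z * g z) \<in> fvs.span U"
proof -
  have 1: "(\<lambda>z. s z * g z) \<in> fvs.span U" if "s \<in> S" for s
    using assms(2)
  proof (induction rule: fvs.span_induct_alt)
    case base
    show ?case using fvs.span_zero[of U] by (simp add: zero_fun_def)
  next
    case (step c x y)
    have "(\<lambda>z. c * (s z * x z)) + (\<lambda>z. s z * y z) \<in> fvs.span U"
      using step ST[OF that] by (intro fvs.span_add fvs.span_scale)
    then show ?case by (simp add: algebra_simps plus_fun_def)
  qed
  show ?thesis
    using assms(1)
  proof (induction rule: fvs.span_induct_alt)
    case base
    show ?case using fvs.span_zero[of U] by (simp add: zero_fun_def)
  next
    case (step c x y)
    have "(\<lambda>z. c * (x z * g z)) + (\<lambda>z. y z * g z) \<in> fvs.span U"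
      using step 1 by (intro fvs.span_add fvs.span_scale)
    then show ?case by (simp add: algebra_simps plus_fun_def)
  qed
qed

text \<open>Bounding every exponent by the same D leaves countably many candidate spaces, each of
  finite dimension; both facts feed the pigeonhole argument over the uncountable field.\<close>

lemma polyfun_span_monfun:
  fixes f :: "('i \<Rightarrow> 'a::field) \<Rightarrow> 'a"
  assumes "polyfun I f" "finite I"
  shows "\<exists>D. f \<in> fvs.span (monfun I ` (I \<rightarrow>\<^sub>E {..<D}))"
  using assms(1)
proof (induction rule: polyfun.induct)
  case (const c)
  have "monfun I (\<lambda>i\<in>I. 0) \<in> monfun I ` (I \<rightarrow>\<^sub>E {..<1::nat})" by auto
  then have "(\<lambda>z. c * monfun I (\<lambda>i\<in>I. 0) z) \<in> fvs.span (monfun I ` (I \<rightarrow>\<^sub>E {..<1::nat}))"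
    by (intro fvs.span_scale fvs.span_base)
  moreover have "(\<lambda>z. c * monfun I (\<lambda>i\<in>I. 0) z) = (\<lambda>_. c)" by (simp add: monfun_def)
  ultimately show ?case by (intro exI) simp
next
  case (var i)
  define e where "e = (\<lambda>j\<in>I. if j = i then 1 else 0::nat)"
  have "monfun I e z = z i" for z :: "'i \<Rightarrow> 'a"
    using var assms(2) by (simp add: monfun_def e_def prod.delta if_distrib[of "power _"] cong: if_cong)
  then have "(\<lambda>z :: 'i \<Rightarrow> 'a. z i) = monfun I e" by auto
  moreover have "monfun I e \<in> fvs.span (monfun I ` (I \<rightarrow>\<^sub>E {..<2::nat}))"
    by (intro fvs.span_base imageI) (auto simp: e_def PiE_iff extensional_def)
  ultimately show ?case by (intro exI) simp
next
  case (add f g)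
  then obtain D1 D2 where D: "f \<in> fvs.span (monfun I ` (I \<rightarrow>\<^sub>E {..<D1}))" "g \<in> fvs.span (monfun I ` (I \<rightarrow>\<^sub>E {..<D2}))"
    by blast
  have mono: "fvs.span (monfun I ` (I \<rightarrow>\<^sub>E {..<D})) \<subseteq> fvs.span (monfun I ` (I \<rightarrow>\<^sub>E {..<max D1 D2}))"
    if "D \<le> max D1 D2" for D
    by (intro fvs.span_mono image_mono PiE_mono) (use that in auto)
  have "f + g \<in> fvs.span (monfun I ` (I \<rightarrow>\<^sub>E {..<max D1 D2}))"
    by (intro fvs.span_add subsetD[OF mono D(1)] subsetD[OF mono D(2)]) auto
  then show ?case by (auto simp: plus_fun_def)
next
  case (mult f g)
  then obtain D1 D2 where D: "f \<in> fvs.span (monfun I ` (I \<rightarrow>\<^sub>E {..<D1}))" "g \<in> fvs.span (monfun I ` (I \<rightarrow>\<^sub>E {..<D2}))"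
    by blast
  have "(\<lambda>z. f z * g z) \<in> fvs.span (monfun I ` (I \<rightarrow>\<^sub>E {..<D1+D2}))"
  proof (rule fvs_span_mult[OF D], safe)
    fix e1 e2 assume e: "e1 \<in> I \<rightarrow>\<^sub>E {..<D1}" "e2 \<in> I \<rightarrow>\<^sub>E {..<D2}"
    have eq: "(\<lambda>z. monfun I e1 z * monfun I e2 z) = monfun I (\<lambda>i\<in>I. e1 i + e2 i)"
      by (subst monfun_cong[of I _ "\<lambda>i. e1 i + e2 i"]) (auto simp: fun_eq_iff monfun_add)
    have "(\<lambda>i\<in>I. e1 i + e2 i) \<in> I \<rightarrow>\<^sub>E {..<D1+D2}"
      using e by (auto simp: PiE_iff intro: add_less_mono)
    then show "(\<lambda>z. monfun I e1 z * monfun I e2 z) \<in> fvs.span (monfun I ` (I \<rightarrow>\<^sub>E {..<D1+D2}))"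
      unfolding eq by (intro fvs.span_base imageI)
  qed
  then show ?case by blast
qed

lemma hpolyfun_span_monfun:
  fixes f :: "('i \<Rightarrow> 'a::field) \<Rightarrow> 'a"
  assumes "hpolyfun I d f" "finite I"
  shows "f \<in> fvs.span (monfun I ` {e. (\<Sum>i\<in>I. e i) = d})"
  using assms(1)
proof (induction rule: hpolyfun.induct)
  case (zero d)
  show ?case using fvs.span_zero by (simp add: zero_fun_def)
next
  case (const c)
  have "monfun I (\<lambda>i. 0) \<in> monfun I ` {e. (\<Sum>i\<in>I. e i) = 0}" by auto
  then have "(\<lambda>z. c * monfun I (\<lambda>i. 0) z) \<in> fvs.span (monfun I ` {e. (\<Sum>i\<in>I. e i) = 0})"
    by (intro fvs.span_scale fvs.span_base)
  moreover have "(\<lambda>z. c * monfun I (\<lambda>i. 0) z) = (\<lambda>_. c)" by (simp add: monfun_def)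
  ultimately show ?case by metis
next
  case (var i)
  define e where "e = (\<lambda>j. if j = i then 1 else 0::nat)"
  have "monfun I e z = z i" for z :: "'i \<Rightarrow> 'a"
    using var assms(2) by (simp add: monfun_def e_def if_distrib prod.delta cong: if_cong prod.cong)
  then have "(\<lambda>z :: 'i \<Rightarrow> 'a. z i) = monfun I e" by auto
  moreover have "monfun I e \<in> fvs.span (monfun I ` {e. (\<Sum>i\<in>I. e i) = 1})"
    by (intro fvs.span_base imageI) (use var assms(2) in \<open>auto simp: e_def\<close>)
  ultimately show ?case by metis
next
  case (add d f g)
  then show ?case using fvs.span_add by (fastforce simp: plus_fun_def)
next
  case (mult d1 f d2 g)
  show ?case
  proof (rule fvs_span_mult[OF mult.IH], safe)
    fix e1 e2 :: "'i \<Rightarrow> nat"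
    have "(\<lambda>z. monfun I e1 z * monfun I e2 z) = monfun I (\<lambda>i. e1 i + e2 i)"
      by (auto simp: fun_eq_iff monfun_add)
    then show "(\<lambda>z. monfun I e1 z * monfun I e2 z)
       \<in> fvs.span (monfun I ` {e. (\<Sum>i\<in>I. e i) = (\<Sum>i\<in>I. e1 i) + (\<Sum>i\<in>I. e2 i)})"
      by (auto intro!: fvs.span_base simp: sum.distrib)
  qed
qed

text \<open>One variable at a time: with the others frozen, the sum is a univariate polynomial
  vanishing everywhere, hence zero as the domain is infinite; each of its coefficients is a relation
  in fewer variables.\<close>

lemma monfun_independent:
  fixes c :: "('i \<Rightarrow> nat) \<Rightarrow> 'a::{idom,ring_char_0}"
  assumes "finite I" "\<And>z. (\<Sum>e\<in>I \<rightarrow>\<^sub>E {..<b}. c e * monfun I e z) = 0" "e \<in> I \<rightarrow>\<^sub>E {..<b}"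
  shows "c e = 0"
  using assms
proof (induction I arbitrary: c e rule: finite_induct)
  case empty
  then show ?case by (simp add: monfun_def)
next
  case (insert i I)
  define S where "S = I \<rightarrow>\<^sub>E {..<b}"
  have inj: "inj_on (\<lambda>(y, g). g(i := y)) ({..<b} \<times> S)"
    unfolding S_def using insert.hyps(2) by (rule inj_combinator)
  have eq: "(\<Sum>k<b. (\<Sum>g\<in>S. c (g(i:=k)) * monfun I g z) * t ^ k) = 0" for z t
  proof -
    have m: "monfun (insert i I) (g(i:=k)) (z(i:=t)) = monfun I g z * t ^ k" for g k
    proof -
      have "monfun I (g(i:=k)) (z(i:=t)) = monfun I g z"
        unfolding monfun_def by (rule prod.cong) (use insert.hyps in auto)
      then show ?thesis using insert.hyps by (simp add: monfun_def mult.commute)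
    qed
    have "0 = (\<Sum>e\<in>insert i I \<rightarrow>\<^sub>E {..<b}. c e * monfun (insert i I) e (z(i:=t)))"
      using insert.prems(1) by simp
    also have "\<dots> = (\<Sum>(k,g)\<in>{..<b} \<times> S. c (g(i:=k)) * monfun (insert i I) (g(i:=k)) (z(i:=t)))"
      unfolding PiE_insert_eq S_def[symmetric] using inj
      by (subst sum.reindex) (auto simp: case_prod_unfold)
    also have "\<dots> = (\<Sum>k<b. \<Sum>g\<in>S. c (g(i:=k)) * (monfun I g z * t ^ k))"
      by (simp add: m sum.cartesian_product)
    finally show ?thesis by (simp add: sum_distrib_right mult.assoc)
  qed
  have zero: "(\<Sum>g\<in>S. c (g(i:=k)) * monfun I g z) = 0" if "k < b" for k z
  proof -
    define p where "p = (\<Sum>k<b. monom (\<Sum>g\<in>S. c (g(i:=k)) * monfun I g z) k)"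
    have "poly p t = 0" for t using eq[of z t] by (simp add: p_def poly_sum poly_monom)
    then have "p = 0" using poly_all_0_iff_0 by blast
    then have "coeff p k = 0" by simp
    then show ?thesis using that by (simp add: p_def coeff_sum)
  qed
  obtain k g where kg: "k < b" "g \<in> S" "e = g(i:=k)"
    using insert.prems(2) unfolding PiE_insert_eq S_def by auto
  show ?case using insert.IH[of "\<lambda>g. c (g(i:=k))" g] zero kg unfolding S_def
    by (simp del: fun_upd_apply)
qed

section \<open>A Nullstellensatz over the complex numbers\<close>

definition polyfun_ideal :: "'i set \<Rightarrow> (('i \<Rightarrow> 'a::comm_ring_1) \<Rightarrow> 'a) set \<Rightarrow> bool" where
  "polyfun_ideal I M \<longleftrightarrow> M \<subseteq> Collect (polyfun I) \<and> (\<lambda>_. 0) \<in> M \<and>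
     (\<forall>f\<in>M. \<forall>g\<in>M. (\<lambda>z. f z + g z) \<in> M) \<and> (\<forall>f g. polyfun I f \<longrightarrow> g \<in> M \<longrightarrow> (\<lambda>z. f z * g z) \<in> M)"

lemma polyfun_idealD:
  assumes "polyfun_ideal I M"
  shows "f \<in> M \<Longrightarrow> polyfun I f" "(\<lambda>_. 0) \<in> M"
    "f \<in> M \<Longrightarrow> g \<in> M \<Longrightarrow> (\<lambda>z. f z + g z) \<in> M"
    "polyfun I f \<Longrightarrow> g \<in> M \<Longrightarrow> (\<lambda>z. f z * g z) \<in> M"
  using assms by (simp_all add: polyfun_ideal_def subset_iff)

lemma polyfun_ideal_sum:
  assumes "polyfun_ideal I M" "\<And>s. s \<in> S \<Longrightarrow> f s \<in> M"
  shows "(\<lambda>z. \<Sum>s\<in>S. f s z) \<in> M"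
  using assms(2)
proof (induction S rule: infinite_finite_induct)
  case (insert s S)
  then have "f s \<in> M" "(\<lambda>z. \<Sum>s\<in>S. f s z) \<in> M" by auto
  then show ?case using assms(1) insert.hyps by (simp add: polyfun_ideal_def)
qed (use assms(1) in \<open>simp_all add: polyfun_ideal_def\<close>)

lemma ex_maximal_polyfun_ideal:
  assumes "polyfun_ideal I J" "(\<lambda>_. 1) \<notin> J"
  shows "\<exists>M. polyfun_ideal I M \<and> (\<lambda>_. 1) \<notin> M \<and> J \<subseteq> M \<and>
    (\<forall>N. polyfun_ideal I N \<longrightarrow> M \<subseteq> N \<longrightarrow> (\<lambda>_. 1) \<notin> N \<longrightarrow> N = M)"
proof -
  define A where "A = {N. polyfun_ideal I N \<and> J \<subseteq> N \<and> (\<lambda>_. 1) \<notin> N}"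
  have "\<exists>M\<in>A. \<forall>X\<in>A. M \<subseteq> X \<longrightarrow> X = M"
  proof (rule subset_Zorn_nonempty)
    show "A \<noteq> {}" using assms by (auto simp: A_def)
    fix C assume C: "C \<noteq> {}" "subset.chain A C"
    have 1: "polyfun_ideal I N" "J \<subseteq> N" "(\<lambda>_. 1) \<notin> N" if "N \<in> C" for N
      using C(2) that by (auto simp: A_def subset.chain_def)
    have add: "(\<lambda>z. f z + g z) \<in> \<Union>C" if fg: "f \<in> \<Union>C" "g \<in> \<Union>C" for f g
    proof -
      obtain N1 N2 where N: "N1 \<in> C" "N2 \<in> C" "f \<in> N1" "g \<in> N2" using fg by auto
      then have "N1 \<subseteq> N2 \<or> N2 \<subseteq> N1" using C(2) by (auto simp: subset.chain_def)
      then obtain N where "N \<in> C" "f \<in> N" "g \<in> N" using N by auto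
      then show ?thesis using 1(1)[of N] by (auto simp: polyfun_ideal_def)
    qed
    have "polyfun_ideal I (\<Union>C)"
      unfolding polyfun_ideal_def
    proof (intro conjI subsetI ballI allI impI)
      fix f assume "f \<in> \<Union>C"
      then show "f \<in> Collect (polyfun I)" using polyfun_idealD(1)[OF 1(1)] by blast
    next
      show "(\<lambda>_. 0) \<in> \<Union>C" using C(1) polyfun_idealD(2)[OF 1(1)] by blast
    next
      fix f g :: "('a \<Rightarrow> 'b) \<Rightarrow> 'b" assume f: "polyfun I f" and "g \<in> \<Union>C"
      then obtain N where N: "N \<in> C" "g \<in> N" by blast
      from polyfun_idealD(4)[OF 1(1)[OF N(1)] f N(2)]
      show "(\<lambda>z. f z * g z) \<in> \<Union>C" using N(1) by (rule UnionI[rotated])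
    qed (rule add)
    moreover have "J \<subseteq> \<Union>C" "(\<lambda>_. 1) \<notin> \<Union>C" using 1(2,3) C(1) by auto
    ultimately show "\<Union>C \<in> A" by (simp add: A_def)
  qed
  then obtain M where M: "M \<in> A" "\<And>X. X \<in> A \<Longrightarrow> M \<subseteq> X \<Longrightarrow> X = M" by blast
  show ?thesis
  proof (intro exI[of _ M] conjI allI impI)
    fix N assume "polyfun_ideal I N" "M \<subseteq> N" "(\<lambda>_. 1) \<notin> N"
    then show "N = M" by (intro M(2)) (use M(1) in \<open>auto simp: A_def\<close>)
  qed (use M(1) in \<open>simp_all add: A_def\<close>)
qed

text \<open>If no \<open>z i - a\<close> lies in \<open>M\<close>, then every \<open>z i - a\<close> has an inverse \<open>g a\<close> modulo \<open>M\<close>. As \<open>\<complex>\<close> is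
  uncountable, infinitely many \<open>g a\<close> lie in one finite-dimensional space; clearing
  denominators in a linear relation between them gives a nonzero univariate polynomial in \<open>z i\<close>
  that lies in \<open>M\<close>, and its linear factors can be cancelled one by one.\<close>
lemma maximal_polyfun_ideal_coordinate:
  fixes M :: "(('i \<Rightarrow> complex) \<Rightarrow> complex) set"
  assumes I: "finite I" "i \<in> I"
    and M: "polyfun_ideal I M" "(\<lambda>_. 1) \<notin> M"
    and max: "\<And>N. polyfun_ideal I N \<Longrightarrow> M \<subseteq> N \<Longrightarrow> (\<lambda>_. 1) \<notin> N \<Longrightarrow> N = M"
  shows "\<exists>a. (\<lambda>z. z i - a) \<in> M"
proof (rule ccontr)
  assume none: "\<nexists>a. (\<lambda>z. z i - a) \<in> M"
  have M_add: "(\<lambda>z. f z + g z) \<in> M" if "f \<in> M" "g \<in> M" for f g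
    using M(1) that by (auto simp: polyfun_ideal_def)
  have M_mult: "(\<lambda>z. f z * g z) \<in> M" if "polyfun I f" "g \<in> M" for f g
    using M(1) that by (auto simp: polyfun_ideal_def)
  have M_diff: "(\<lambda>z. f z - g z) \<in> M" if "f \<in> M" "g \<in> M" for f g
    using M_add[OF that(1) M_mult[OF polyfun.const[of I "-1"] that(2)]] by simp
  have lin: "polyfun I (\<lambda>z. z i - a)" for a
    using polyfun.add[OF polyfun.var[OF I(2)] polyfun.const[of I "-a"]] by simp
  have "\<exists>g. polyfun I g \<and> (\<lambda>z. 1 - (z i - a) * g z) \<in> M" for a
  proof -
    \<comment> \<open>The ideal generated by \<open>M\<close> and \<open>z i - a\<close>; by
      maximality it contains 1, which gives the inverse of \<open>z i - a\<close> modulo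
      \<open>M\<close>.\<close>
    define N where "N = {(\<lambda>z. f z + (z i - a) * g z) | f g. f \<in> M \<and> polyfun I g}"
    have MN: "M \<subseteq> N"
    proof
      fix f assume "f \<in> M"
      then show "f \<in> N" unfolding N_def
        by (intro CollectI exI[of _ f] exI[of _ "\<lambda>_. 0"]) (auto intro: polyfun.const)
    qed
    have id: "polyfun_ideal I N"
      unfolding polyfun_ideal_def
    proof (intro conjI ballI allI impI)
      show "N \<subseteq> Collect (polyfun I)"
        using M(1) lin by (auto simp: N_def polyfun_ideal_def intro!: polyfun.add polyfun.mult)
      show "(\<lambda>_. 0) \<in> N" using MN M(1) by (auto simp: polyfun_ideal_def)
    next
      fix p q assume "p \<in> N" "q \<in> N"
      then obtain f g f' g' where
        "f \<in> M" "f' \<in> M" "polyfun I g" "polyfun I g'"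
        "p = (\<lambda>z. f z + (z i - a) * g z)" "q = (\<lambda>z. f' z + (z i - a) * g' z)"
        unfolding N_def by blast
      then show "(\<lambda>z. p z + q z) \<in> N" unfolding N_def
        by (intro CollectI exI[of _ "\<lambda>z. f z + f' z"] exI[of _ "\<lambda>z. g z + g' z"] conjI M_add polyfun.add)
          (auto simp: algebra_simps)
    next
      fix p q :: "('i \<Rightarrow> complex) \<Rightarrow> complex" assume "polyfun I p" "q \<in> N"
      then obtain f g where "f \<in> M" "polyfun I g" "q = (\<lambda>z. f z + (z i - a) * g z)"
        unfolding N_def by blast
      with \<open>polyfun I p\<close> show "(\<lambda>z. p z * q z) \<in> N" unfolding N_def
        by (intro CollectI exI[of _ "\<lambda>z. p z * f z"] exI[of _ "\<lambda>z. p z * g z"] conjI M_mult polyfun.mult)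
          (auto simp: algebra_simps)
    qed
    have "(\<lambda>z. z i - a) \<in> N" unfolding N_def
      by (intro CollectI exI[of _ "\<lambda>_. 0"] exI[of _ "\<lambda>_. 1"])
        (use M(1) in \<open>auto simp: polyfun_ideal_def intro: polyfun.const\<close>)
    then have "N \<noteq> M" using none by auto
    then have "(\<lambda>_. 1) \<in> N" using max[OF id MN] by blast
    then obtain f g where fg: "f \<in> M" "polyfun I g" "(\<lambda>_. 1) = (\<lambda>z. f z + (z i - a) * g z)"
      unfolding N_def by blast
    have "f = (\<lambda>z. 1 - (z i - a) * g z)" using fg(3) by (metis add_diff_cancel_right')
    then show ?thesis using fg by blast
  qed
  then obtain g where g: "\<And>a. polyfun I (g a)" "\<And>a. (\<lambda>z. 1 - (z i - a) * g a z) \<in> M"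
    by metis
  have cancel: "(\<lambda>z. h z) \<in> M" if "polyfun I h" "(\<lambda>z. (z i - a) * h z) \<in> M" for a h
  proof -
    have "(\<lambda>z. h z * (1 - (z i - a) * g a z) + g a z * ((z i - a) * h z)) \<in> M"
      by (intro M_add M_mult that g)
    then show ?thesis by (simp add: algebra_simps)
  qed
  have poly_in: "polyfun I (\<lambda>z. poly h (z i))" for h
    by (induction h) (auto intro!: polyfun.intros I(2))
  have no_poly: "(\<lambda>z. poly h (z i)) \<notin> M" if "h \<noteq> 0" for h
    using that
  proof (induction "degree h" arbitrary: h rule: less_induct)
    case less
    show ?case
    proof (cases "degree h = 0")
      case True
      then obtain c where c: "h = [:c:]" by (meson degree_eq_zeroE)
      then have "c \<noteq> 0" using less.prems by auto
      show ?thesis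
      proof
        assume "(\<lambda>z. poly h (z i)) \<in> M"
        then have "(\<lambda>z. inverse c * poly h (z i)) \<in> M" by (intro M_mult polyfun.const)
        then show False using c \<open>c \<noteq> 0\<close> M(2) by simp
      qed
    next
      case False
      then have "\<not> constant (poly h)" by (simp add: constant_degree)
      then obtain a where "poly h a = 0" using fundamental_theorem_of_algebra by blast
      then obtain h' where h': "h = [:-a, 1:] * h'" by (meson dvdE poly_eq_0_iff_dvd)
      with less.prems have "h' \<noteq> 0" by auto
      then have "degree h' < degree h" by (subst h', subst degree_mult_eq) auto
      then have "(\<lambda>z. poly h' (z i)) \<notin> M" using less.hyps \<open>h' \<noteq> 0\<close> by blast
      moreover have "(\<lambda>z. poly h (z i)) = (\<lambda>z. (z i - a) * poly h' (z i))"
        by (simp add: h' algebra_simps)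
      ultimately show ?thesis using cancel[OF poly_in, of a h'] by auto
    qed
  qed
  have "\<exists>D. \<forall>a. g a \<in> fvs.span (monfun I ` (I \<rightarrow>\<^sub>E {..<D a}))"
    by (intro choice allI polyfun_span_monfun g I)
  then obtain D where D: "\<And>a. g a \<in> fvs.span (monfun I ` (I \<rightarrow>\<^sub>E {..<D a}))" by blast
  have "\<exists>d. infinite {a. D a = d}"
  proof (rule ccontr)
    assume "\<nexists>d. infinite {a. D a = d}"
    then have "countable (\<Union>d. {a. D a = d})" by (intro countable_UN) (auto intro: countable_finite)
    moreover have "(\<Union>d. {a. D a = d}) = UNIV" by auto
    ultimately have "countable (UNIV :: complex set)" by simp
    then have "countable (range complex_of_real)" by (rule countable_subset[OF subset_UNIV])
    then have "countable (UNIV :: real set)"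
      by (rule countable_image_inj_on) (simp add: inj_on_def)
    then show False using uncountable_UNIV_real by blast
  qed
  then obtain d where d: "infinite {a. D a = d}" by blast
  define T :: "(('i \<Rightarrow> complex) \<Rightarrow> complex) set" where "T = monfun I ` (I \<rightarrow>\<^sub>E {..<d})"
  have T: "finite T" unfolding T_def using I(1) by (intro finite_imageI finite_PiE) auto
  obtain Q where Q: "finite Q" "card Q = Suc (card T)" "Q \<subseteq> {a. D a = d}"
    using infinite_arbitrarily_large[OF d] by blast
  have "\<exists>c. (\<exists>q\<in>Q. c q \<noteq> 0) \<and> (\<forall>z. (\<Sum>q\<in>Q. c q * g q z) = 0)"
  proof (rule fvs_family_relation[OF Q(1) T])
    show "card T < card Q" using Q by simp
    show "g q \<in> fvs.span T" if "q \<in> Q" for q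
      using D[of q] Q(3) that unfolding T_def by auto
  qed
  then obtain c a0 where c: "\<And>z. (\<Sum>q\<in>Q. c q * g q z) = 0" "a0 \<in> Q" "c a0 \<noteq> 0" by blast
  \<comment> \<open>\<open>h\<close> is the sum of c a / (X - a) over \<open>Q\<close> times the
    common denominator; at \<open>a0\<close> only the term of \<open>a0\<close> survives, so h is
    not 0.\<close>
  define P where "P R = (\<Prod>b\<in>R. [:-b, 1:])" for R :: "complex set"
  define h where "h = (\<Sum>a\<in>Q. smult (c a) (P (Q - {a})))"
  have "poly h a0 = (\<Sum>a\<in>{a0}. c a * poly (P (Q - {a})) a0)"
    unfolding h_def poly_sum poly_smult
  proof (rule sum.mono_neutral_right[OF Q(1)])
    show "\<forall>i\<in>Q - {a0}. c i * poly (P (Q - {i})) a0 = 0"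
      using Q(1) c(2) by (auto simp: P_def poly_prod)
  qed (use c(2) in auto)
  also have "\<dots> \<noteq> 0" using c(3) Q(1) by (auto simp: P_def poly_prod)
  finally have "h \<noteq> 0" by auto
  have P: "poly (P Q) x = (x - a) * poly (P (Q - {a})) x" if "a \<in> Q" for a x
    unfolding P_def using Q(1) that by (subst prod.remove[of _ a]) (auto simp: algebra_simps)
  \<comment> \<open>Modulo \<open>M\<close>, \<open>g a\<close> stands for 1 / (z i - a). With these
    weights the terms containing \<open>g\<close> add up to \<open>P Q\<close> times the linear
    relation, which is 0, and h(z i) is left.\<close>
  have "(\<lambda>z. \<Sum>a\<in>Q. (c a * poly (P (Q - {a})) (z i)) * (1 - (z i - a) * g a z)) \<in> M"
    by (intro polyfun_ideal_sum[OF M(1)] M_mult g polyfun.mult polyfun.const poly_in)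
  moreover have "(\<Sum>a\<in>Q. (c a * poly (P (Q - {a})) (z i)) * (1 - (z i - a) * g a z)) = poly h (z i)" for z
  proof -
    have "(\<Sum>a\<in>Q. (c a * poly (P (Q - {a})) (z i)) * (1 - (z i - a) * g a z))
        = (\<Sum>a\<in>Q. c a * poly (P (Q - {a})) (z i)) - (\<Sum>a\<in>Q. poly (P Q) (z i) * (c a * g a z))"
      unfolding sum_subtractf[symmetric] by (rule sum.cong) (auto simp: P algebra_simps)
    also have "\<dots> = poly h (z i)"
      using c(1)[of z] by (simp add: h_def poly_sum flip: sum_distrib_left)
    finally show ?thesis .
  qed
  ultimately show False using no_poly[OF \<open>h \<noteq> 0\<close>] by simp
qed

text \<open>If 1 is not in the ideal generated by the \<open>f k\<close>, a maximal ideal above it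
  contains z i - a i for some point a, so reduction modulo it is evaluation at a. All
  \<open>f k\<close> then vanish at a.\<close>

lemma weak_nullstellensatz:
  fixes f :: "'k \<Rightarrow> ('i \<Rightarrow> complex) \<Rightarrow> complex"
  assumes I: "finite I" and K: "finite K" and f: "\<And>k. k \<in> K \<Longrightarrow> polyfun I (f k)"
    and no_zero: "\<And>z. \<exists>k\<in>K. f k z \<noteq> 0"
  shows "\<exists>g. (\<forall>k\<in>K. polyfun I (g k)) \<and> (\<forall>z. (\<Sum>k\<in>K. g k z * f k z) = 1)"
proof (rule ccontr)
  assume no: "\<not> ?thesis"
  define J where "J = {(\<lambda>z. \<Sum>k\<in>K. g k z * f k z) | g. \<forall>k\<in>K. polyfun I (g k)}"
  have J: "polyfun_ideal I J"
    unfolding polyfun_ideal_def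
  proof (intro conjI ballI allI impI)
    show "J \<subseteq> Collect (polyfun I)" using f by (auto simp: J_def intro!: polyfun_sum polyfun.mult)
    show "(\<lambda>_. 0) \<in> J" unfolding J_def
      by (intro CollectI exI[of _ "\<lambda>_ _. 0"]) (auto intro: polyfun.const)
  next
    fix p q assume "p \<in> J" "q \<in> J"
    then obtain g g' where "\<forall>k\<in>K. polyfun I (g k)" "\<forall>k\<in>K. polyfun I (g' k)"
      "p = (\<lambda>z. \<Sum>k\<in>K. g k z * f k z)" "q = (\<lambda>z. \<Sum>k\<in>K. g' k z * f k z)"
      unfolding J_def by blast
    then show "(\<lambda>z. p z + q z) \<in> J" unfolding J_def
      by (intro CollectI exI[of _ "\<lambda>k z. g k z + g' k z"])
        (auto simp: algebra_simps sum.distrib intro: polyfun.add)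
  next
    fix p q :: "('i \<Rightarrow> complex) \<Rightarrow> complex" assume "polyfun I p" "q \<in> J"
    then obtain g where "\<forall>k\<in>K. polyfun I (g k)" "q = (\<lambda>z. \<Sum>k\<in>K. g k z * f k z)"
      unfolding J_def by blast
    with \<open>polyfun I p\<close> show "(\<lambda>z. p z * q z) \<in> J" unfolding J_def
      by (intro CollectI exI[of _ "\<lambda>k z. p z * g k z"])
        (auto simp: algebra_simps sum_distrib_left intro: polyfun.mult)
  qed
  have "(\<lambda>_. 1) \<notin> J"
  proof
    assume "(\<lambda>_. 1) \<in> J"
    then obtain g where "\<forall>k\<in>K. polyfun I (g k)" "(\<lambda>_. 1) = (\<lambda>z. \<Sum>k\<in>K. g k z * f k z)"
      unfolding J_def by blast
    then show False using no by metis
  qed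
  then obtain M where M: "polyfun_ideal I M" "(\<lambda>_. 1) \<notin> M" "J \<subseteq> M"
    "\<And>N. polyfun_ideal I N \<Longrightarrow> M \<subseteq> N \<Longrightarrow> (\<lambda>_. 1) \<notin> N \<Longrightarrow> N = M"
    using ex_maximal_polyfun_ideal[OF J] by blast
  have "\<exists>a. \<forall>i\<in>I. (\<lambda>z. z i - a i) \<in> M"
    by (intro bchoice ballI maximal_polyfun_ideal_coordinate[OF I _ M(1,2,4)])
  then obtain a where a: "\<And>i. i \<in> I \<Longrightarrow> (\<lambda>z. z i - a i) \<in> M" by blast
  have M_add: "(\<lambda>z. f z + g z) \<in> M" if "f \<in> M" "g \<in> M" for f g
    using M(1) that by (auto simp: polyfun_ideal_def)
  have M_mult: "(\<lambda>z. f z * g z) \<in> M" if "polyfun I f" "g \<in> M" for f g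
    using M(1) that by (auto simp: polyfun_ideal_def)
  have eval: "(\<lambda>z. p z - p a) \<in> M" if "polyfun I p" for p
    using that
  proof (induction rule: polyfun.induct)
    case (const c)
    then show ?case using M(1) by (auto simp: polyfun_ideal_def)
  next
    case (var i)
    then show ?case by (rule a)
  next
    case (add p q)
    from M_add[OF add.IH] show ?case by (simp add: algebra_simps)
  next
    case (mult p q)
    have "(\<lambda>z. p z * (q z - q a) + q a * (p z - p a)) \<in> M"
      by (intro M_add M_mult mult polyfun.const)
    then show ?case by (simp add: algebra_simps)
  qed
  obtain k where k: "k \<in> K" "f k a \<noteq> 0" using no_zero by blast
  define c where "c = f k a"
  have "f k \<in> J" unfolding J_def
    by (intro CollectI exI[of _ "\<lambda>l _. if l = k then 1 else 0"])
      (use k K in \<open>auto simp: if_distrib[of "\<lambda>x. x * _"] intro: polyfun.const cong: if_cong\<close>)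
  then have "f k \<in> M" using M(3) by blast
  then have "(\<lambda>z. inverse c * f k z + (- inverse c) * (f k z - f k a)) \<in> M"
    by (intro M_add M_mult polyfun.const eval f k)
  then have "(\<lambda>z. 1) \<in> M" using k(2) by (simp add: c_def algebra_simps)
  then show False using M(2) by blast
qed

lemma hpolyfun_scaling:
  "hpolyfun I d f \<Longrightarrow> f (\<lambda>j. c * z j) = c ^ d * f z"
  by (induction rule: hpolyfun.induct) (auto simp: algebra_simps power_add)

text \<open>Setting z i = 1 dehomogenizes: the \<open>f k\<close> together with z i - 1 have no
  common zero, so 1 is a combination of them. Substituting z / z i kills the term of z i - 1, and
  clearing denominators makes the remaining cofactors homogeneous.\<close>

lemma power_in_ideal_if_only_trivial_zero:
  fixes f :: "'k \<Rightarrow> ('i \<Rightarrow> complex) \<Rightarrow> complex"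
  assumes I: "finite I" "i \<in> I" and K: "finite K"
    and f: "\<And>k. k \<in> K \<Longrightarrow> hpolyfun I (d k) (f k)"
    and no_zero: "\<And>z. z i \<noteq> 0 \<Longrightarrow> \<exists>k\<in>K. f k z \<noteq> 0"
  shows "\<exists>m G. (\<forall>k\<in>K. d k \<le> m \<and> hpolyfun I (m - d k) (G k)) \<and> (\<forall>z. z i ^ m = (\<Sum>k\<in>K. f k z * G k z))"
proof -
  define F where "F = (\<lambda>k. case k of None \<Rightarrow> (\<lambda>z. z i - 1) | Some k \<Rightarrow> f k)"
  have lin: "polyfun I (\<lambda>z. z i - 1)"
    using polyfun.add[OF polyfun.var[OF I(2)] polyfun.const[of I "-1"]] by simp
  have "\<exists>g. (\<forall>k\<in>insert None (Some ` K). polyfun I (g k)) \<and>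
      (\<forall>z. (\<Sum>k\<in>insert None (Some ` K). g k z * F k z) = 1)"
  proof (rule weak_nullstellensatz[OF I(1)])
    show "finite (insert None (Some ` K))" using K by simp
    show "polyfun I (F k)" if "k \<in> insert None (Some ` K)" for k
      using that lin hpolyfun_imp_polyfun[OF f] by (auto simp: F_def)
    show "\<exists>k\<in>insert None (Some ` K). F k z \<noteq> 0" for z
      using no_zero[of z] by (cases "z i = 0") (auto simp: F_def)
  qed
  then obtain g where g: "\<And>k. k \<in> K \<Longrightarrow> polyfun I (g (Some k))"
    and g1: "\<And>z. (\<Sum>k\<in>insert None (Some ` K). g k z * F k z) = 1" by blast
  have g2: "g None z * (z i - 1) + (\<Sum>k\<in>K. g (Some k) z * f k z) = 1" for z
    using g1[of z] K by (simp add: sum.reindex F_def)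
  have "\<forall>k\<in>K. \<exists>D. \<forall>d\<ge>D. \<exists>G. hpolyfun I d G \<and> (\<forall>z. z i \<noteq> 0 \<longrightarrow> G z = z i ^ d * g (Some k) (\<lambda>j. z j / z i))"
    by (intro ballI hpolyfun_homogenize g I)
  from bchoice[OF this] obtain D where D: "\<And>k d. k \<in> K \<Longrightarrow> d \<ge> D k \<Longrightarrow>
      \<exists>G. hpolyfun I d G \<and> (\<forall>z. z i \<noteq> 0 \<longrightarrow> G z = z i ^ d * g (Some k) (\<lambda>j. z j / z i))"
    by blast
  define m where "m = (\<Sum>k\<in>K. D k + d k)"
  have m: "D k + d k \<le> m" if "k \<in> K" for k
    unfolding m_def using K that by (intro member_le_sum) auto
  have "\<forall>k\<in>K. \<exists>G. hpolyfun I (m - d k) G \<and>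
      (\<forall>z. z i \<noteq> 0 \<longrightarrow> G z = z i ^ (m - d k) * g (Some k) (\<lambda>j. z j / z i))"
  proof
    fix k assume "k \<in> K"
    then show "\<exists>G. hpolyfun I (m - d k) G \<and>
      (\<forall>z. z i \<noteq> 0 \<longrightarrow> G z = z i ^ (m - d k) * g (Some k) (\<lambda>j. z j / z i))"
      using D[of k "m - d k"] m[of k] by simp
  qed
  from bchoice[OF this] obtain G where G: "\<And>k. k \<in> K \<Longrightarrow> hpolyfun I (m - d k) (G k)"
    "\<And>k z. k \<in> K \<Longrightarrow> z i \<noteq> 0 \<Longrightarrow> G k z = z i ^ (m - d k) * g (Some k) (\<lambda>j. z j / z i)"
    by blast
  have eq: "z i ^ m = (\<Sum>k\<in>K. f k z * G k z)" if z: "z i \<noteq> 0" for z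
  proof -
    have "f k z * G k z = z i ^ m * (g (Some k) (\<lambda>j. z j / z i) * f k (\<lambda>j. z j / z i))" if k: "k \<in> K" for k
    proof -
      have "f k z = z i ^ d k * f k (\<lambda>j. z j / z i)"
        using hpolyfun_scaling[OF f[OF k], of "z i" "\<lambda>j. z j / z i"] z by simp
      moreover have "z i ^ m = z i ^ d k * z i ^ (m - d k)"
        using m[OF k] by (simp flip: power_add)
      ultimately show ?thesis using G(2)[OF k, of z] z by simp
    qed
    then have "(\<Sum>k\<in>K. f k z * G k z) = z i ^ m * (\<Sum>k\<in>K. g (Some k) (\<lambda>j. z j / z i) * f k (\<lambda>j. z j / z i))"
      by (simp add: sum_distrib_left)
    then show ?thesis using g2[of "\<lambda>j. z j / z i"] z by simp
  qed
  show ?thesis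
  \<comment> \<open>The identity is known only for z i \<noteq> 0; one more factor z i makes both
    sides 0 on the hyperplane z i = 0.\<close>
  proof (intro exI[of _ "Suc m"] exI[of _ "\<lambda>k z. z i * G k z"] conjI ballI allI)
    fix k assume k: "k \<in> K"
    show "d k \<le> Suc m" using m[OF k] by simp
    show "hpolyfun I (Suc m - d k) (\<lambda>z. z i * G k z)"
      using hpolyfun.mult[OF hpolyfun.var[OF I(2)] G(1)[OF k]] m[OF k] by (simp add: Suc_diff_le)
  next
    fix z
    show "z i ^ Suc m = (\<Sum>k\<in>K. f k z * (z i * G k z))"
      using eq[of z] by (cases "z i = 0") (simp_all add: sum_distrib_left mult.left_commute)
  qed
qed

text \<open>If the origin were the only common zero, the polynomial ring would be a finite module over
  the subring generated by the \<open>f k\<close>, and there would be too few elements of bounded degree.\<close>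
lemma hpolyfun_system_zero:
  fixes f :: "'k \<Rightarrow> ('i \<Rightarrow> complex) \<Rightarrow> complex"
  assumes I: "finite I" and K: "finite K" and less: "card K < card I"
    and f: "\<And>k. k \<in> K \<Longrightarrow> hpolyfun I (d k) (f k)" and d: "\<And>k. k \<in> K \<Longrightarrow> d k > 0"
  shows "\<exists>z. (\<exists>i\<in>I. z i \<noteq> 0) \<and> (\<forall>k\<in>K. f k z = 0)"
proof (rule ccontr)
  assume no: "\<not> ?thesis"
  have "\<forall>i\<in>I. \<exists>m G. (\<forall>k\<in>K. d k \<le> m \<and> hpolyfun I (m - d k) (G k)) \<and> (\<forall>z. z i ^ m = (\<Sum>k\<in>K. f k z * G k z))"
    using no by (intro ballI power_in_ideal_if_only_trivial_zero I K f) auto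
  from bchoice[OF this] obtain m where "\<forall>i\<in>I. \<exists>G. (\<forall>k\<in>K. d k \<le> m i \<and> hpolyfun I (m i - d k) (G k)) \<and>
      (\<forall>z. z i ^ m i = (\<Sum>k\<in>K. f k z * G k z))" by blast
  from bchoice[OF this] obtain G where G: "\<And>i k. i \<in> I \<Longrightarrow> k \<in> K \<Longrightarrow> d k \<le> m i"
      "\<And>i k. i \<in> I \<Longrightarrow> k \<in> K \<Longrightarrow> hpolyfun I (m i - d k) (G i k)"
      "\<And>i z. i \<in> I \<Longrightarrow> z i ^ m i = (\<Sum>k\<in>K. f k z * G i k z)" by blast
  define L where "L = Suc (\<Sum>i\<in>I. m i)"
  \<comment> \<open>Monomials with bounded exponents generate the module; the powers of the
    \<open>f k\<close> come from the subring. The argument of \<open>B\<close> bounds the exponents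
    of the \<open>f k\<close>.\<close>
  define gen where "gen = (\<lambda>(\<alpha>, \<gamma>) z. monfun I \<alpha> z * (\<Prod>k\<in>K. f k z ^ \<gamma> k))"
  define B where "B = (\<lambda>D::nat. gen ` ((I \<rightarrow>\<^sub>E {..<L}) \<times> (K \<rightarrow>\<^sub>E {..D})))"
  have mult_f: "(\<lambda>z. f k z * h z) \<in> fvs.span (B (Suc D))" if k: "k \<in> K" and h: "h \<in> fvs.span (B D)" for k D h
  proof (rule fvs_span_mult[of _ "{f k}", OF fvs.span_base h])
    fix s t assume "s \<in> {f k}" and "t \<in> B D"
    then obtain \<alpha> \<gamma> where t: "s = f k" "t = gen (\<alpha>, \<gamma>)" "\<alpha> \<in> I \<rightarrow>\<^sub>E {..<L}" "\<gamma> \<in> K \<rightarrow>\<^sub>E {..D}"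
      unfolding B_def by auto
    define \<gamma>' where "\<gamma>' = \<gamma>(k := Suc (\<gamma> k))"
    have "(\<Prod>l\<in>K. f l z ^ \<gamma>' l) = f k z * (\<Prod>l\<in>K. f l z ^ \<gamma> l)" for z
      using K k by (simp add: prod.remove[of K k] \<gamma>'_def)
    then have "(\<lambda>z. s z * t z) = gen (\<alpha>, \<gamma>')" by (simp add: t gen_def fun_eq_iff)
    moreover have "\<gamma>' \<in> K \<rightarrow>\<^sub>E {..Suc D}"
      using t(4) k by (auto simp: \<gamma>'_def PiE_iff extensional_def intro: le_SucI)
    ultimately show "(\<lambda>z. s z * t z) \<in> fvs.span (B (Suc D))"
      using t(3) by (auto simp: B_def intro!: fvs.span_base)
  qed simp
  \<comment> \<open>A monomial divisible by z i ^ m i is a sum of \<open>f k\<close> times forms of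
    degree e - d k. As d k > 0 the degree drops, and one unit of \<open>D\<close> pays for the extra
    factor \<open>f k\<close>.\<close>
  have span: "h \<in> fvs.span (B D)" if "hpolyfun I e h" "e \<le> D" for e h D
    using that
  proof (induction e arbitrary: h D rule: less_induct)
    case (less e)
    have "monfun I \<alpha> \<in> fvs.span (B D)" if \<alpha>: "(\<Sum>i\<in>I. \<alpha> i) = e" for \<alpha>
    proof (cases "\<forall>i\<in>I. \<alpha> i < m i")
      case True
      then have "\<alpha> i < L" if "i \<in> I" for i
      proof -
        have "m i \<le> (\<Sum>i\<in>I. m i)" using I that by (intro member_le_sum) auto
        then show ?thesis using True that by (auto simp: L_def)
      qed
      then have "gen (restrict \<alpha> I, \<lambda>k\<in>K. 0) \<in> B D"
        unfolding B_def by (intro imageI) auto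
      moreover have "monfun I \<alpha> = gen (restrict \<alpha> I, \<lambda>k\<in>K. 0)"
        by (simp add: gen_def fun_eq_iff monfun_cong[of I "restrict \<alpha> I" \<alpha>])
      ultimately show ?thesis by (simp add: fvs.span_base)
    next
      case False
      then obtain i where i: "i \<in> I" "m i \<le> \<alpha> i" by auto
      define \<alpha>' where "\<alpha>' = \<alpha>(i := \<alpha> i - m i)"
      have mon: "monfun I \<alpha> z = z i ^ m i * monfun I \<alpha>' z" for z :: "'i \<Rightarrow> complex"
        using I i by (simp add: monfun_def prod.remove[of I i] \<alpha>'_def flip: power_add mult.assoc)
      have "\<alpha> i \<le> (\<Sum>i\<in>I. \<alpha> i)" using I i by (intro member_le_sum) auto
      then have le: "m i \<le> e" using i \<alpha> by simp
      have "(\<Sum>i\<in>I. \<alpha>' i) + m i = (\<Sum>i\<in>I. \<alpha> i)"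
        using I i by (simp add: sum.remove[of I i] \<alpha>'_def)
      then have e: "(\<Sum>i\<in>I. \<alpha>' i) = e - m i" using \<alpha> by simp
      have "(\<lambda>z. f k z * (G i k z * monfun I \<alpha>' z)) \<in> fvs.span (B D)" if k: "k \<in> K" for k
      proof -
        have "hpolyfun I (e - d k) (\<lambda>z. G i k z * monfun I \<alpha>' z)"
          using hpolyfun.mult[OF G(2)[OF i(1) k] hpolyfun_monfun[OF I, of \<alpha>']] e le G(1)[OF i(1) k]
          by simp
        moreover have "e - d k < e" "e - d k \<le> D - 1"
          using d[OF k] G(1)[OF i(1) k] le less.prems(2) by auto
        ultimately have "(\<lambda>z. G i k z * monfun I \<alpha>' z) \<in> fvs.span (B (D - 1))"
          by (intro less.IH)
        from mult_f[OF k this] show ?thesis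
          using d[OF k] G(1)[OF i(1) k] le less.prems(2) by simp
      qed
      then have "(\<Sum>k\<in>K. (\<lambda>z. f k z * (G i k z * monfun I \<alpha>' z))) \<in> fvs.span (B D)"
        by (rule fvs.span_sum)
      moreover have "(\<Sum>k\<in>K. (\<lambda>z. f k z * (G i k z * monfun I \<alpha>' z))) = monfun I \<alpha>"
        by (simp add: fun_eq_iff sum_fun_apply mon G(3)[OF i(1)] sum_distrib_right mult.assoc)
      ultimately show ?thesis by simp
    qed
    then have "fvs.span (monfun I ` {\<alpha>. (\<Sum>i\<in>I. \<alpha> i) = e}) \<subseteq> fvs.span (B D)"
      by (intro fvs.span_minimal fvs.subspace_span) auto
    then show ?case using hpolyfun_span_monfun[OF less.prems(1) I] by blast
  qed
  define N where "N = card I"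
  \<comment> \<open>With this b the bound L^N (2 N b)^card K on the number of generators equals (b -
    1) b^card K, which is less than the number b^N of monomials with exponents below b. These
    monomials have degree at most N b, hence \<open>B (N * b)\<close>.\<close>
  define b where "b = Suc (L ^ N * (2 * N) ^ card K)"
  have N: "N > 0" "card K \<le> N - 1" using less by (auto simp: N_def)
  have "card (B (N * b)) \<le> card ((I \<rightarrow>\<^sub>E {..<L}) \<times> (K \<rightarrow>\<^sub>E {..N * b}))"
    unfolding B_def using I K by (intro card_image_le finite_cartesian_product finite_PiE) auto
  also have "\<dots> = L ^ N * Suc (N * b) ^ card K"
    using I K by (simp add: card_cartesian_product card_PiE N_def)
  also have "\<dots> \<le> L ^ N * (2 * N * b) ^ card K"
  proof -
    have "Suc (N * b) \<le> 2 * N * b" using N(1) by (simp add: b_def)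
    then show ?thesis by (intro mult_left_mono power_mono) auto
  qed
  also have "\<dots> = (b - 1) * b ^ card K"
    by (simp only: b_def diff_Suc_1 power_mult_distrib mult.assoc)
  also have "\<dots> \<le> (b - 1) * b ^ (N - 1)"
    using N(2) by (intro mult_left_mono power_increasing) (auto simp: b_def)
  also have "\<dots> < b * b ^ (N - 1)" by (simp add: b_def)
  also have "\<dots> = card (I \<rightarrow>\<^sub>E {..<b})"
    using I N(1) by (simp add: card_PiE N_def flip: power_Suc)
  finally have card: "card (B (N * b)) < card (I \<rightarrow>\<^sub>E {..<b})" .
  have "\<exists>c. (\<exists>e\<in>I \<rightarrow>\<^sub>E {..<b}. c e \<noteq> 0) \<and> (\<forall>z::'i \<Rightarrow> complex. (\<Sum>e\<in>I \<rightarrow>\<^sub>E {..<b}. c e * monfun I e z) = 0)"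
  proof (rule fvs_family_relation[OF _ _ card])
    show "finite (I \<rightarrow>\<^sub>E {..<b})" "finite (B (N * b))"
      unfolding B_def using I K by (intro finite_imageI finite_cartesian_product finite_PiE; simp)+
    fix e assume e: "e \<in> I \<rightarrow>\<^sub>E {..<b}"
    have "(\<Sum>i\<in>I. e i) \<le> of_nat (card I) * b"
      using e by (intro sum_bounded_above) (auto simp: PiE_iff less_imp_le)
    then show "monfun I e \<in> fvs.span (B (N * b))"
      by (intro span[OF hpolyfun_monfun[OF I]]) (simp add: N_def)
  qed
  then obtain c where c: "\<exists>e\<in>I \<rightarrow>\<^sub>E {..<b}. c e \<noteq> 0"
      "\<And>z::'i \<Rightarrow> complex. (\<Sum>e\<in>I \<rightarrow>\<^sub>E {..<b}. c e * monfun I e z) = 0" by blast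
  from c(1) obtain e where "e \<in> I \<rightarrow>\<^sub>E {..<b}" "c e \<noteq> 0" by blast
  with monfun_independent[OF I c(2)] show False by blast
qed

section \<open>Systems of diagonal quadratic equations over rational function fields\<close>

definition polys_in :: "nat \<Rightarrow> mpoly set" where
  "polys_in n = {p. poly_vars p \<subseteq> {..<n}}"

lemma polys_in_iff: "p \<in> polys_in n \<longleftrightarrow> (\<forall>m\<in>Poly_Mapping.keys p. Poly_Mapping.keys m \<subseteq> {..<n})"
  by (auto simp: polys_in_def poly_vars_def)

lemma polys_in_const [simp]: "0 \<in> polys_in n" "1 \<in> polys_in n" "Poly_Mapping.single 0 c \<in> polys_in n"
  by (auto simp: polys_in_iff)

lemma polys_in_add: "p \<in> polys_in n \<Longrightarrow> q \<in> polys_in n \<Longrightarrow> p + q \<in> polys_in n"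
  using Poly_Mapping.keys_add[of p q] unfolding polys_in_iff by blast

lemma polys_in_uminus: "p \<in> polys_in n \<Longrightarrow> - p \<in> polys_in n"
  by (simp add: polys_in_iff in_keys_iff)

lemma polys_in_mult:
  assumes "p \<in> polys_in n" "q \<in> polys_in n"
  shows "p * q \<in> polys_in n"
  unfolding polys_in_iff
proof
  fix m assume "m \<in> Poly_Mapping.keys (p * q)"
  then obtain a b where "m = a + b" "a \<in> Poly_Mapping.keys p" "b \<in> Poly_Mapping.keys q"
    using keys_mult[of p q] by blast
  then show "Poly_Mapping.keys m \<subseteq> {..<n}"
    using assms Poly_Mapping.keys_add[of a b] unfolding polys_in_iff by blast
qed

definition fract_of :: "'a::idom \<Rightarrow> 'a fract" where "fract_of p = Fract p 1"

lemma fract_of_mult [simp]: "fract_of (p * q) = fract_of p * fract_of q"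
  by (simp add: fract_of_def)

lemma fract_of_one [simp]: "fract_of 1 = 1"
  by (simp add: fract_of_def One_fract_def)

lemma fract_of_power [simp]: "fract_of (p ^ k) = fract_of p ^ k"
  by (induction k) simp_all

lemma fract_of_simps [simp]: "fract_of 0 = 0"
  "fract_of (p + q) = fract_of p + fract_of q" "fract_of (p - q) = fract_of p - fract_of q" "fract_of (- p) = - fract_of p"
  "fract_of p = fract_of q \<longleftrightarrow> p = q" "fract_of p = 0 \<longleftrightarrow> p = 0"
  by (simp_all add: fract_of_def Zero_fract_def eq_fract)

lemma fract_of_sum: "fract_of (sum f S) = (\<Sum>s\<in>S. fract_of (f s))"
  by (induction S rule: infinite_finite_induct) auto

lemma Fract_eq_fract_of: "q \<noteq> 0 \<Longrightarrow> Fract p q = fract_of p / fract_of q"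
  by (simp add: fract_of_def)

lemma rat_fun_field_iff:
  "x \<in> rat_fun_field n \<longleftrightarrow> (\<exists>p\<in>polys_in n. \<exists>q\<in>polys_in n. q \<noteq> 0 \<and> x = fract_of p / fract_of q)"
proof
  assume "x \<in> rat_fun_field n"
  then obtain p q where "x = Fract p q" "q \<noteq> 0" "p \<in> polys_in n" "q \<in> polys_in n"
    unfolding rat_fun_field_def polys_in_def by blast
  then show "\<exists>p\<in>polys_in n. \<exists>q\<in>polys_in n. q \<noteq> 0 \<and> x = fract_of p / fract_of q"
    using Fract_eq_fract_of by blast
next
  assume "\<exists>p\<in>polys_in n. \<exists>q\<in>polys_in n. q \<noteq> 0 \<and> x = fract_of p / fract_of q"
  then obtain p q where "x = Fract p q" "q \<noteq> 0" "p \<in> polys_in n" "q \<in> polys_in n"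
    using Fract_eq_fract_of by metis
  then show "x \<in> rat_fun_field n"
    unfolding rat_fun_field_def polys_in_def by blast
qed

section \<open>Subfields as sets, and the rational function field as one of them\<close>

locale subfield_set =
  fixes F :: "'a::field set"
  assumes one [simp]: "1 \<in> F"
    and minus [simp]: "x \<in> F \<Longrightarrow> y \<in> F \<Longrightarrow> x - y \<in> F"
    and mult [simp]: "x \<in> F \<Longrightarrow> y \<in> F \<Longrightarrow> x * y \<in> F"
    and inverse [simp]: "x \<in> F \<Longrightarrow> inverse x \<in> F"
begin

lemma zero [simp]: "0 \<in> F"
  using minus[OF one one] by simp

lemma uminus [simp]: "x \<in> F \<Longrightarrow> - x \<in> F"
  using minus[OF zero] by fastforce

lemma add [simp]: "x \<in> F \<Longrightarrow> y \<in> F \<Longrightarrow> x + y \<in> F"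
  using minus[of x "-y"] by simp

lemma divide [simp]: "x \<in> F \<Longrightarrow> y \<in> F \<Longrightarrow> x / y \<in> F"
  by (simp add: divide_inverse)

lemma power [simp]: "x \<in> F \<Longrightarrow> x ^ k \<in> F"
  by (induction k) auto

lemma sum [simp]: "(\<And>s. s \<in> S \<Longrightarrow> f s \<in> F) \<Longrightarrow> sum f S \<in> F"
  by (induction S rule: infinite_finite_induct) auto

end

lemma fract_of_in_rat_fun_field: "p \<in> polys_in n \<Longrightarrow> fract_of p \<in> rat_fun_field n"
  unfolding rat_fun_field_iff by (intro bexI[of _ p] bexI[of _ 1]) auto

interpretation rff: subfield_set "rat_fun_field n" for n
proof
  show "1 \<in> rat_fun_field n" using fract_of_in_rat_fun_field[of 1 n] by simp
next
  fix x y assume "x \<in> rat_fun_field n" "y \<in> rat_fun_field n"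
  then obtain p q p' q' where *: "p \<in> polys_in n" "q \<in> polys_in n" "q \<noteq> 0" "x = fract_of p / fract_of q"
     "p' \<in> polys_in n" "q' \<in> polys_in n" "q' \<noteq> 0" "y = fract_of p' / fract_of q'"
    unfolding rat_fun_field_iff by blast
  then have "x - y = fract_of (p * q' + - (p' * q)) / fract_of (q * q')"
    by (simp add: diff_frac_eq)
  moreover have "p * q' + - (p' * q) \<in> polys_in n" "q * q' \<in> polys_in n" "q * q' \<noteq> 0" "p * p' \<in> polys_in n"
    using * by (simp_all add: polys_in_add polys_in_uminus polys_in_mult del: add_uminus_conv_diff)
  moreover have "x * y = fract_of (p * p') / fract_of (q * q')" using * by simp
  ultimately show "x - y \<in> rat_fun_field n" "x * y \<in> rat_fun_field n"
    unfolding rat_fun_field_iff by blast+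
next
  fix x assume "x \<in> rat_fun_field n"
  then obtain p q where *: "p \<in> polys_in n" "q \<in> polys_in n" "q \<noteq> 0" "x = fract_of p / fract_of q"
    unfolding rat_fun_field_iff by blast
  show "inverse x \<in> rat_fun_field n"
  proof (cases "p = 0")
    case True
    then show ?thesis using * fract_of_in_rat_fun_field[of 0 n] by simp
  next
    case False
    then show ?thesis unfolding rat_fun_field_iff
      using * by (intro bexI[of _ q] bexI[of _ p]) auto
  qed
qed

lemma common_denominator:
  fixes a :: "'s \<Rightarrow> ratfun"
  assumes "finite S" "\<And>s. s \<in> S \<Longrightarrow> a s \<in> rat_fun_field n"
  shows "\<exists>q p. q \<noteq> 0 \<and> q \<in> polys_in n \<and> (\<forall>s\<in>S. p s \<in> polys_in n \<and> fract_of (p s) = fract_of q * a s)"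
  using assms
proof (induction S rule: finite_induct)
  case empty
  show ?case by (intro exI[of _ 1]) auto
next
  case (insert s S)
  obtain q p where q: "q \<noteq> 0" "q \<in> polys_in n" "\<forall>s\<in>S. p s \<in> polys_in n \<and> fract_of (p s) = fract_of q * a s"
    using insert.IH insert.prems by auto
  obtain p' q' where p': "p' \<in> polys_in n" "q' \<in> polys_in n" "q' \<noteq> 0" "a s = fract_of p' / fract_of q'"
    using insert.prems[of s] unfolding rat_fun_field_iff by blast
  show ?case
    by (intro exI[of _ "q' * q"] exI[of _ "\<lambda>t. if t = s then p' * q else q' * p t"])
      (use q p' in \<open>auto intro: polys_in_mult\<close>)
qed

text \<open>Bounding each exponent rather than the total degree makes the number of monomials
  exactly s^n for s > 0, which keeps the comparison of unknowns and equations elementary.\<close>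

definition box :: "nat \<Rightarrow> nat \<Rightarrow> (nat \<Rightarrow>\<^sub>0 nat) set" where
  "box n s = {m. Poly_Mapping.keys m \<subseteq> {..<n} \<and> (\<forall>i. Poly_Mapping.lookup m i < s)}"

lemma box_mono: "s \<le> t \<Longrightarrow> box n s \<subseteq> box n t"
  unfolding box_def by (simp add: Collect_mono_iff) (meson order.strict_trans2)

lemma bij_betw_box:
  assumes "s > 0"
  shows "bij_betw (\<lambda>m. restrict (Poly_Mapping.lookup m) {..<n}) (box n s) ({..<n} \<rightarrow>\<^sub>E {..<s})"
proof (rule bij_betwI')
  fix x y assume xy: "x \<in> box n s" "y \<in> box n s"
  show "(restrict (Poly_Mapping.lookup x) {..<n} = restrict (Poly_Mapping.lookup y) {..<n}) = (x = y)"
  proof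
    assume eq: "restrict (Poly_Mapping.lookup x) {..<n} = restrict (Poly_Mapping.lookup y) {..<n}"
    show "x = y"
    proof (rule poly_mapping_eqI)
      fix i show "Poly_Mapping.lookup x i = Poly_Mapping.lookup y i"
      proof (cases "i < n")
        case True
        then show ?thesis using fun_cong[OF eq, of i] by simp
      next
        case False
        then have "i \<notin> Poly_Mapping.keys x" "i \<notin> Poly_Mapping.keys y" using xy by (auto simp: box_def)
        then show ?thesis by (simp add: in_keys_iff)
      qed
    qed
  qed simp
next
  fix x assume "x \<in> box n s"
  then show "restrict (Poly_Mapping.lookup x) {..<n} \<in> {..<n} \<rightarrow>\<^sub>E {..<s}" by (auto simp: box_def)
next
  fix e assume e: "e \<in> {..<n} \<rightarrow>\<^sub>E {..<s}"
  define m where "m = Abs_poly_mapping (\<lambda>i. if i < n then e i else 0)"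
  have m: "Poly_Mapping.lookup m = (\<lambda>i. if i < n then e i else 0)"
    unfolding m_def by (rule lookup_Abs_poly_mapping) (auto intro: finite_subset[of _ "{..<n}"])
  have "m \<in> box n s" using e assms by (auto simp: box_def in_keys_iff m PiE_iff split: if_splits)
  moreover have "e = restrict (Poly_Mapping.lookup m) {..<n}"
    using e by (auto simp: fun_eq_iff m PiE_iff extensional_def)
  ultimately show "\<exists>x\<in>box n s. e = restrict (Poly_Mapping.lookup x) {..<n}" by blast
qed

lemma card_box: "s > 0 \<Longrightarrow> card (box n s) = s ^ n"
  using bij_betw_same_card[OF bij_betw_box] by (simp add: card_PiE)

lemma finite_box: "finite (box n s)"
proof (cases "s > 0")
  case True
  then show ?thesis using bij_betw_finite[OF bij_betw_box] by (simp add: finite_PiE)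
qed (simp add: box_def)

lemma box_add: "a \<in> box n s \<Longrightarrow> b \<in> box n t \<Longrightarrow> a + b \<in> box n (s + t)"
  using subset_trans[OF Poly_Mapping.keys_add[of a b], of "{..<n}"]
  by (simp add: box_def lookup_add add_less_mono)

lemma keys_mult_box:
  assumes "Poly_Mapping.keys p \<subseteq> box n s" "Poly_Mapping.keys q \<subseteq> box n t"
  shows "Poly_Mapping.keys (p * q) \<subseteq> box n (s + t)"
proof
  fix m assume "m \<in> Poly_Mapping.keys (p * q)"
  then obtain a b where "m = a + b" "a \<in> Poly_Mapping.keys p" "b \<in> Poly_Mapping.keys q"
    using keys_mult[of p q] by blast
  then show "m \<in> box n (s + t)" using assms box_add by blast
qed

lemma keys_subset_box:
  assumes "p \<in> polys_in n"
  shows "\<exists>d. Poly_Mapping.keys p \<subseteq> box n d"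
proof -
  define d where "d = Suc (\<Sum>m\<in>Poly_Mapping.keys p. \<Sum>i\<in>Poly_Mapping.keys m. Poly_Mapping.lookup m i)"
  have "Poly_Mapping.lookup m i < d" if m: "m \<in> Poly_Mapping.keys p" for m i
  proof (cases "i \<in> Poly_Mapping.keys m")
    case True
    then have "Poly_Mapping.lookup m i \<le> (\<Sum>i\<in>Poly_Mapping.keys m. Poly_Mapping.lookup m i)"
      by (intro member_le_sum) auto
    also have "\<dots> \<le> (\<Sum>m\<in>Poly_Mapping.keys p. \<Sum>i\<in>Poly_Mapping.keys m. Poly_Mapping.lookup m i)"
      by (rule member_le_sum[OF m]) auto
    finally show ?thesis by (simp add: d_def)
  qed (simp add: d_def in_keys_iff)
  then show ?thesis using assms by (intro exI[of _ d]) (auto simp: box_def polys_in_iff)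
qed

lemma keys_subset_box_finite:
  assumes "finite S" "\<And>s. s \<in> S \<Longrightarrow> p s \<in> polys_in n"
  shows "\<exists>d. \<forall>s\<in>S. Poly_Mapping.keys (p s) \<subseteq> box n d"
  using assms
proof (induction S rule: finite_induct)
  case (insert s S)
  then obtain d where d: "\<forall>s\<in>S. Poly_Mapping.keys (p s) \<subseteq> box n d" by auto
  obtain d' where d': "Poly_Mapping.keys (p s) \<subseteq> box n d'" using keys_subset_box[of "p s" n] insert.prems by auto
  show ?case using d d' box_mono[of d "max d d'" n] box_mono[of d' "max d d'" n]
    by (intro exI[of _ "max d d'"]) auto
qed simp

lemma lookup_single_times: "Poly_Mapping.lookup (Poly_Mapping.single 0 c * p) m = c * Poly_Mapping.lookup p m"
  for c :: "'a::comm_semiring_1"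
  by (simp add: mult_map_scale_conv_mult[symmetric] Poly_Mapping.map.rep_eq when_def)

text \<open>The quotient (2 s + d)^n / s^n tends to 2^n. The factor 2 is the degree of the
  equations; d accounts for the degrees of their coefficients.\<close>

lemma exists_box_size:
  fixes k N d n :: nat
  assumes "k * 2 ^ n < N"
  shows "\<exists>s>0. k * (2 * s + d) ^ n < N * s ^ n"
proof -
  have "(\<lambda>s. real k * (2 + real d / real s) ^ n) \<longlonglongrightarrow> real k * (2 + 0) ^ n"
    by (intro tendsto_intros lim_const_over_n)
  moreover have "real k * (2 + 0) ^ n < real N"
  proof -
    have "real (k * 2 ^ n) < real N" using assms by (simp only: of_nat_less_iff)
    then show ?thesis by simp
  qed
  ultimately have "eventually (\<lambda>s. real k * (2 + real d / real s) ^ n < real N) sequentially"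
    by (rule order_tendstoD)
  then have "eventually (\<lambda>s. real k * (2 + real d / real s) ^ n < real N \<and> s > 0) sequentially"
    using eventually_gt_at_top[of 0] by (rule eventually_conj)
  then obtain s where s: "real k * (2 + real d / real s) ^ n < real N" "s > 0"
    by (metis (mono_tags, lifting) eventually_sequentially order_refl)
  have "real (k * (2 * s + d) ^ n) = real k * (2 + real d / real s) ^ n * real s ^ n"
  proof -
    have "(2 + real d / real s) * real s = real (2 * s + d)" using s(2) by (simp add: field_simps)
    then show ?thesis by (simp add: mult.assoc flip: power_mult_distrib)
  qed
  also have "\<dots> < real N * real s ^ n" using s by (intro mult_strict_right_mono) auto
  finally have "real (k * (2 * s + d) ^ n) < real (N * s ^ n)" by simp
  then show ?thesis using s(2) by (auto simp only: of_nat_less_iff)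
qed

lemma hpolyfun_scale_right: "hpolyfun I d f \<Longrightarrow> hpolyfun I d (\<lambda>z. f z * c)"
  using hpolyfun_scale[of I d f c] by (simp add: mult.commute)

text \<open>Tsen-Lang: polynomial unknowns of degree less than \<open>s\<close> in each variable turn the system into
  quadratic equations over \<open>\<complex>\<close>; for large \<open>s\<close> there are more unknowns than equations.\<close>
lemma diagonal_system_isotropic:
  fixes a :: "'k \<Rightarrow> 'j \<Rightarrow> ratfun"
  assumes J: "finite J" and K: "finite K" and card: "card K * 2 ^ n < card J"
    and a: "\<And>k j. k \<in> K \<Longrightarrow> j \<in> J \<Longrightarrow> a k j \<in> rat_fun_field n"
  shows "\<exists>v. (\<forall>j\<in>J. v j \<in> rat_fun_field n) \<and> (\<exists>j\<in>J. v j \<noteq> 0) \<and> (\<forall>k\<in>K. (\<Sum>j\<in>J. a k j * (v j)\<^sup>2) = 0)"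
proof -
  have "\<exists>q p. q \<noteq> 0 \<and> q \<in> polys_in n \<and> (\<forall>s\<in>K \<times> J. p s \<in> polys_in n \<and> fract_of (p s) = fract_of q * (case s of (k, j) \<Rightarrow> a k j))"
    using J K a by (intro common_denominator) auto
  then obtain q p where q: "q \<noteq> 0"
    and "\<forall>s\<in>K \<times> J. p s \<in> polys_in n \<and> fract_of (p s) = fract_of q * (case s of (k, j) \<Rightarrow> a k j)" by blast
  then have p: "\<And>k j. k \<in> K \<Longrightarrow> j \<in> J \<Longrightarrow> p (k, j) \<in> polys_in n"
    "\<And>k j. k \<in> K \<Longrightarrow> j \<in> J \<Longrightarrow> fract_of (p (k, j)) = fract_of q * a k j" by auto
  have "\<exists>d. \<forall>s\<in>K \<times> J. Poly_Mapping.keys (p s) \<subseteq> box n d"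
    using J K p(1) by (intro keys_subset_box_finite) auto
  then obtain d where d: "\<And>k j. k \<in> K \<Longrightarrow> j \<in> J \<Longrightarrow> Poly_Mapping.keys (p (k, j)) \<subseteq> box n d"
    by (auto simp: Ball_def)
  obtain s where s: "s > 0" "card K * (2 * s + d) ^ n < card J * s ^ n"
    using exists_box_size[OF card] by blast
  \<comment> \<open>\<open>V t j\<close> is a polynomial with undetermined coefficients t (j,
    \<alpha>), and \<open>Q t k\<close> is the left side of equation k after clearing denominators.
    The coefficients of \<open>Q t k\<close> are quadratic forms in t.\<close>
  define V where "V = (\<lambda>t (j::'j). \<Sum>\<alpha>\<in>box n s. Poly_Mapping.single \<alpha> (t (j, \<alpha>) :: complex))"
  define Q where "Q = (\<lambda>t k. \<Sum>j\<in>J. p (k, j) * (V t j)\<^sup>2)"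
  have lookup_V: "Poly_Mapping.lookup (V t j) \<alpha> = t (j, \<alpha>)" if "\<alpha> \<in> box n s" for t j \<alpha>
    using that finite_box[of n s] by (simp add: V_def lookup_sum lookup_single when_def)
  have keys_V: "Poly_Mapping.keys (V t j) \<subseteq> box n s" for t j
    using finite_box[of n s] by (auto simp: V_def lookup_sum lookup_single in_keys_iff when_def split: if_splits)
  have V_in: "V t j \<in> polys_in n" for t j
    using keys_V[of t j] by (auto simp: polys_in_iff box_def)
  have "\<exists>t. (\<exists>i\<in>J \<times> box n s. t i \<noteq> 0) \<and> (\<forall>e\<in>K \<times> box n (2 * s + d). Poly_Mapping.lookup (Q t (fst e)) (snd e) = 0)"
  proof (rule hpolyfun_system_zero)
    show "finite (J \<times> box n s)" "finite (K \<times> box n (2 * s + d))" using J K finite_box by auto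
    show "card (K \<times> box n (2 * s + d)) < card (J \<times> box n s)"
      using s by (simp add: card_cartesian_product card_box)
    show "hpolyfun (J \<times> box n s) 2 (\<lambda>t. Poly_Mapping.lookup (Q t (fst e)) (snd e))" for e
    proof -
      have V2: "(V t j)\<^sup>2 = (\<Sum>\<alpha>\<in>box n s. \<Sum>\<beta>\<in>box n s. Poly_Mapping.single 0 (t (j, \<alpha>) * t (j, \<beta>)) * Poly_Mapping.single (\<alpha> + \<beta>) 1)" for t j
        by (simp add: V_def power2_eq_square sum_product mult_single)
      have "Q t k = (\<Sum>j\<in>J. \<Sum>\<alpha>\<in>box n s. \<Sum>\<beta>\<in>box n s.
          Poly_Mapping.single 0 (t (j, \<alpha>) * t (j, \<beta>)) * (p (k, j) * Poly_Mapping.single (\<alpha> + \<beta>) 1))" for t k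
        by (simp add: Q_def V2 sum_distrib_left mult.left_commute)
      then have "Poly_Mapping.lookup (Q t k) \<mu> = (\<Sum>j\<in>J. \<Sum>\<alpha>\<in>box n s. \<Sum>\<beta>\<in>box n s.
          (t (j, \<alpha>) * t (j, \<beta>)) * Poly_Mapping.lookup (p (k, j) * Poly_Mapping.single (\<alpha> + \<beta>) 1) \<mu>)" for t k \<mu>
        by (simp add: lookup_sum lookup_single_times)
      moreover have "hpolyfun (J \<times> box n s) 2 (\<lambda>t :: 'j \<times> (nat \<Rightarrow>\<^sub>0 nat) \<Rightarrow> complex. t (j, \<alpha>) * t (j, \<beta>))"
        if "j \<in> J" "\<alpha> \<in> box n s" "\<beta> \<in> box n s" for j \<alpha> \<beta>
        using hpolyfun.mult[OF hpolyfun.var hpolyfun.var, of "(j, \<alpha>)" "J \<times> box n s" "(j, \<beta>)"] that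
        by (simp add: numeral_2_eq_2)
      ultimately show ?thesis
        by (simp only:) (intro hpolyfun_sum hpolyfun_scale_right)
    qed
  qed simp
  then obtain t j0 \<alpha>0 where t: "j0 \<in> J" "\<alpha>0 \<in> box n s" "t (j0, \<alpha>0) \<noteq> 0"
    and zero: "\<And>k \<mu>. k \<in> K \<Longrightarrow> \<mu> \<in> box n (2 * s + d) \<Longrightarrow> Poly_Mapping.lookup (Q t k) \<mu> = 0" by auto
  have Q0: "Q t k = 0" if k: "k \<in> K" for k
  proof (rule poly_mapping_eqI)
    fix \<mu>
    \<comment> \<open>Exponents outside the box cannot occur: the coefficient contributes d and each
      of the two factors \<open>V t j\<close> contributes s.\<close>
    have "Poly_Mapping.keys (p (k, j) * (V t j)\<^sup>2) \<subseteq> box n (2 * s + d)" if "j \<in> J" for j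
      using keys_mult_box[OF d[OF k that] keys_mult_box[OF keys_V keys_V]]
      by (simp add: power2_eq_square mult_2 add.commute add.left_commute)
    then have "\<mu> \<notin> box n (2 * s + d) \<Longrightarrow> Poly_Mapping.lookup (Q t k) \<mu> = 0"
      unfolding Q_def lookup_sum
      by (intro sum.neutral ballI) (simp add: subset_iff not_in_keys_iff_lookup_eq_zero[symmetric], blast)
    then show "Poly_Mapping.lookup (Q t k) \<mu> = Poly_Mapping.lookup 0 \<mu>"
      using zero[OF k, of \<mu>] by (cases "\<mu> \<in> box n (2 * s + d)") simp_all
  qed
  show ?thesis
  proof (intro exI[of _ "\<lambda>j. fract_of (V t j)"] conjI ballI)
    show "fract_of (V t j) \<in> rat_fun_field n" for j by (intro fract_of_in_rat_fun_field V_in)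
    have "V t j0 \<noteq> 0" using lookup_V[OF t(2), of t j0] t(3) by auto
    then show "\<exists>j\<in>J. fract_of (V t j) \<noteq> 0" using t(1) by auto
    fix k assume k: "k \<in> K"
    have "fract_of q * (\<Sum>j\<in>J. a k j * (fract_of (V t j))\<^sup>2) = fract_of (Q t k)"
      using p(2)[OF k] by (simp add: Q_def fract_of_sum sum_distrib_left mult.assoc[symmetric])
    then show "(\<Sum>j\<in>J. a k j * (fract_of (V t j))\<^sup>2) = 0"
      using Q0[OF k] q by simp
  qed
qed

section \<open>Isometry of diagonal forms and Pfister forms\<close>

definition scale :: "'a::times \<Rightarrow> 'a multiset \<Rightarrow> 'a multiset" where
  "scale c M = image_mset ((*) c) M"

lemma scale_simps [simp]: "scale c {#} = {#}" "scale c (add_mset a M) = add_mset (c * a) (scale c M)"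
  "scale c (M + N) = scale c M + scale c N" "size (scale c M) = size M"
  by (simp_all add: scale_def)

lemma scale_scale [simp]: "scale c (scale d M) = scale (c * d) M" for c :: "'a::semigroup_mult"
  by (induction M) (simp_all add: mult.assoc)

lemma scale_one [simp]: "scale 1 M = M" for M :: "'a::monoid_mult multiset"
  by (induction M) simp_all

text \<open>A diagonal bilinear form is encoded as the multiset of its diagonal entries; \<open>relative_pure_part ps rs\<close>
  is the orthogonal complement of \<open>\<langle>\<langle>ps\<rangle>\<rangle>\<close> in \<open>\<langle>\<langle>rs @ ps\<rangle>\<rangle>\<close>.\<close>
fun pfister_mset :: "'a::comm_ring_1 list \<Rightarrow> 'a multiset" where
  "pfister_mset [] = {#1#}"
| "pfister_mset (a # as) = pfister_mset as + scale (- a) (pfister_mset as)"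

fun relative_pure_part :: "'a::comm_ring_1 list \<Rightarrow> 'a list \<Rightarrow> 'a multiset" where
  "relative_pure_part ps [] = {#}"
| "relative_pure_part ps (a # rs) = relative_pure_part ps rs + scale (- a) (pfister_mset (rs @ ps))"

lemma pfister_mset_append: "pfister_mset (rs @ ps) = pfister_mset ps + relative_pure_part ps rs"
  by (induction rs) simp_all

lemma size_pfister_mset: "size (pfister_mset as) = 2 ^ length as"
  by (induction as) simp_all

lemma size_relative_pure_part: "size (relative_pure_part ps rs) = 2 ^ (length rs + length ps) - 2 ^ length ps"
  using arg_cong[OF pfister_mset_append[of rs ps], of size] by (simp add: size_pfister_mset)

lemma pfister_mset_middle: "pfister_mset (xs @ a # ys) = pfister_mset (a # xs @ ys)"
  by (induction xs) (simp_all add: ac_simps)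

section \<open>Chain equivalence, roundness and the pure subform theorem\<close>

context subfield_set
begin

text \<open>Witt's chain equivalence: an elementary move changes at most two entries. In
  \<open>plane\<close> the new vectors (p, r) and (q, s) are orthogonal but may be dependent;
  invertibility is recovered later from a target without zero entries.\<close>

inductive diag_isometric :: "'a multiset \<Rightarrow> 'a multiset \<Rightarrow> bool" where
  refl: "diag_isometric M M"
| square: "t \<in> F \<Longrightarrow> t \<noteq> 0 \<Longrightarrow> diag_isometric (add_mset a M) (add_mset (a * t\<^sup>2) M)"
| plane: "p \<in> F \<Longrightarrow> q \<in> F \<Longrightarrow> r \<in> F \<Longrightarrow> s \<in> F \<Longrightarrow> a * p * q + b * r * s = 0 \<Longrightarrow>
    diag_isometric (add_mset a (add_mset b M)) (add_mset (a * p\<^sup>2 + b * r\<^sup>2) (add_mset (a * q\<^sup>2 + b * s\<^sup>2) M))"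
| trans: "diag_isometric L M \<Longrightarrow> diag_isometric M N \<Longrightarrow> diag_isometric L N"

declare diag_isometric.trans [trans]

lemma iso_add_right: "diag_isometric M N \<Longrightarrow> diag_isometric (M + K) (N + K)"
proof (induction rule: diag_isometric.induct)
  case (trans L M N)
  then show ?case using diag_isometric.trans by blast
qed (auto intro: diag_isometric.intros)

lemma iso_add:
  assumes "diag_isometric M N" "diag_isometric M' N'"
  shows "diag_isometric (M + M') (N + N')"
  using iso_add_right[OF assms(1), of M'] iso_add_right[OF assms(2), of N] diag_isometric.trans
  by (simp add: union_commute)

lemma iso_scale: "diag_isometric M N \<Longrightarrow> diag_isometric (scale c M) (scale c N)"
proof (induction rule: diag_isometric.induct)
  case (square t a M)
  then show ?case using diag_isometric.square[of t "c * a" "scale c M"] by (simp add: mult.assoc)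
next
  case (plane p q r s a b M)
  have "c * a * p * q + c * b * r * s = c * (a * p * q + b * r * s)" by (simp add: algebra_simps)
  then show ?case
    using diag_isometric.plane[OF plane(1-4), of "c * a" "c * b" "scale c M"] plane(5)
    by (simp only: scale_simps distrib_left mult.assoc[symmetric] mult_zero_right)
next
  case (trans L M N)
  then show ?case using diag_isometric.trans by blast
qed (rule diag_isometric.refl)

lemma iso_scale_square: "t \<in> F \<Longrightarrow> t \<noteq> 0 \<Longrightarrow> diag_isometric (scale c M) (scale (c * t\<^sup>2) M)"
proof (induction M)
  case (add a M)
  have "diag_isometric (add_mset (c * a) (scale c M)) (add_mset (c * a * t\<^sup>2) (scale c M))"
    by (rule diag_isometric.square[OF add.prems])
  moreover have "diag_isometric (add_mset (c * a * t\<^sup>2) (scale c M)) (add_mset (c * a * t\<^sup>2) (scale (c * t\<^sup>2) M))"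
    using iso_add[OF diag_isometric.refl[of "{#c * a * t\<^sup>2#}"] add.IH[OF add.prems]] by simp
  ultimately show ?case by (auto intro: diag_isometric.trans simp: ac_simps)
qed (simp add: diag_isometric.refl)

lemma iso_scale_square_cancel:
  assumes "t \<in> F" "t \<noteq> 0"
  shows "diag_isometric (scale (c * t\<^sup>2) M) (scale c M)"
  using iso_scale_square[of "inverse t" "c * t\<^sup>2" M] assms by (simp add: power_inverse mult.assoc)

text \<open>The plane move with the vectors (1, 1) and (y, -x), carried out for every entry of
  \<open>M\<close>. The case x + y = 0 is allowed and produces zero entries.\<close>

lemma iso_scale_plane:
  assumes "x \<in> F" "y \<in> F"
  shows "diag_isometric (scale x M + scale y M) (scale (x + y) M + scale (x * y * (x + y)) M)"
proof (induction M)
  case (add a M)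
  have "diag_isometric (add_mset (x * a) (add_mset (y * a) (scale x M + scale y M)))
     (add_mset (x * a * 1\<^sup>2 + y * a * 1\<^sup>2) (add_mset (x * a * y\<^sup>2 + y * a * (- x)\<^sup>2) (scale x M + scale y M)))"
    by (rule diag_isometric.plane) (use assms in \<open>simp_all add: algebra_simps\<close>)
  also have "diag_isometric \<dots> (add_mset (x * a * 1\<^sup>2 + y * a * 1\<^sup>2) (add_mset (x * a * y\<^sup>2 + y * a * (- x)\<^sup>2)
       (scale (x + y) M + scale (x * y * (x + y)) M)))"
    using iso_add[OF diag_isometric.refl[of "{#x * a * 1\<^sup>2 + y * a * 1\<^sup>2, x * a * y\<^sup>2 + y * a * (- x)\<^sup>2#}"] add.IH] by simp
  finally show ?case by (simp add: algebra_simps power2_eq_square add_mset_commute)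
qed (simp add: diag_isometric.refl)

text \<open>The zero vector counts, so 0 is always a value; statements about slots therefore ask for
  nonzero values.\<close>

inductive represents :: "'a multiset \<Rightarrow> 'a \<Rightarrow> bool" where
  empty: "represents {#} 0"
| add: "represents M y \<Longrightarrow> t \<in> F \<Longrightarrow> represents (add_mset a M) (a * t\<^sup>2 + y)"

lemma represents_add_msetD:
  "represents N z \<Longrightarrow> N = add_mset a M \<Longrightarrow> \<exists>t y. t \<in> F \<and> represents M y \<and> z = a * t\<^sup>2 + y"
proof (induction arbitrary: M rule: represents.induct)
  case (add N y t b)
  show ?case
  proof (cases "a = b \<and> N = M")
    case True
    then show ?thesis using add by blast
  next
    case False
    then obtain K where K: "N = add_mset a K" "M = add_mset b K"
      using add.prems by (auto simp: add_eq_conv_ex)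
    from add.IH[OF K(1)] obtain s x where s: "s \<in> F" "represents K x" "y = a * s\<^sup>2 + x" by blast
    have "represents M (b * t\<^sup>2 + x)" using represents.add[OF s(2) add.hyps(2)] K(2) by simp
    then show ?thesis using s by (intro exI[of _ s] exI[of _ "b * t\<^sup>2 + x"]) (simp add: algebra_simps)
  qed
qed simp

lemma represents_unionD:
  "represents (M + N) z \<Longrightarrow> \<exists>x y. represents M x \<and> represents N y \<and> z = x + y"
proof (induction M arbitrary: z)
  case empty
  then show ?case by (intro exI[of _ 0] exI[of _ z]) (auto intro: represents.empty)
next
  case (add a M)
  then obtain t w where t: "t \<in> F" "represents (M + N) w" "z = a * t\<^sup>2 + w"
    using represents_add_msetD[of "add_mset a M + N" z a "M + N"] by auto
  from add.IH[OF t(2)] obtain x y where "represents M x" "represents N y" "w = x + y" by blast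
  then show ?case using t represents.add[of M x t a]
    by (intro exI[of _ "a * t\<^sup>2 + x"] exI[of _ y]) (simp add: algebra_simps)
qed

lemma represents_emptyD: "represents {#} z \<Longrightarrow> z = 0"
  by (cases rule: represents.cases) auto

lemma represents_scaleD: "represents (scale c M) z \<Longrightarrow> \<exists>y. represents M y \<and> z = c * y"
proof (induction M arbitrary: z)
  case empty
  then show ?case using represents_emptyD represents.empty by fastforce
next
  case (add a M)
  then obtain t w where t: "t \<in> F" "represents (scale c M) w" "z = c * a * t\<^sup>2 + w"
    using represents_add_msetD[of "scale c (add_mset a M)" z "c * a" "scale c M"] by auto
  from add.IH[OF t(2)] obtain y where "represents M y" "w = c * y" by blast
  then show ?case using t represents.add[of M y t a]
    by (intro exI[of _ "a * t\<^sup>2 + y"]) (simp add: algebra_simps)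
qed

lemma represents_in: "represents M y \<Longrightarrow> set_mset M \<subseteq> F \<Longrightarrow> y \<in> F"
  by (induction rule: represents.induct) auto

lemma pfister_mset_subset: "set as \<subseteq> F - {0} \<Longrightarrow> set_mset (pfister_mset as) \<subseteq> F - {0}"
  by (induction as) (auto simp: scale_def)

lemma relative_pure_part_subset:
  assumes "set ps \<subseteq> F - {0}" "set rs \<subseteq> F - {0}"
  shows "set_mset (relative_pure_part ps rs) \<subseteq> F - {0}"
  using pfister_mset_subset[of "rs @ ps"] assms by (auto simp: pfister_mset_append)

text \<open>Pfister forms are round. For y = s - a t with s and t values of \<open>P\<close>, the
  factors s and t are inserted by induction, the plane move turns <s, -a t> into <y, -a s t y>, and
  s t is absorbed again. If s or t is 0, one insertion suffices.\<close>

lemma represents_pfister_mset: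
  assumes "set as \<subseteq> F - {0}" "represents (pfister_mset as) y" "y \<noteq> 0"
  shows "diag_isometric (pfister_mset as) (scale y (pfister_mset as))"
  using assms
proof (induction as arbitrary: y)
  case Nil
  then obtain t where "t \<in> F" "y = t\<^sup>2"
    using represents_add_msetD[of "{#1#}" y 1 "{#}"] represents_emptyD by fastforce
  then show ?case using Nil diag_isometric.square[of t 1 "{#}"] by auto
next
  case (Cons a as)
  define P where "P = pfister_mset as"
  have a: "a \<in> F" "a \<noteq> 0" and as: "set as \<subseteq> F - {0}" using Cons.prems by auto
  have PF: "set_mset P \<subseteq> F" using pfister_mset_subset[OF as] by (auto simp: P_def)
  obtain s t where st: "represents P s" "represents P t" "y = s + (- a) * t"
    using Cons.prems(2) represents_unionD[of P "scale (- a) P"] represents_scaleD[of "- a" P]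
    unfolding P_def by fastforce
  have IH: "diag_isometric P (scale z P)" if "represents P z" "z \<noteq> 0" for z
    using Cons.IH[OF as] that by (simp add: P_def)
  have in_F: "s \<in> F" "t \<in> F" using st represents_in PF by auto
  consider "t = 0" | "s = 0" "t \<noteq> 0" | "s \<noteq> 0" "t \<noteq> 0" by blast
  then have "diag_isometric (P + scale (- a) P) (scale y (P + scale (- a) P))"
  proof cases
    case 1
    then have "diag_isometric P (scale y P)" using IH[OF st(1)] st(3) Cons.prems(3) by simp
    then show ?thesis using iso_add[OF _ iso_scale, of P "scale y P" P "scale y P" "- a"]
      by (simp add: ac_simps)
  next
    case 2
    then have y: "y = - a * t" using st(3) by simp
    have "diag_isometric P (scale t P)" using IH[OF st(2)] 2 by simp
    then have 1: "diag_isometric (scale (- a) P) (scale y P)" using iso_scale[of P "scale t P" "- a"] y by simp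
    have "diag_isometric P (scale (t * a\<^sup>2) P)" using diag_isometric.trans[OF \<open>diag_isometric P (scale t P)\<close> iso_scale_square[OF a]] .
    then have 2: "diag_isometric P (scale (y * - a) P)" using y by (simp add: power2_eq_square ac_simps)
    show ?thesis using iso_add[OF 2 1] by (simp add: union_commute)
  next
    case 3
    have 1: "diag_isometric P (scale s P)" "diag_isometric P (scale t P)" using IH st 3 by auto
    have "diag_isometric (P + scale (- a) P) (scale s P + scale (- a * t) P)"
      using iso_add[OF 1(1) iso_scale[OF 1(2), of "- a"]] by simp
    also have "diag_isometric \<dots> (scale y P + scale (s * (- a * t) * y) P)"
      using iso_scale_plane[of s "- a * t" P] in_F a st(3) by simp
    also have "diag_isometric \<dots> (scale y P + scale (y * - a) P)"
    proof (rule iso_add[OF diag_isometric.refl])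
      \<comment> \<open>\<open>P\<close> absorbs s and t one at a time: multiply by t and discard
        t^2, then multiply by s and discard s^2.\<close>
      have "diag_isometric (scale (s * t) P) (scale (s * s\<^sup>2 * t\<^sup>2) P)"
      proof -
        have "diag_isometric (scale (s * t) P) (scale (s * t * t) P)" using iso_scale[OF 1(2), of "s * t"] by simp
        moreover have "diag_isometric (scale (s * t * t) P) (scale (s * t * t * s\<^sup>2) P)"
          by (rule iso_scale_square) (use in_F 3 in auto)
        ultimately show ?thesis using diag_isometric.trans by (simp add: power2_eq_square ac_simps)
      qed
      moreover have "diag_isometric (scale (s * s\<^sup>2 * t\<^sup>2) P) (scale s P)"
        using iso_scale_square_cancel[of "s * t" s P] in_F 3 by (simp add: power_mult_distrib mult.assoc)
      moreover have "diag_isometric (scale s P) (scale (s * s) P)" using iso_scale[OF 1(1), of s] by simp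
      moreover have "diag_isometric (scale (s * s) P) P"
        using iso_scale_square_cancel[of s 1 P] in_F 3 by (simp add: power2_eq_square)
      ultimately have "diag_isometric (scale (s * t) P) P" using diag_isometric.trans by blast
      from iso_scale[OF this, of "- a * y"]
      show "diag_isometric (scale (s * (- a * t) * y) P) (scale (y * - a) P)" by (simp add: ac_simps)
    qed
    finally show ?thesis by simp
  qed
  then show ?case by (simp add: P_def)
qed

lemma iso_pfister_mset_Cons:
  "diag_isometric (pfister_mset as) (pfister_mset bs) \<Longrightarrow> diag_isometric (pfister_mset (a # as)) (pfister_mset (a # bs))"
  by (simp add: iso_add iso_scale)

text \<open>The blocks of <<z, x>> are 1, -x, -z and x z. The plane move acts on -x and -z only, and
  the untouched block x z becomes the one of the slot -x z.\<close>

lemma iso_pfister_mset_chain: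
  assumes "x \<in> F" "z \<in> F"
  shows "diag_isometric (pfister_mset (z # x # as)) (pfister_mset ((x + z) # (- x * z) # as))"
proof -
  define T where "T = pfister_mset as"
  have "diag_isometric (scale (- x) T + scale (- z) T) (scale (- x - z) T + scale (x * (z * (- x - z))) T)"
    using iso_scale_plane[of "- x" "- z" T] assms by (simp add: mult.assoc)
  from iso_add[OF diag_isometric.refl[of "T + scale (x * z) T"] this] show ?thesis
    by (simp add: T_def[symmetric] ac_simps)
qed

text \<open>Splitting off the first slot a gives c = x + a y, where -x is a value of the pure part
  of the remaining slots and y a value of their whole form. Roundness replaces the slot a by a y,
  induction makes x a slot, and the chain relation merges the two into c; if x or y is 0, the other
  summand alone is c. The factor \<open>ps\<close> stays fixed throughout.\<close>

lemma pure_subform: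
  assumes "set ps \<subseteq> F - {0}" "set rs \<subseteq> F - {0}" "c \<noteq> 0" "represents (relative_pure_part ps rs) (- c)"
  shows "\<exists>rs'. Suc (length rs') = length rs \<and> set rs' \<subseteq> F - {0} \<and>
    diag_isometric (pfister_mset (rs @ ps)) (pfister_mset (c # rs' @ ps))"
  using assms(2-4)
proof (induction rs arbitrary: c)
  case Nil
  then show ?case using represents_emptyD by fastforce
next
  case (Cons a rs)
  define Q where "Q = pfister_mset (rs @ ps)"
  have a: "a \<in> F" "a \<noteq> 0" and rs: "set rs \<subseteq> F - {0}" using Cons.prems by auto
  obtain y1 y where y: "represents (relative_pure_part ps rs) y1" "represents Q y" "- c = y1 + (- a) * y"
    using Cons.prems(3) represents_unionD[of "relative_pure_part ps rs" "scale (- a) Q"] represents_scaleD[of "- a" Q]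
    unfolding Q_def by fastforce
  define x where "x = - y1"
  have c: "c = x + a * y" using y(3) by (simp add: x_def algebra_simps)
  have QF: "set_mset Q \<subseteq> F" "set_mset (relative_pure_part ps rs) \<subseteq> F"
    using pfister_mset_subset[of "rs @ ps"] relative_pure_part_subset[OF assms(1) rs] assms(1) rs by (auto simp: Q_def)
  have in_F: "x \<in> F" "y \<in> F" using y represents_in QF by (auto simp: x_def)
  have IH: "\<exists>rs'. Suc (length rs') = length rs \<and> set rs' \<subseteq> F - {0} \<and> diag_isometric Q (pfister_mset (x # rs' @ ps))" if "x \<noteq> 0"
    using Cons.IH[OF rs that] y(1) by (simp add: x_def Q_def)
  show ?case
  proof (cases "y = 0")
    case True
    then obtain rs' where rs': "Suc (length rs') = length rs" "set rs' \<subseteq> F - {0}" "diag_isometric Q (pfister_mset (c # rs' @ ps))"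
      using IH c Cons.prems(2) by auto
    have "diag_isometric (pfister_mset ((a # rs) @ ps)) (pfister_mset (a # c # rs' @ ps))"
      using iso_pfister_mset_Cons[of "rs @ ps" "c # rs' @ ps" a] rs'(3) by (simp add: Q_def)
    also have "pfister_mset (a # c # rs' @ ps) = pfister_mset (c # (a # rs') @ ps)"
      by (simp add: ac_simps)
    finally show ?thesis using rs' a by (intro exI[of _ "a # rs'"]) simp
  next
    case False
    define z where "z = a * y"
    have z: "z \<in> F" "z \<noteq> 0" using a in_F False by (auto simp: z_def)
    have "diag_isometric Q (scale y Q)"
      using represents_pfister_mset[of "rs @ ps" y] assms(1) rs y(2) False by (simp add: Q_def)
    from iso_add[OF diag_isometric.refl[of Q] iso_scale[OF this, of "- a"]]
    have 1: "diag_isometric (pfister_mset ((a # rs) @ ps)) (pfister_mset (z # rs @ ps))"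
      by (simp add: Q_def z_def)
    show ?thesis
    proof (cases "x = 0")
      case True
      then show ?thesis using 1 rs c by (intro exI[of _ rs]) (simp add: z_def)
    next
      case False
      obtain rs' where rs': "Suc (length rs') = length rs" "set rs' \<subseteq> F - {0}" "diag_isometric Q (pfister_mset (x # rs' @ ps))"
        using IH False by auto
      have "diag_isometric (pfister_mset (z # rs @ ps)) (pfister_mset (z # x # rs' @ ps))"
        using iso_pfister_mset_Cons[of "rs @ ps" "x # rs' @ ps" z] rs'(3) by (simp add: Q_def)
      with 1 have "diag_isometric (pfister_mset ((a # rs) @ ps)) (pfister_mset (z # x # rs' @ ps))" by (rule diag_isometric.trans)
      from diag_isometric.trans[OF this iso_pfister_mset_chain[OF in_F(1) z(1)]]
      show ?thesis using rs' in_F z False c by (intro exI[of _ "(- x * z) # rs'"]) (simp add: z_def)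
    qed
  qed
qed

end

section \<open>Common factors of three Pfister forms\<close>

context subfield_set
begin

lemma represents_mset:
  "(\<And>i. i < length xs \<Longrightarrow> v i \<in> F) \<Longrightarrow> represents (mset xs) (\<Sum>i<length xs. xs ! i * (v i)\<^sup>2)"
proof (induction xs arbitrary: v)
  case Nil
  then show ?case by (simp add: represents.empty)
next
  case (Cons x xs)
  have "represents (mset xs) (\<Sum>i<length xs. xs ! i * (v (Suc i))\<^sup>2)"
    by (rule Cons.IH) (use Cons.prems in auto)
  from represents.add[OF this Cons.prems[of 0], of x] show ?case
    by (simp add: sum.lessThan_Suc_shift del: sum.lessThan_Suc)
qed

text \<open>Adding l v to the basis vector at k changes its value x into x + 2 l x v k because v is
  isotropic; this is linear in l with nonzero slope, so it takes the value c.\<close>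

lemma represents_if_isotropic:
  assumes two: "(2::'a) \<noteq> 0" and xs: "set xs \<subseteq> F - {0}" and v: "\<And>i. i < length xs \<Longrightarrow> v i \<in> F"
    and zero: "(\<Sum>i<length xs. xs ! i * (v i)\<^sup>2) = 0" and k: "k < length xs" "v k \<noteq> 0" and c: "c \<in> F"
  shows "represents (mset xs) c"
proof -
  define x where "x = xs ! k"
  have x: "x \<in> F" "x \<noteq> 0" using subsetD[OF xs nth_mem[OF k(1)]] by (auto simp: x_def)
  define l where "l = (c - x) / (2 * x * v k)"
  have "2 \<in> F" using minus[of 1 "- 1"] by simp
  then have l: "l \<in> F" using x c v[OF k(1)] by (simp add: l_def)
  define w where "w = (\<lambda>i. l * v i + (if i = k then 1 else 0))"
  have "represents (mset xs) (\<Sum>i<length xs. xs ! i * (w i)\<^sup>2)"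
    using l v by (intro represents_mset) (simp add: w_def)
  also have "(\<Sum>i<length xs. xs ! i * (w i)\<^sup>2) =
      (\<Sum>i<length xs. l\<^sup>2 * (xs ! i * (v i)\<^sup>2) + (if i = k then 2 * l * x * v k + x else 0))"
    by (intro sum.cong) (auto simp: w_def x_def power2_eq_square algebra_simps)
  also have "\<dots> = l\<^sup>2 * (\<Sum>i<length xs. xs ! i * (v i)\<^sup>2) + (2 * l * x * v k + x)"
    using k(1) by (simp add: sum.distrib sum_distrib_left)
  also have "2 * l * x * v k = c - x"
  proof -
    have "2 * x * v k \<noteq> 0" using two x(2) k(2) by simp
    then have "l * (2 * x * v k) = c - x" by (simp add: l_def)
    then show ?thesis by (simp add: ac_simps)
  qed
  also have "l\<^sup>2 * (\<Sum>i<length xs. xs ! i * (v i)\<^sup>2) + (c - x + x) = c" using zero by simp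
  finally show ?thesis .
qed

end

text \<open>Tsen-Lang as an axiom, with \<open>D\<close> in place of 2^n. The index types are fixed
  because a locale assumption is not polymorphic: \<open>K\<close> numbers the equations,
  \<open>J\<close> holds pairs of a form and a coordinate.\<close>

locale isotropic_field = subfield_set F for F :: "'a::field set" +
  fixes D :: nat
  assumes D_pos: "D > 0" and two: "(2::'a) \<noteq> 0"
    and isotropic: "\<And>(J :: (nat \<times> nat) set) (K :: nat set) a. finite J \<Longrightarrow> finite K \<Longrightarrow> card K * D < card J \<Longrightarrow>
      (\<And>k j. k \<in> K \<Longrightarrow> j \<in> J \<Longrightarrow> a k j \<in> F) \<Longrightarrow>
      \<exists>v. (\<forall>j\<in>J. v j \<in> F) \<and> (\<exists>j\<in>J. v j \<noteq> 0) \<and> (\<forall>k\<in>K. (\<Sum>j\<in>J. a k j * (v j)\<^sup>2) = 0)"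
begin

text \<open>Equating each form with a fixed one costs card T - 1 equations in card T * s unknowns.
  If the common value is 0, a form with a nonzero component is isotropic, hence represents
  everything, and the others are treated by induction.\<close>

lemma common_value:
  fixes T :: "nat set"
  assumes "finite T" "T \<noteq> {}" "(card T - 1) * D < card T * s"
    and P: "\<And>j. j \<in> T \<Longrightarrow> set_mset (P j) \<subseteq> F - {0}" "\<And>j. j \<in> T \<Longrightarrow> size (P j) = s"
  shows "\<exists>c\<in>F. c \<noteq> 0 \<and> (\<forall>j\<in>T. represents (P j) c)"
  using assms
proof (induction "card T" arbitrary: T rule: less_induct)
  case less
  obtain t where t: "t \<in> T" using less.prems by blast
  have "\<exists>xs. \<forall>j. mset (xs j) = P j" by (intro choice allI ex_mset)
  then obtain xs where xs: "\<And>j. mset (xs j) = P j" by blast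
  have len: "length (xs j) = s" if "j \<in> T" for j
    using less.prems(5)[OF that] xs[of j] by (metis size_mset)
  have xs_in: "set (xs j) \<subseteq> F - {0}" if "j \<in> T" for j
    using less.prems(4)[OF that] xs[of j] by (metis set_mset_mset)
  have nth_in: "xs j ! i \<in> F" "xs j ! i \<noteq> 0" if "j \<in> T" "i < s" for i j
    using subsetD[OF xs_in[OF that(1)] nth_mem[of i "xs j"]] len[OF that(1)] that(2) by auto
  \<comment> \<open>Equation k is the value of form k minus the value of form t.\<close>
  define a where "a = (\<lambda>k (j, i). if j = k then xs k ! i else if j = t then - (xs t ! i) else 0)"
  have "\<exists>v. (\<forall>j\<in>T \<times> {..<s}. v j \<in> F) \<and> (\<exists>j\<in>T \<times> {..<s}. v j \<noteq> 0) \<and>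
      (\<forall>k\<in>T - {t}. (\<Sum>j\<in>T \<times> {..<s}. a k j * (v j)\<^sup>2) = 0)"
  proof (rule isotropic)
    show "card (T - {t}) * D < card (T \<times> {..<s})"
      using less.prems(1,3) t by (simp add: card_cartesian_product)
    show "a k j \<in> F" if "k \<in> T - {t}" "j \<in> T \<times> {..<s}" for k j
      using that t nth_in by (auto simp: a_def)
  qed (use less.prems(1) in auto)
  then obtain v j0 i0 where v: "\<And>j i. j \<in> T \<Longrightarrow> i < s \<Longrightarrow> v (j, i) \<in> F"
    and j0: "j0 \<in> T" "i0 < s" "v (j0, i0) \<noteq> 0"
    and zero: "\<And>k. k \<in> T - {t} \<Longrightarrow> (\<Sum>j\<in>T \<times> {..<s}. a k j * (v j)\<^sup>2) = 0" by fast
  define q where "q = (\<lambda>j. \<Sum>i<s. xs j ! i * (v (j, i))\<^sup>2)"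
  have q: "represents (P j) (q j)" if "j \<in> T" for j
    using represents_mset[of "xs j" "\<lambda>i. v (j, i)"] len[OF that] v[OF that] xs[of j] by (simp add: q_def)
  have q_eq: "q k = q t" if k: "k \<in> T" for k
  proof (cases "k = t")
    case False
    have "0 = (\<Sum>j\<in>T. \<Sum>i<s. a k (j, i) * (v (j, i))\<^sup>2)"
      using zero[of k] k False by (simp add: sum.cartesian_product case_prod_unfold)
    also have "\<dots> = (\<Sum>j\<in>{k, t}. \<Sum>i<s. a k (j, i) * (v (j, i))\<^sup>2)"
      by (rule sum.mono_neutral_right) (use less.prems(1) k t in \<open>auto simp: a_def\<close>)
    also have "\<dots> = q k - q t"
      using False by (simp add: a_def q_def sum_negf)
    finally show ?thesis by simp
  qed simp
  show ?case
  proof (cases "q t = 0")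
    case False
    have "q t \<in> F" using represents_in[OF q[OF t]] less.prems(4)[OF t] by blast
    then show ?thesis using False q q_eq by (intro bexI[of _ "q t"] conjI ballI) metis+
  next
    case True
    have universal: "represents (P j0) c" if "c \<in> F" for c
      using represents_if_isotropic[OF two xs_in[OF j0(1)], of "\<lambda>i. v (j0, i)" i0 c]
        len[OF j0(1)] v[OF j0(1)] j0 q_eq[OF j0(1)] True that xs[of j0] by (simp add: q_def)
    show ?thesis
    proof (cases "T = {j0}")
      case True
      then show ?thesis using universal[OF one] by (intro bexI[of _ 1]) auto
    next
      case False
      then have ne: "T - {j0} \<noteq> {}" using j0(1) by blast
      have card: "card (T - {j0}) = card T - 1" "card (T - {j0}) < card T"
        by (simp add: less.prems(1) j0(1)) (rule card_Diff1_less[OF less.prems(1) j0(1)])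
      obtain m where m: "card T = Suc (Suc m)"
        using card ne less.prems(1) by (metis card_0_eq finite_Diff Suc_pred' gr0I diff_0_eq_0 card_gt_0_iff)
      \<comment> \<open>Dropping a form takes one D from the left side and one s from the right side
        of the count, which is harmless for s < D; for s \<ge> D the claim is clear.\<close>
      have "m * D < Suc m * s"
      proof (cases "s \<ge> D")
        case True
        then have "Suc m * D \<le> Suc m * s" by (rule mult_le_mono2)
        moreover have "m * D < Suc m * D" using D_pos by simp
        ultimately show ?thesis by linarith
      next
        case False
        then show ?thesis using less.prems(3) m by simp
      qed
      then have "\<exists>c\<in>F. c \<noteq> 0 \<and> (\<forall>j\<in>T - {j0}. represents (P j) c)"
        using less.hyps[OF card(2) _ ne] less.prems card m by auto
      then show ?thesis using universal by blast
    qed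
  qed
qed

lemma common_pfister_factor:
  assumes D: "D = 2 ^ n" and as: "\<And>j. j < 3 \<Longrightarrow> length (as j) = n" "\<And>j. j < 3 \<Longrightarrow> set (as j) \<subseteq> F - {0}"
  shows "r < n \<Longrightarrow> \<exists>ps. length ps = r \<and> set ps \<subseteq> F - {0} \<and> (\<forall>j<3::nat. \<exists>rs. length rs = n - r \<and>
    set rs \<subseteq> F - {0} \<and> diag_isometric (pfister_mset (as j)) (pfister_mset (rs @ ps)))"
proof (induction r)
  case 0
  show ?case using as by (intro exI[of _ "[]"]) (auto intro!: exI[of _ "as _"] diag_isometric.refl)
next
  case (Suc r)
  then obtain ps where ps: "length ps = r" "set ps \<subseteq> F - {0}"
    and "\<forall>j\<in>{..<3::nat}. \<exists>rs. length rs = n - r \<and> set rs \<subseteq> F - {0} \<and> diag_isometric (pfister_mset (as j)) (pfister_mset (rs @ ps))"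
    by auto
  from bchoice[OF this(3)] obtain rs where rs: "\<And>j. j < 3 \<Longrightarrow> length (rs j) = n - r"
    "\<And>j. j < 3 \<Longrightarrow> set (rs j) \<subseteq> F - {0}" "\<And>j. j < 3 \<Longrightarrow> diag_isometric (pfister_mset (as j)) (pfister_mset (rs j @ ps))"
    by auto
  have "\<exists>c\<in>F. c \<noteq> 0 \<and> (\<forall>j\<in>{..<3}. represents (relative_pure_part ps (rs j)) c)"
  proof (rule common_value[where s = "2 ^ n - 2 ^ r"])
    \<comment> \<open>Here 2^n = 4 Y, and the count reads 8 Y < 3 (4 Y - X), which follows from X
      \<le> Y.\<close>
    obtain m where m: "n = r + 2 + m" using Suc.prems by (metis add_2_eq_Suc' add_Suc_right add_Suc_shift less_iff_Suc_add)
    define X Y :: nat where "X = 2 ^ r" and "Y = 2 ^ r * 2 ^ m"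
    have "1 \<le> X" "X \<le> Y" by (simp_all add: X_def Y_def)
    then have "2 * (4 * Y) < 3 * (4 * Y - X)" by linarith
    then show "(card {..<3::nat} - 1) * D < card {..<3::nat} * (2 ^ n - 2 ^ r)"
      unfolding D m power_add X_def Y_def by (simp add: mult.commute mult.left_commute)
    show "size (relative_pure_part ps (rs j)) = 2 ^ n - 2 ^ r" if "j \<in> {..<3}" for j
      using that rs(1)[of j] ps(1) Suc.prems by (simp add: size_relative_pure_part)
    show "set_mset (relative_pure_part ps (rs j)) \<subseteq> F - {0}" if "j \<in> {..<3}" for j
      using that rs(2)[of j] ps(2) by (intro relative_pure_part_subset) auto
  qed (auto simp: lessThan_empty_iff)
  then obtain c where c: "c \<in> F" "c \<noteq> 0" "\<And>j. j < 3 \<Longrightarrow> represents (relative_pure_part ps (rs j)) c" by auto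
  show ?case
  \<comment> \<open>A value c of the pure part belongs to the slot -c, because <<a>> is <1,
    -a>.\<close>
  proof (rule exI[of _ "- c # ps"], intro conjI allI impI)
    fix j :: nat assume j: "j < 3"
    obtain rs' where rs': "Suc (length rs') = length (rs j)" "set rs' \<subseteq> F - {0}"
        "diag_isometric (pfister_mset (rs j @ ps)) (pfister_mset (- c # rs' @ ps))"
      using pure_subform[OF ps(2) rs(2)[OF j], of "- c"] c(2) c(3)[OF j] by auto
    have "diag_isometric (pfister_mset (as j)) (pfister_mset (rs' @ - c # ps))"
      using diag_isometric.trans[OF rs(3)[OF j] rs'(3)] by (simp only: pfister_mset_middle)
    then show "\<exists>rs. length rs = n - Suc r \<and> set rs \<subseteq> F - {0} \<and> diag_isometric (pfister_mset (as j)) (pfister_mset (rs @ - c # ps))"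
      using rs' rs(1)[OF j] by (intro exI[of _ rs']) auto
  qed (use ps c in auto)
qed

end

section \<open>Gram matrices\<close>

text \<open>The order of the entries is that of \<open>kron\<close>, so for diagonal matrices the
  product is an equality and not merely an isometry.\<close>

definition tensor_list :: "'a::times list \<Rightarrow> 'a list \<Rightarrow> 'a list" where
  "tensor_list xs ys = concat (map (\<lambda>x. map ((*) x) ys) xs)"

lemma length_tensor_list: "length (tensor_list xs ys) = length xs * length ys"
  by (induction xs) (simp_all add: tensor_list_def)

lemma nth_tensor_list:
  "i < length xs * length ys \<Longrightarrow> tensor_list xs ys ! i = xs ! (i div length ys) * ys ! (i mod length ys)"
proof (induction xs arbitrary: i)
  case (Cons x xs)
  have "length ys > 0" using Cons.prems by (cases ys) auto
  show ?case
  proof (cases "i < length ys")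
    case True
    then show ?thesis by (simp add: tensor_list_def nth_append)
  next
    case False
    then have "tensor_list (x # xs) ys ! i = tensor_list xs ys ! (i - length ys)"
      by (simp add: tensor_list_def nth_append)
    also have "\<dots> = xs ! ((i - length ys) div length ys) * ys ! ((i - length ys) mod length ys)"
      using Cons.prems False by (intro Cons.IH) auto
    finally show ?thesis
      using False \<open>length ys > 0\<close> by (simp add: le_div_geq le_mod_geq)
  qed
qed simp

lemma diag_form_index:
  "i < length xs \<Longrightarrow> j < length xs \<Longrightarrow> diag_form xs $$ (i, j) = (if i = j then xs ! i else 0)"
  by (simp add: diag_form_def mat_diag_def)

lemma diag_form_dim [simp]: "dim_row (diag_form xs) = length xs" "dim_col (diag_form xs) = length xs"
  "diag_form xs \<in> carrier_mat (length xs) (length xs)"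
  by (simp_all add: diag_form_def mat_diag_def)

lemma kron_diag_form:
  fixes xs ys :: "'a::semiring_0 list"
  shows "kron (diag_form xs) (diag_form ys) = diag_form (tensor_list xs ys)"
proof (rule eq_matI)
  fix i j assume "i < dim_row (diag_form (tensor_list xs ys))" "j < dim_col (diag_form (tensor_list xs ys))"
  then have ij: "i < length xs * length ys" "j < length xs * length ys" by (simp_all add: length_tensor_list)
  then have ys: "length ys > 0" by (cases ys) auto
  have lt: "k div length ys < length xs" "k mod length ys < length ys" if "k < length xs * length ys" for k
    using that ys by (simp_all add: less_mult_imp_div_less)
  have eq: "i div length ys = j div length ys \<Longrightarrow> i mod length ys = j mod length ys \<Longrightarrow> i = j"
    by (metis div_mult_mod_eq)
  show "kron (diag_form xs) (diag_form ys) $$ (i, j) = diag_form (tensor_list xs ys) $$ (i, j)"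
    using ij lt[OF ij(1)] lt[OF ij(2)] eq
    by (auto simp: kron_def diag_form_index length_tensor_list nth_tensor_list)
qed (simp_all add: kron_def length_tensor_list)

fun pfister_list :: "'a::comm_ring_1 list \<Rightarrow> 'a list" where
  "pfister_list [] = [1]"
| "pfister_list (a # as) = tensor_list [1, - a] (pfister_list as)"

lemma pfister_eq_diag_form: "pfister as = diag_form (pfister_list as)"
proof (induction as)
  case Nil
  show ?case by (rule eq_matI) (auto simp: diag_form_index)
next
  case (Cons a as)
  then show ?case by (simp add: pf1_def kron_diag_form)
qed

lemma mset_pfister_list: "mset (pfister_list as) = pfister_mset as"
  by (induction as) (simp_all add: tensor_list_def flip: scale_def)

lemma mset_tensor_list_right: "mset (tensor_list xs [1, - b]) = mset xs + scale (- b) (mset xs)"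
  for b :: "'a::comm_ring_1"
  by (induction xs) (simp_all add: tensor_list_def mult.commute)

lemma isometric_over_diag_formD:
  assumes "isometric_over F (diag_form xs) (diag_form ys)" "length xs = length ys"
  shows "\<exists>M. (\<forall>i<length xs. \<forall>j<length xs. M i j \<in> F) \<and>
    (\<forall>i<length xs. \<forall>j<length xs. (\<Sum>l<length xs. M l i * M l j * xs ! l) = (if i = j then ys ! i else 0))"
proof -
  define n where "n = length xs"
  obtain M where M: "M \<in> carrier_mat n n" "\<forall>i<n. \<forall>j<n. M $$ (i,j) \<in> F"
    "transpose_mat M * diag_form xs * M = diag_form ys"
    using assms(1) by (auto simp: isometric_over_def n_def)
  have "(\<Sum>l<n. M $$ (l,i) * M $$ (l,j) * xs ! l) = (if i = j then ys ! i else 0)" if "i < n" "j < n" for i j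
  proof -
    have "(transpose_mat M * diag_form xs * M) $$ (i,j) = (\<Sum>l<n. M $$ (l,i) * xs ! l * M $$ (l,j))"
      using M(1) that unfolding diag_form_def n_def[symmetric]
      by (subst mat_diag_mult_right[of _ n n]) (auto simp: scalar_prod_def lessThan_atLeast0)
    then show ?thesis using M(3) that assms(2) by (simp add: diag_form_index n_def ac_simps)
  qed
  then show ?thesis using M(2) by (intro exI[of _ "\<lambda>i j. M $$ (i,j)"]) (simp add: n_def)
qed

section \<open>From chain equivalence to invertible matrices\<close>

context subfield_set
begin

text \<open>The Gram matrix identity entry by entry. Invertibility of \<open>M\<close> is not
  demanded, since a chain may pass through singular moves.\<close>

definition list_isometric :: "'a list \<Rightarrow> 'a list \<Rightarrow> bool" where
  "list_isometric xs ys \<longleftrightarrow> length xs = length ys \<and> (\<exists>M. (\<forall>i<length xs. \<forall>j<length xs. M i j \<in> F) \<and>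
    (\<forall>i<length xs. \<forall>j<length xs. (\<Sum>l<length xs. M l i * M l j * xs ! l) = (if i = j then ys ! i else 0)))"

text \<open>A target without zero entries has nonzero determinant, and multiplicativity passes this
  on to \<open>M\<close>.\<close>

lemma list_isometric_imp_isometric_over:
  assumes "list_isometric xs ys" "0 \<notin> set ys"
  shows "isometric_over F (diag_form xs) (diag_form ys)"
proof -
  define n where "n = length xs"
  obtain f where f: "\<forall>i<n. \<forall>j<n. f i j \<in> F" and len: "length ys = n"
    and eq: "\<And>i j. i < n \<Longrightarrow> j < n \<Longrightarrow> (\<Sum>l<n. f l i * f l j * xs ! l) = (if i = j then ys ! i else 0)"
    using assms(1) unfolding list_isometric_def n_def by metis
  define M where "M = Matrix.mat n n (\<lambda>(i,j). f i j)"
  have M: "M \<in> carrier_mat n n" by (simp add: M_def)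
  have MM: "transpose_mat M * diag_form xs * M = diag_form ys"
  proof (rule eq_matI)
    fix i j assume "i < dim_row (diag_form ys)" "j < dim_col (diag_form ys)"
    then have ij: "i < n" "j < n" using len by simp_all
    have "(transpose_mat M * diag_form xs * M) $$ (i,j) = (\<Sum>l<n. f l i * xs ! l * f l j)"
      using ij unfolding diag_form_def n_def[symmetric]
      by (subst mat_diag_mult_right[of _ n n]) (auto simp: scalar_prod_def lessThan_atLeast0 M_def)
    then show "(transpose_mat M * diag_form xs * M) $$ (i,j) = diag_form ys $$ (i,j)"
      using eq[OF ij] ij len by (simp add: diag_form_index ac_simps)
  qed (use M len in auto)
  have "det (diag_form ys) = prod_list ys"
  proof -
    have "diag_mat (diag_form ys) = ys"
      by (rule nth_equalityI) (simp_all add: diag_mat_def diag_form_index)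
    then show ?thesis
      by (subst det_upper_triangular[of _ "length ys"]) (auto simp: diag_form_index upper_triangular_def)
  qed
  then have "det (diag_form ys) \<noteq> 0" using assms(2) by (simp add: prod_list_zero_iff)
  moreover have "det (transpose_mat M * diag_form xs * M) = det (transpose_mat M * diag_form xs) * det M"
    by (rule det_mult[of _ n]) (use M in \<open>simp_all add: n_def\<close>)
  ultimately have "det M \<noteq> 0" using MM by auto
  then show ?thesis unfolding isometric_over_def
    using M MM f by (intro exI[of _ M]) (simp add: n_def M_def)
qed

lemma list_isometric_permute:
  assumes "mset xs = mset ys"
  shows "list_isometric xs ys"
proof -
  obtain p where p: "p permutes {..<length xs}" "permute_list p xs = ys"
    using mset_eq_permutation[of ys xs] assms by auto
  have len: "length xs = length ys" using p by auto
  have nth: "ys ! i = xs ! p i" if "i < length xs" for i using p that permute_list_nth by blast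
  have lt: "p i < length xs" if "i < length xs" for i using permutes_in_image[OF p(1)] that by auto
  have inj: "p i = p j \<longleftrightarrow> i = j" for i j using permutes_inj[OF p(1)] by (auto dest: injD)
  show ?thesis unfolding list_isometric_def
  proof (intro conjI exI[of _ "\<lambda>l i. if l = p i then 1 else 0"] allI impI)
    fix i j assume ij: "i < length xs" "j < length xs"
    have "(\<Sum>l<length xs. (if l = p i then 1 else 0) * (if l = p j then 1 else 0) * xs ! l)
        = (\<Sum>l<length xs. if l = p i then (if i = j then xs ! l else 0) else 0)"
      using inj by (intro sum.cong) auto
    then show "(\<Sum>l<length xs. (if l = p i then 1 else 0) * (if l = p j then 1 else 0) * xs ! l) =
        (if i = j then ys ! i else 0)"
      using lt[OF ij(1)] nth[OF ij(1)] by (cases "i = j") simp_all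
  qed (use len in auto)
qed

lemma list_isometric_trans:
  assumes "list_isometric xs ys" "list_isometric ys zs"
  shows "list_isometric xs zs"
proof -
  define n where "n = length xs"
  obtain f where len: "length ys = n" and f: "\<forall>i<n. \<forall>j<n. f i j \<in> F"
    and fe: "\<And>i j. i < n \<Longrightarrow> j < n \<Longrightarrow> (\<Sum>l<n. f l i * f l j * xs ! l) = (if i = j then ys ! i else 0)"
    using assms(1) unfolding list_isometric_def n_def by metis
  obtain g where len': "length zs = n" and g: "\<forall>i<n. \<forall>j<n. g i j \<in> F"
    and ge: "\<And>i j. i < n \<Longrightarrow> j < n \<Longrightarrow> (\<Sum>l<n. g l i * g l j * ys ! l) = (if i = j then zs ! i else 0)"
    using assms(2) unfolding list_isometric_def len by metis
  have "(\<Sum>l<n. (\<Sum>a<n. f l a * g a i) * (\<Sum>b<n. f l b * g b j) * xs ! l) = (if i = j then zs ! i else 0)"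
    if ij: "i < n" "j < n" for i j
  proof -
    have "(\<Sum>l<n. (\<Sum>a<n. f l a * g a i) * (\<Sum>b<n. f l b * g b j) * xs ! l) =
        (\<Sum>l<n. \<Sum>a<n. \<Sum>b<n. g a i * g b j * (f l a * f l b * xs ! l))"
      unfolding sum_product unfolding sum_distrib_right by (intro sum.cong HOL.refl) (simp only: ac_simps)
    also have "\<dots> = (\<Sum>a<n. \<Sum>l<n. \<Sum>b<n. g a i * g b j * (f l a * f l b * xs ! l))"
      by (rule sum.swap)
    also have "\<dots> = (\<Sum>a<n. \<Sum>b<n. \<Sum>l<n. g a i * g b j * (f l a * f l b * xs ! l))"
      by (rule sum.cong[OF HOL.refl], rule sum.swap)
    also have "\<dots> = (\<Sum>a<n. \<Sum>b<n. g a i * g b j * (if a = b then ys ! a else 0))"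
      unfolding sum_distrib_left[symmetric] by (intro sum.cong HOL.refl arg_cong2[of _ _ _ _ "(*)"] fe) auto
    also have "\<dots> = (\<Sum>a<n. g a i * g a j * ys ! a)"
      by (intro sum.cong) (auto simp: if_distrib cong: if_cong)
    finally show ?thesis using ge[OF ij] by simp
  qed
  moreover have "(\<Sum>a<n. f i a * g a j) \<in> F" if "i < n" "j < n" for i j
    by (rule sum) (use f g that in auto)
  ultimately show ?thesis unfolding list_isometric_def n_def[symmetric] len'
    by (intro conjI exI[of _ "\<lambda>l i. \<Sum>a<n. f l a * g a i"]) simp_all
qed

lemma list_isometric_square:
  assumes "t \<in> F"
  shows "list_isometric (a # zs) ((a * t\<^sup>2) # zs)"
  unfolding list_isometric_def
proof (intro conjI exI[of _ "\<lambda>l i. if l = i then (if l = 0 then t else 1) else 0"] allI impI)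
  fix i j assume ij: "i < length (a # zs)" "j < length (a # zs)"
  have "(\<Sum>l<length (a # zs). (if l = i then (if l = 0 then t else 1) else 0) *
      (if l = j then (if l = 0 then t else 1) else 0) * (a # zs) ! l) =
      (\<Sum>l<length (a # zs). if l = i then (if i = j then ((a * t\<^sup>2) # zs) ! i else 0) else 0)"
    by (rule sum.cong) (auto simp: power2_eq_square nth_Cons split: nat.splits)
  then show "(\<Sum>l<length (a # zs). (if l = i then (if l = 0 then t else 1) else 0) *
      (if l = j then (if l = 0 then t else 1) else 0) * (a # zs) ! l) =
      (if i = j then ((a * t\<^sup>2) # zs) ! i else 0)"
    using ij by simp
qed (use assms in auto)

lemma list_isometric_plane:
  assumes "p \<in> F" "q \<in> F" "r \<in> F" "s \<in> F" "a * p * q + b * r * s = 0"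
  shows "list_isometric (a # b # zs) ((a * p\<^sup>2 + b * r\<^sup>2) # (a * q\<^sup>2 + b * s\<^sup>2) # zs)"
proof -
  \<comment> \<open>The block with columns (p, r) and (q, s), completed by an identity
    block.\<close>
  define M where "M = (\<lambda>l i::nat. if l < 2 \<and> i < 2 then (if l = 0 then (if i = 0 then p else q)
    else (if i = 0 then r else s)) else if l = i then 1 else 0)"
  have M: "M 0 0 = p" "M 0 (Suc 0) = q" "M (Suc 0) 0 = r" "M (Suc 0) (Suc 0) = s"
    "M 0 (Suc (Suc i)) = 0" "M (Suc 0) (Suc (Suc i)) = 0" "M (Suc (Suc i)) 0 = 0" "M (Suc (Suc i)) (Suc 0) = 0"
    "M (Suc (Suc i)) (Suc (Suc j)) = (if i = j then 1 else 0)" for i j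
    by (auto simp: M_def)
  show ?thesis
    unfolding list_isometric_def
  proof (intro conjI exI[of _ M] allI impI)
    show "M i j \<in> F" for i j using assms by (simp add: M_def)
    fix i j assume ij: "i < length (a # b # zs)" "j < length (a # b # zs)"
    have split: "(\<Sum>l<length (a # b # zs). M l i * M l j * (a # b # zs) ! l) =
       M 0 i * M 0 j * a + M (Suc 0) i * M (Suc 0) j * b + (\<Sum>l<length zs. M (Suc (Suc l)) i * M (Suc (Suc l)) j * zs ! l)"
      by (simp add: sum.lessThan_Suc_shift del: sum.lessThan_Suc)
    have 0: "a * (p * q) + b * (r * s) = 0" using assms(5) by (simp add: mult.assoc)
    consider "i = 0" | "i = Suc 0" | k where "i = Suc (Suc k)" by (metis not0_implies_Suc)
    then show "(\<Sum>l<length (a # b # zs). M l i * M l j * (a # b # zs) ! l) =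
       (if i = j then ((a * p\<^sup>2 + b * r\<^sup>2) # (a * q\<^sup>2 + b * s\<^sup>2) # zs) ! i else 0)"
    proof cases
      case 1
      consider "j = 0" | "j = Suc 0" | k where "j = Suc (Suc k)" by (metis not0_implies_Suc)
      then show ?thesis unfolding split by cases (simp_all add: 1 M 0 power2_eq_square ac_simps)
    next
      case 2
      consider "j = 0" | "j = Suc 0" | k where "j = Suc (Suc k)" by (metis not0_implies_Suc)
      then show ?thesis unfolding split by cases (simp_all add: 2 M 0 power2_eq_square ac_simps)
    next
      case k: (3 k)
      consider "j = 0" | "j = Suc 0" | m where "j = Suc (Suc m)" by (metis not0_implies_Suc)
      then show ?thesis
      proof cases
        case j: (3 m)
        have "(\<Sum>l<length zs. M (Suc (Suc l)) i * M (Suc (Suc l)) j * zs ! l) =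
            (\<Sum>l<length zs. if l = k then (if k = m then zs ! k else 0) else 0)"
          by (intro sum.cong) (auto simp: M j k)
        then show ?thesis unfolding split using ij by (simp add: M j k)
      next
        case j: 1
        then show ?thesis unfolding split by (simp add: M k)
      next
        case j: 2
        then show ?thesis unfolding split by (simp add: M k)
      qed
    qed
  qed simp
qed

text \<open>Moves on multisets touch entries at arbitrary positions; permutation matrices bring them
  to the front of the list.\<close>

lemma diag_isometric_imp_list_isometric:
  "diag_isometric M N \<Longrightarrow> mset xs = M \<Longrightarrow> mset ys = N \<Longrightarrow> list_isometric xs ys"
proof (induction arbitrary: xs ys rule: diag_isometric.induct)
  case (refl M)
  then show ?case by (intro list_isometric_permute) simp
next
  case (square t a M)
  obtain zs where zs: "mset zs = M" using ex_mset by blast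
  have "list_isometric xs (a # zs)" "list_isometric ((a * t\<^sup>2) # zs) ys"
    using square zs by (auto intro: list_isometric_permute)
  then show ?case using list_isometric_square[OF square.hyps(1), of a zs] list_isometric_trans by blast
next
  case (plane p q r s a b M)
  obtain zs where zs: "mset zs = M" using ex_mset by blast
  have "list_isometric xs (a # b # zs)" "list_isometric ((a * p\<^sup>2 + b * r\<^sup>2) # (a * q\<^sup>2 + b * s\<^sup>2) # zs) ys"
    using plane zs by (auto intro: list_isometric_permute)
  then show ?case using list_isometric_plane[OF plane.hyps, of zs] list_isometric_trans by blast
next
  case (trans L M N)
  obtain zs where "mset zs = M" using ex_mset by blast
  then show ?case using trans list_isometric_trans by blast
qed

text \<open>A new slot enters \<open>pfister\<close> as the left factor, whereas a shared factor is
  completed by <<b>> on the right. The two diagonals are permutations of each other, so multisets do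
  not see the difference.\<close>

lemma diag_isometric_imp_isometric_kron:
  assumes "diag_isometric (pfister_mset as) (pfister_mset (b # ps))" "set ps \<subseteq> F - {0}" "b \<in> F - {0}"
  shows "isometric_over F (pfister as) (kron (pfister ps) (pf1 b))"
proof -
  define ys where "ys = tensor_list (pfister_list ps) [1, - b]"
  have ys: "mset ys = pfister_mset (b # ps)"
    by (simp add: ys_def mset_tensor_list_right mset_pfister_list)
  then have "0 \<notin> set ys"
    using pfister_mset_subset[of "b # ps"] assms(2,3) by (metis DiffD2 insert_subset list.simps(15) set_mset_mset singletonI subset_iff)
  then have "isometric_over F (diag_form (pfister_list as)) (diag_form ys)"
    by (intro list_isometric_imp_isometric_over diag_isometric_imp_list_isometric[OF assms(1)] ys mset_pfister_list)
  then show ?thesis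
    by (simp add: pfister_eq_diag_form pf1_def kron_diag_form ys_def)
qed

end

lemma (in isotropic_field) linked_3:
  assumes "D = 2 ^ n" "n \<ge> 1"
  shows "linked F 3 n"
  unfolding linked_def
proof (intro allI impI)
  fix \<phi>s :: "'a mat list"
  assume \<phi>s: "length \<phi>s = 3 \<and> (\<forall>\<phi>\<in>set \<phi>s. is_pfister_over F n \<phi>)"
  have "\<forall>j\<in>{..<3}. \<exists>as. length as = n \<and> set as \<subseteq> F - {0} \<and> \<phi>s ! j = pfister as"
    using \<phi>s by (auto simp: is_pfister_over_def)
  from bchoice[OF this] obtain as where as: "\<And>j. j < 3 \<Longrightarrow> length (as j) = n"
      "\<And>j. j < 3 \<Longrightarrow> set (as j) \<subseteq> F - {0}" "\<And>j. j < 3 \<Longrightarrow> \<phi>s ! j = pfister (as j)"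
    by auto
  have "\<exists>ps. length ps = n - 1 \<and> set ps \<subseteq> F - {0} \<and> (\<forall>j<3::nat. \<exists>rs. length rs = n - (n - 1) \<and>
      set rs \<subseteq> F - {0} \<and> diag_isometric (pfister_mset (as j)) (pfister_mset (rs @ ps)))"
    by (rule common_pfister_factor) (use as assms in auto)
  then obtain ps where ps: "length ps = n - 1" "set ps \<subseteq> F - {0}"
    and "\<forall>j\<in>{..<3::nat}. \<exists>rs. length rs = n - (n - 1) \<and>
      set rs \<subseteq> F - {0} \<and> diag_isometric (pfister_mset (as j)) (pfister_mset (rs @ ps))" by auto
  from bchoice[OF this(3)] obtain rs where rs: "\<And>j. j < 3 \<Longrightarrow> length (rs j) = 1"
      "\<And>j. j < 3 \<Longrightarrow> set (rs j) \<subseteq> F - {0}"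
      "\<And>j. j < 3 \<Longrightarrow> diag_isometric (pfister_mset (as j)) (pfister_mset (rs j @ ps))"
    using assms by auto
  have rs_hd: "rs j = [hd (rs j)]" if "j < 3" for j using rs(1)[OF that] by (cases "rs j") auto
  have hd_in: "hd (rs j) \<in> F - {0}" if "j < 3" for j
    using rs(2)[OF that] rs_hd[OF that] by (metis insert_subset list.simps(15))
  have iso: "diag_isometric (pfister_mset (as j)) (pfister_mset (hd (rs j) # ps))" if "j < 3" for j
    using rs(3)[OF that] rs_hd[OF that] by (metis append_Cons append_Nil)
  show "share_common_factor F n \<phi>s"
    unfolding share_common_factor_def
  proof (intro exI[of _ "pfister ps"] exI[of _ "map (\<lambda>j. hd (rs j)) [0..<3]"] conjI allI impI)
    show "is_pfister_over F (n - 1) (pfister ps)" using ps by (auto simp: is_pfister_over_def)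
    show "set (map (\<lambda>j. hd (rs j)) [0..<3]) \<subseteq> F - {0}" using hd_in by auto
    fix j assume "j < length \<phi>s"
    then have j: "j < 3" using \<phi>s by simp
    then have "map (\<lambda>j. hd (rs j)) [0..<3] ! j = hd (rs j)" by simp
    then show "isometric_over F (\<phi>s ! j) (kron (pfister ps) (pf1 (map (\<lambda>j. hd (rs j)) [0..<3] ! j)))"
      using diag_isometric_imp_isometric_kron[OF iso[OF j] ps(2) hd_in[OF j]] as(3)[OF j] by simp
  qed (use \<phi>s in simp)
qed

lemma isotropic_rat_fun_field: "isotropic_field (rat_fun_field n) (2 ^ n)"
proof
  have "(2::ratfun) = fract_of 2" using fract_of_simps(2)[of 1 1] by simp
  moreover have "fract_of (2::mpoly) \<noteq> 0" by simp
  ultimately show "(2::ratfun) \<noteq> 0" by (simp only: not_False_eq_True)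
qed (simp, rule diagonal_system_isotropic)

section \<open>Dyadic valuation rings\<close>

definition subring_set :: "'a::comm_ring_1 set \<Rightarrow> bool" where
  "subring_set R \<longleftrightarrow> 1 \<in> R \<and> (\<forall>x\<in>R. \<forall>y\<in>R. x - y \<in> R \<and> x * y \<in> R)"

lemma subring_setD:
  assumes "subring_set R"
  shows "1 \<in> R" "0 \<in> R" "x \<in> R \<Longrightarrow> y \<in> R \<Longrightarrow> x - y \<in> R" "x \<in> R \<Longrightarrow> y \<in> R \<Longrightarrow> x * y \<in> R"
    "x \<in> R \<Longrightarrow> - x \<in> R" "x \<in> R \<Longrightarrow> y \<in> R \<Longrightarrow> x + y \<in> R"
proof -
  show 1: "1 \<in> R" and diff: "\<And>x y. x \<in> R \<Longrightarrow> y \<in> R \<Longrightarrow> x - y \<in> R"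
    and "x \<in> R \<Longrightarrow> y \<in> R \<Longrightarrow> x * y \<in> R"
    using assms by (auto simp: subring_set_def)
  show 0: "0 \<in> R" using diff[OF 1 1] by simp
  show neg: "\<And>x. x \<in> R \<Longrightarrow> - x \<in> R" using diff[OF 0] by fastforce
  show "x \<in> R \<Longrightarrow> y \<in> R \<Longrightarrow> x + y \<in> R" using diff[of x "- y"] neg[of y] by simp
qed

lemma subring_set_sum: "subring_set R \<Longrightarrow> (\<And>s. s \<in> S \<Longrightarrow> f s \<in> R) \<Longrightarrow> sum f S \<in> R"
  by (induction S rule: infinite_finite_induct) (auto intro: subring_setD)

lemma subring_set_power: "subring_set R \<Longrightarrow> x \<in> R \<Longrightarrow> x ^ k \<in> R"
  by (induction k) (auto intro: subring_setD)

definition adjoin :: "'a::comm_ring_1 set \<Rightarrow> 'a \<Rightarrow> 'a set" where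
  "adjoin R t = {poly p t | p. \<forall>i. coeff p i \<in> R}"

lemma subring_set_adjoin:
  assumes "subring_set R"
  shows "subring_set (adjoin R t)" "R \<subseteq> adjoin R t" "t \<in> adjoin R t"
proof -
  note R = subring_setD[OF assms] subring_set_sum[OF assms]
  show sub: "R \<subseteq> adjoin R t"
  proof
    fix x assume "x \<in> R"
    then show "x \<in> adjoin R t" unfolding adjoin_def
      by (intro CollectI exI[of _ "[:x:]"]) (auto simp: coeff_pCons R split: nat.splits)
  qed
  show "t \<in> adjoin R t" unfolding adjoin_def
    by (intro CollectI exI[of _ "[:0, 1:]"]) (auto simp: coeff_pCons R split: nat.splits)
  show "subring_set (adjoin R t)"
    unfolding subring_set_def
  proof (intro conjI ballI)
    show "1 \<in> adjoin R t" using sub R(1) by blast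
    fix x y assume "x \<in> adjoin R t" "y \<in> adjoin R t"
    then obtain p q where pq: "x = poly p t" "y = poly q t" "\<forall>i. coeff p i \<in> R" "\<forall>i. coeff q i \<in> R"
      unfolding adjoin_def by blast
    show "x - y \<in> adjoin R t" unfolding adjoin_def
      by (intro CollectI exI[of _ "p - q"]) (use pq in \<open>auto intro: R\<close>)
    show "x * y \<in> adjoin R t" unfolding adjoin_def
      by (intro CollectI exI[of _ "p * q"]) (use pq in \<open>auto simp: coeff_mult intro!: R\<close>)
  qed
qed

lemma ex_maximal_subring_excluding:
  assumes "subring_set A" "(b::'a::comm_ring_1) \<notin> A"
  shows "\<exists>W. subring_set W \<and> A \<subseteq> W \<and> b \<notin> W \<and> (\<forall>V. subring_set V \<longrightarrow> W \<subseteq> V \<longrightarrow> b \<notin> V \<longrightarrow> V = W)"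
proof -
  define \<A> where "\<A> = {W. subring_set W \<and> A \<subseteq> W \<and> b \<notin> W}"
  have "\<exists>M\<in>\<A>. \<forall>X\<in>\<A>. M \<subseteq> X \<longrightarrow> X = M"
  proof (rule subset_Zorn_nonempty)
    show "\<A> \<noteq> {}" using assms by (auto simp: \<A>_def)
    fix C assume C: "C \<noteq> {}" "subset.chain \<A> C"
    have 1: "subring_set N" "A \<subseteq> N" "b \<notin> N" if "N \<in> C" for N
      using C(2) that by (auto simp: \<A>_def subset.chain_def)
    have "x - y \<in> \<Union>C \<and> x * y \<in> \<Union>C" if xy: "x \<in> \<Union>C" "y \<in> \<Union>C" for x y
    proof -
      obtain N1 N2 where N: "N1 \<in> C" "N2 \<in> C" "x \<in> N1" "y \<in> N2" using xy by auto
      then have "N1 \<subseteq> N2 \<or> N2 \<subseteq> N1" using C(2) by (auto simp: subset.chain_def)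
      then obtain N where "N \<in> C" "x \<in> N" "y \<in> N" using N by auto
      then show ?thesis using subring_setD(3,4)[OF 1(1)] by blast
    qed
    moreover have "1 \<in> \<Union>C" using C(1) subring_setD(1)[OF 1(1)] by blast
    ultimately have "subring_set (\<Union>C)" unfolding subring_set_def by blast
    moreover have "A \<subseteq> \<Union>C" "b \<notin> \<Union>C" using 1(2,3) C(1) by auto
    ultimately show "\<Union>C \<in> \<A>" by (simp add: \<A>_def)
  qed
  then obtain M where M: "M \<in> \<A>" "\<And>X. X \<in> \<A> \<Longrightarrow> M \<subseteq> X \<Longrightarrow> X = M" by blast
  show ?thesis
  proof (intro exI[of _ M] conjI allI impI)
    fix V assume "subring_set V" "M \<subseteq> V" "b \<notin> V"
    then show "V = M" by (intro M(2)) (use M(1) in \<open>auto simp: \<A>_def\<close>)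
  qed (use M(1) in \<open>simp_all add: \<A>_def\<close>)
qed

text \<open>Take \<open>W\<close> maximal among the subrings that contain \<open>A\<close> but not
  1/a. If neither t nor 1/t is in \<open>W\<close>, maximality puts 1/a into W[t] and into W[1/t],
  giving relations a p(t) = 1 and a q(1/t) = 1. With both degrees minimal, the relation of smaller
  degree would still lower the degree of the other.\<close>

lemma ex_valuation_ring_excluding:
  fixes a :: "'a::field"
  assumes A: "subring_set A" "a \<in> A" "a \<noteq> 0" "inverse a \<notin> A"
  shows "\<exists>W. subring_set W \<and> A \<subseteq> W \<and> inverse a \<notin> W \<and> (\<forall>t. t \<in> W \<or> inverse t \<in> W)"
proof -
  obtain W where W: "subring_set W" "A \<subseteq> W" "inverse a \<notin> W"
    and max: "\<And>V. subring_set V \<Longrightarrow> W \<subseteq> V \<Longrightarrow> inverse a \<notin> V \<Longrightarrow> V = W"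
    using ex_maximal_subring_excluding[OF A(1,4)] by blast
  note R = subring_setD[OF W(1)] subring_set_sum[OF W(1)] subring_set_power[OF W(1)]
  have a: "a \<in> W" using A W by blast
  have no_inv: "a * w \<noteq> 1" if "w \<in> W" for w
    using that W(3) inverse_unique[of a w] by auto
  have adj: "\<exists>p. (\<forall>i. coeff p i \<in> W) \<and> a * poly p t = 1" if "t \<notin> W" for t
  proof -
    have "inverse a \<in> adjoin W t"
      using max[OF subring_set_adjoin(1,2)[OF W(1)], of t] subring_set_adjoin(3)[OF W(1), of t] that by blast
    then obtain p where "\<forall>i. coeff p i \<in> W" "inverse a = poly p t" unfolding adjoin_def by blast
    then show ?thesis using A(3) by (intro exI[of _ p]) (simp flip: \<open>inverse a = poly p t\<close>)
  qed
  \<comment> \<open>Otherwise 1/a lies in W[1/u] for u = 1 - a b, and clearing denominators puts a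
    power of u into a W. Powers of u also lie in 1 + a W, so a would be invertible in
    \<open>W\<close>.\<close>
  have unit: "inverse (1 - a * b) \<in> W" if b: "b \<in> W" for b
  proof (rule ccontr)
    define u where "u = 1 - a * b"
    assume "inverse (1 - a * b) \<notin> W"
    then obtain p where p: "\<forall>i. coeff p i \<in> W" "a * poly p (inverse u) = 1" using adj u_def by blast
    have "u \<noteq> 0" using no_inv[OF b] by (simp add: u_def)
    then have pow: "u ^ degree p * inverse u ^ i = u ^ (degree p - i)" if "i \<le> degree p" for i
      using that by (simp add: power_diff power_inverse field_simps)
    have "u ^ degree p * poly p (inverse u) = (\<Sum>i\<le>degree p. coeff p i * u ^ (degree p - i))"
      unfolding poly_altdef sum_distrib_left by (rule sum.cong) (auto simp: pow mult.left_commute)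
    moreover have "(\<Sum>i\<le>degree p. coeff p i * u ^ (degree p - i)) \<in> W"
      using p(1) a b by (intro R) (auto simp: u_def intro!: R)
    ultimately obtain w where w: "w \<in> W" "u ^ degree p * poly p (inverse u) = w" by blast
    have upow: "\<exists>b'\<in>W. u ^ k = 1 - a * b'" for k
    proof (induction k)
      case 0
      show ?case by (intro bexI[of _ 0]) (auto intro: R)
    next
      case (Suc k)
      then obtain b' where b': "b' \<in> W" "u ^ k = 1 - a * b'" by blast
      then have "u ^ Suc k = u * (1 - a * b')" by (simp only: power_Suc)
      also have "\<dots> = 1 - a * (b + b' - a * b * b')" by (simp add: u_def algebra_simps)
      finally have "u ^ Suc k = 1 - a * (b + b' - a * b * b')" .
      moreover have "b + b' - a * b * b' \<in> W" using a b b' by (intro R) auto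
      ultimately show ?case by blast
    qed
    then obtain b' where b': "b' \<in> W" "u ^ degree p = 1 - a * b'" by blast
    have "u ^ degree p = a * w" using w(2) p(2) by (metis mult.left_commute mult.right_neutral)
    then have "a * (w + b') = 1" using b'(2) by (simp add: algebra_simps)
    then show False using no_inv[OF R(6)[OF w(1) b'(1)]] by simp
  qed
  define N where "N = (\<lambda>t k. \<exists>p. (\<forall>i. coeff p i \<in> W) \<and> degree p \<le> k \<and> a * poly p t = 1)"
  have N0: "\<not> N t 0" for t
  proof
    assume "N t 0"
    then obtain p where p: "\<forall>i. coeff p i \<in> W" "degree p = 0" "a * poly p t = 1" by (auto simp: N_def)
    then obtain c where "p = [:c:]" by (meson degree_eq_zeroE)
    then show False using p(3) no_inv[of c] p(1)[rule_format, of 0] by simp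
  qed
  \<comment> \<open>As 1 - a * coeff q 0 is a unit, the relation for 1/t expresses t ^ Suc k through
    lower powers, by the polynomial \<open>r\<close>; substituting it for the leading term of p
    lowers the degree. The bound l \<le> Suc k keeps the exponents Suc k - j from being
    truncated.\<close>
  have step: "N t k" if t: "t \<noteq> 0" and Nt: "N t (Suc k)" "N (inverse t) l" "l \<le> Suc k" for t k l
  proof -
    obtain p where p: "\<forall>i. coeff p i \<in> W" "degree p \<le> Suc k" "a * poly p t = 1" using Nt by (auto simp: N_def)
    obtain q where q: "\<forall>i. coeff q i \<in> W" "degree q \<le> l" "a * poly q (inverse t) = 1" using Nt by (auto simp: N_def)
    define u where "u = 1 - a * coeff q 0"
    have u: "inverse u \<in> W" "u \<noteq> 0" using unit no_inv q(1) by (auto simp: u_def)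
    define r where "r = (\<Sum>j\<in>{1..l}. monom (inverse u * a * coeff q j) (Suc k - j))"
    have r_coeff: "coeff r i \<in> W" for i
      unfolding r_def coeff_sum using u(1) a q(1) by (intro R) (auto intro!: R)
    have r_deg: "coeff r i = 0" if "i > k" for i
      unfolding r_def coeff_sum using that Nt(3) by (intro sum.neutral) auto
    have "poly q x = (\<Sum>j\<le>l. coeff q j * x ^ j)" for x
      unfolding poly_altdef by (rule sum.mono_neutral_left) (use q(2) in \<open>auto simp: coeff_eq_0\<close>)
    then have "1 = a * (\<Sum>j\<le>l. coeff q j * inverse t ^ j)" using q(3) by simp
    also have "(\<Sum>j\<le>l. coeff q j * inverse t ^ j) = coeff q 0 + (\<Sum>j\<in>{1..l}. coeff q j * inverse t ^ j)"
      by (simp add: atMost_atLeast0 sum.atLeast_Suc_atMost)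
    finally have "u = a * (\<Sum>j\<in>{1..l}. coeff q j * inverse t ^ j)" by (simp add: u_def algebra_simps)
    then have "inverse u * (a * (\<Sum>j\<in>{1..l}. coeff q j * inverse t ^ j)) = 1"
      using left_inverse[OF u(2)] by (simp only:)
    then have "t ^ Suc k = inverse u * a * (\<Sum>j\<in>{1..l}. coeff q j * inverse t ^ j) * t ^ Suc k"
      by (simp only: mult.assoc[of _ a] mult_1)
    also have "\<dots> = (\<Sum>j\<in>{1..l}. inverse u * a * coeff q j * (inverse t ^ j * t ^ Suc k))"
      by (simp add: sum_distrib_left sum_distrib_right mult.assoc)
    also have "\<dots> = poly r t"
      unfolding r_def poly_sum poly_monom
    proof (rule sum.cong)
      fix j assume "j \<in> {1..l}"
      then have "t ^ Suc k = t ^ (Suc k - j) * t ^ j" using Nt(3) by (simp flip: power_add)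
      then show "inverse u * a * coeff q j * (inverse t ^ j * t ^ Suc k) = inverse u * a * coeff q j * t ^ (Suc k - j)"
        using t by (simp add: power_inverse del: power_Suc)
    qed simp
    finally have tr: "t ^ Suc k = poly r t" .
    define p' where "p' = p - monom (coeff p (Suc k)) (Suc k) + smult (coeff p (Suc k)) r"
    have "poly p' t = poly p t" by (simp add: p'_def poly_monom tr del: power_Suc)
    moreover have "coeff p' i \<in> W" for i
      using p(1) r_coeff by (auto simp: p'_def intro!: R)
    moreover have "degree p' \<le> k"
    proof (rule degree_le, intro allI impI)
      fix i assume "k < i"
      then show "coeff p' i = 0"
        using r_deg[of i] p(2) by (cases "i = Suc k") (auto simp: p'_def coeff_eq_0)
    qed
    ultimately show ?thesis unfolding N_def using p(3) by (intro exI[of _ p']) simp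
  qed
  have "t \<in> W \<or> inverse t \<in> W" for t
  proof (rule ccontr)
    assume no: "\<not> (t \<in> W \<or> inverse t \<in> W)"
    then have t: "t \<noteq> 0" "inverse t \<noteq> 0" using R by auto
    have ex: "\<exists>k. N t k" "\<exists>k. N (inverse t) k"
      using adj[of t] adj[of "inverse t"] no unfolding N_def by blast+
    define k where "k = (LEAST k. N t k)"
    define l where "l = (LEAST k. N (inverse t) k)"
    have k: "N t k" "\<And>k'. N t k' \<Longrightarrow> k \<le> k'" unfolding k_def using ex by (auto intro: LeastI_ex Least_le)
    have l: "N (inverse t) l" "\<And>k'. N (inverse t) k' \<Longrightarrow> l \<le> k'" unfolding l_def using ex by (auto intro: LeastI_ex Least_le)
    obtain k' where k': "k = Suc k'" using k(1) N0 by (cases k) auto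
    obtain l' where l': "l = Suc l'" using l(1) N0 by (cases l) auto
    show False
    proof (cases "l \<le> k")
      case True
      then show False using step[OF t(1), of k' l] k l(1) k' by fastforce
    next
      case False
      then show False using step[OF t(2), of l' k] l k(1) l' by fastforce
    qed
  qed
  then show ?thesis using W by blast
qed

text \<open>The construction is applied to the integers and a = 2; characteristic 0 keeps 1/2 out of
  the integers.\<close>

lemma ex_dyadic_valuation_ring:
  "\<exists>W::'a::field_char_0 set. subring_set W \<and> 2 \<in> W \<and> inverse 2 \<notin> W \<and> (\<forall>t. t \<in> W \<or> inverse t \<in> W)"
proof -
  have Z: "subring_set (\<int> :: 'a set)" by (simp add: subring_set_def)
  have "inverse 2 \<notin> (\<int> :: 'a set)"
  proof
    assume "inverse 2 \<in> (\<int> :: 'a set)"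
    then obtain k :: int where "inverse 2 = (of_int k :: 'a)" by (auto elim: Ints_cases)
    then have "(of_int (2 * k) :: 'a) = of_int 1" by (simp add: field_simps)
    then have "2 * k = 1" by (simp only: of_int_eq_iff)
    then show False by presburger
  qed
  then obtain W :: "'a set" where W: "subring_set W" "\<int> \<subseteq> W" "inverse 2 \<notin> W" "\<forall>t. t \<in> W \<or> inverse t \<in> W"
    using ex_valuation_ring_excluding[OF Z, of 2] by auto
  moreover have "2 \<in> W" using W(2) Ints_numeral by blast
  ultimately show ?thesis by blast
qed

section \<open>Polynomials modulo a dyadic maximal ideal\<close>

lemma mpoly_sum_single: "(\<Sum>m\<in>Poly_Mapping.keys p. Poly_Mapping.single m (Poly_Mapping.lookup p m)) = p"
  by (rule poly_mapping_eqI) (auto simp: lookup_sum lookup_single when_def in_keys_iff)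

lemma lookup_times: "Poly_Mapping.lookup (p * q) m = (\<Sum>a\<in>Poly_Mapping.keys p. \<Sum>b\<in>Poly_Mapping.keys q.
    (Poly_Mapping.lookup p a * Poly_Mapping.lookup q b when a + b = m))" for p q :: mpoly
proof -
  have "p * q = (\<Sum>a\<in>Poly_Mapping.keys p. \<Sum>b\<in>Poly_Mapping.keys q.
      Poly_Mapping.single (a + b) (Poly_Mapping.lookup p a * Poly_Mapping.lookup q b))"
    by (subst (1) mpoly_sum_single[of p, symmetric], subst (1) mpoly_sum_single[of q, symmetric])
      (simp add: sum_product mult_single)
  then show ?thesis by (simp add: lookup_sum lookup_single)
qed

definition sqfree_exp :: "nat set \<Rightarrow> (nat \<Rightarrow>\<^sub>0 nat)" where
  "sqfree_exp T = (\<Sum>i\<in>T. Poly_Mapping.single i 1)"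

lemma lookup_sqfree_exp: "finite T \<Longrightarrow> Poly_Mapping.lookup (sqfree_exp T) i = (if i \<in> T then 1 else 0)"
  by (simp add: sqfree_exp_def lookup_sum lookup_single when_def)

lemma double_plus_bit_eq:
  fixes x y :: nat
  assumes "2 * x + (if P then 1 else 0) = 2 * y + (if Q then 1 else 0)"
  shows "x = y \<and> (P \<longleftrightarrow> Q)"
proof -
  have "even (2 * x + (if P then 1 else 0)) \<longleftrightarrow> even (2 * y + (if Q then 1 else 0))"
    using assms by (simp only:)
  then have "P \<longleftrightarrow> Q" by (cases P; cases Q) simp_all
  then show ?thesis using assms by auto
qed

text \<open>By parity, an exponent vector is twice a vector plus the indicator of a set in at most
  one way; this underlies the independence of the squarefree monomials over squares.\<close>

lemma double_plus_sqfree_exp_eq_iff: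
  assumes "finite S" "finite T"
  shows "a + a + sqfree_exp S = b + b + sqfree_exp T \<longleftrightarrow> a = b \<and> S = T"
proof
  assume "a + a + sqfree_exp S = b + b + sqfree_exp T"
  then have eq: "2 * Poly_Mapping.lookup a i + (if i \<in> S then 1 else 0) = 2 * Poly_Mapping.lookup b i + (if i \<in> T then 1 else 0)" for i
    using arg_cong[OF \<open>a + a + sqfree_exp S = _\<close>, of "\<lambda>m. Poly_Mapping.lookup m i"]
    unfolding lookup_add lookup_sqfree_exp[OF assms(1)] lookup_sqfree_exp[OF assms(2)] by simp
  have "Poly_Mapping.lookup a i = Poly_Mapping.lookup b i \<and> (i \<in> S \<longleftrightarrow> i \<in> T)" for i
    by (rule double_plus_bit_eq[OF eq])
  then show "a = b \<and> S = T" using poly_mapping_eqI[of a b] by blast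
qed simp

text \<open>The diagonal entry at \<open>S\<close> of the form whose parameter \<epsilon> is the
  indicator of \<open>E\<close>.\<close>

definition shifted_prod :: "nat set \<Rightarrow> nat set \<Rightarrow> mpoly" where
  "shifted_prod E S = (\<Prod>i\<in>S. Poly_Mapping.single (Poly_Mapping.single i 1) 1 + (if i \<in> E then 1 else 0))"

text \<open>Choosing x_i for i in T and the constant in the other factors gives a nonzero term
  exactly when S - T lies in \<open>E\<close>.\<close>

lemma shifted_prod_expand:
  assumes "finite S"
  shows "shifted_prod E S = (\<Sum>T\<in>Pow S. if S \<subseteq> T \<union> E then Poly_Mapping.single (sqfree_exp T) 1 else 0)"
proof -
  have mon: "(\<Prod>i\<in>T. Poly_Mapping.single (Poly_Mapping.single i 1) 1 :: mpoly) = Poly_Mapping.single (sqfree_exp T) 1" for T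
    by (induction T rule: infinite_finite_induct) (auto simp: sqfree_exp_def mult_single)
  have ones: "(\<Prod>i\<in>S - T. if i \<in> E then 1 else 0 :: mpoly) = (if S \<subseteq> T \<union> E then 1 else 0)" for T
    using assms by (auto intro!: prod.neutral)
  show ?thesis unfolding shifted_prod_def prod_add[OF assms] mon ones
    by (intro sum.cong) auto
qed

locale dyadic_valuation_ring =
  fixes W :: "complex set"
  assumes subring: "subring_set W" and total: "\<And>t. t \<in> W \<or> inverse t \<in> W"
    and two_in: "2 \<in> W" and half_notin: "inverse 2 \<notin> W"
begin

lemmas subringD = subring_setD[OF subring]

text \<open>The nonunits of \<open>W\<close>; 0 is listed separately because
  \<open>inverse 0 = 0\<close> lies in \<open>W\<close>.\<close>

definition max_ideal :: "complex set" where
  "max_ideal = {x \<in> W. x = 0 \<or> inverse x \<notin> W}"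

lemma max_ideal_mult:
  assumes w: "w \<in> W" and x: "x \<in> max_ideal"
  shows "w * x \<in> max_ideal"
proof (cases "w * x = 0")
  case True
  then show ?thesis using subringD(2) by (auto simp: max_ideal_def)
next
  case False
  then have eq: "w * inverse (w * x) = inverse x" by (simp add: field_simps)
  have "inverse (w * x) \<notin> W"
  proof
    assume "inverse (w * x) \<in> W"
    from subringD(4)[OF w this] have "inverse x \<in> W" by (simp only: eq)
    then show False using x False by (simp add: max_ideal_def)
  qed
  then show ?thesis using subringD(4)[OF w, of x] x by (simp add: max_ideal_def)
qed

text \<open>For nonzero x and y, one of y / x and x / y lies in \<open>W\<close>, so the sum is a
  \<open>W\<close>-multiple of one of the summands.\<close>

lemma max_ideal_add:
  assumes x: "x \<in> max_ideal" and y: "y \<in> max_ideal"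
  shows "x + y \<in> max_ideal"
proof -
  have *: "x + y \<in> max_ideal" if x: "x \<in> max_ideal" and xy: "x \<noteq> 0" "y / x \<in> W" for x y
  proof -
    have "x + y = (1 + y / x) * x" using xy by (simp add: field_simps)
    then show ?thesis using max_ideal_mult[OF subringD(6)[OF subringD(1) xy(2)] x] by simp
  qed
  show ?thesis
  proof (cases "x = 0 \<or> y = 0")
    case False
    then show ?thesis using total[of "y / x"] *[OF x, of y] *[OF y, of x] by (auto simp: add.commute)
  qed (use x y in auto)
qed

lemma max_ideal_simps: "0 \<in> max_ideal" "1 \<notin> max_ideal" "2 \<in> max_ideal"
  using subringD(1,2) two_in half_notin by (simp_all add: max_ideal_def)

lemma max_ideal_square: "x \<in> W \<Longrightarrow> x\<^sup>2 \<in> max_ideal \<Longrightarrow> x \<in> max_ideal"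
  using subringD(4)[of "inverse x" "inverse x"] by (simp add: max_ideal_def power2_eq_square) blast

lemma max_ideal_sum: "(\<And>s. s \<in> S \<Longrightarrow> f s \<in> max_ideal) \<Longrightarrow> sum f S \<in> max_ideal"
  by (induction S rule: infinite_finite_induct) (simp_all add: max_ideal_simps max_ideal_add)

definition int_polys :: "mpoly set" where
  "int_polys = {p. \<forall>m. Poly_Mapping.lookup p m \<in> W}"

text \<open>Congruence modulo \<open>red_ideal\<close> is equality after reducing coefficients, so
  polynomials over the residue field are handled without constructing that field.\<close>

definition red_ideal :: "mpoly set" where
  "red_ideal = {p. \<forall>m. Poly_Mapping.lookup p m \<in> max_ideal}"

lemma int_polys_times:
  assumes "p \<in> int_polys" "q \<in> int_polys"
  shows "p * q \<in> int_polys"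
proof -
  have "Poly_Mapping.lookup p a * Poly_Mapping.lookup q b \<in> W" for a b
    using assms subringD(4) by (simp add: int_polys_def)
  then have "Poly_Mapping.lookup (p * q) m \<in> W" for m
    unfolding lookup_times when_def by (intro subring_set_sum[OF subring]) (simp add: subringD(2))
  then show ?thesis by (simp add: int_polys_def)
qed

lemma int_polys:
  "1 \<in> int_polys" "0 \<in> int_polys" "p \<in> int_polys \<Longrightarrow> q \<in> int_polys \<Longrightarrow> p + q \<in> int_polys"
  "p \<in> int_polys \<Longrightarrow> q \<in> int_polys \<Longrightarrow> p - q \<in> int_polys"
  "p \<in> int_polys \<Longrightarrow> q \<in> int_polys \<Longrightarrow> p * q \<in> int_polys"
  "c \<in> W \<Longrightarrow> Poly_Mapping.single m c \<in> int_polys"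
proof -
  show "1 \<in> int_polys" "0 \<in> int_polys" using subringD(1,2) by (simp_all add: int_polys_def lookup_one when_def)
  show "p \<in> int_polys \<Longrightarrow> q \<in> int_polys \<Longrightarrow> p + q \<in> int_polys"
    unfolding int_polys_def by (simp add: lookup_add subringD(6))
  show "p \<in> int_polys \<Longrightarrow> q \<in> int_polys \<Longrightarrow> p - q \<in> int_polys"
    unfolding int_polys_def by (simp add: lookup_minus subringD(3))
  show "c \<in> W \<Longrightarrow> Poly_Mapping.single m c \<in> int_polys"
    unfolding int_polys_def by (simp add: lookup_single when_def subringD(2))
qed (rule int_polys_times)

lemma red_ideal_add: "p \<in> red_ideal \<Longrightarrow> q \<in> red_ideal \<Longrightarrow> p + q \<in> red_ideal"
  by (auto simp: red_ideal_def lookup_add intro: max_ideal_add)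

lemma red_ideal_zero: "0 \<in> red_ideal"
  by (simp add: red_ideal_def max_ideal_simps)

lemma red_ideal_mult:
  assumes "p \<in> int_polys" "q \<in> red_ideal"
  shows "p * q \<in> red_ideal"
proof -
  have "Poly_Mapping.lookup p a * Poly_Mapping.lookup q b \<in> max_ideal" for a b
    using assms by (simp add: int_polys_def red_ideal_def max_ideal_mult)
  then have "Poly_Mapping.lookup (p * q) m \<in> max_ideal" for m
    unfolding lookup_times when_def by (intro max_ideal_sum) (simp add: max_ideal_simps)
  then show ?thesis by (simp add: red_ideal_def)
qed

lemma red_ideal_diff: "p \<in> red_ideal \<Longrightarrow> q \<in> red_ideal \<Longrightarrow> p - q \<in> red_ideal"
proof -
  assume p: "p \<in> red_ideal" and q: "q \<in> red_ideal"
  have "p + (0 - 1) * q \<in> red_ideal"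
    by (intro red_ideal_add red_ideal_mult p q int_polys(4) int_polys(1,2))
  then show "p - q \<in> red_ideal" by simp
qed

lemma red_ideal_sum: "(\<And>s. s \<in> S \<Longrightarrow> f s \<in> red_ideal) \<Longrightarrow> sum f S \<in> red_ideal"
  by (induction S rule: infinite_finite_induct) (simp_all add: red_ideal_zero red_ideal_add)

lemma int_polys_sum: "(\<And>s. s \<in> S \<Longrightarrow> f s \<in> int_polys) \<Longrightarrow> sum f S \<in> int_polys"
  by (induction S rule: infinite_finite_induct) (simp_all add: int_polys(2,3))

lemma of_nat_int_polys: "of_nat k \<in> int_polys"
  by (induction k) (simp_all add: int_polys(1,2,3))

lemma two_mult_red_ideal: "p \<in> int_polys \<Longrightarrow> 2 * p \<in> red_ideal"
proof -
  assume p: "p \<in> int_polys"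
  have "(2::mpoly) \<in> red_ideal"
    by (simp add: red_ideal_def lookup_numeral when_def max_ideal_simps)
  from red_ideal_mult[OF p this] show ?thesis by (subst mult.commute)
qed

text \<open>Cross terms carry a factor 2, so squaring is additive modulo
  \<open>red_ideal\<close>.\<close>

lemma square_sum_red_ideal:
  assumes "finite S" "\<And>s. s \<in> S \<Longrightarrow> f s \<in> int_polys"
  shows "(sum f S)\<^sup>2 - (\<Sum>s\<in>S. (f s)\<^sup>2) \<in> red_ideal"
  using assms
proof (induction S rule: finite_induct)
  case (insert s S)
  have "(sum f (insert s S))\<^sup>2 - (\<Sum>s\<in>insert s S. (f s)\<^sup>2) =
      ((sum f S)\<^sup>2 - (\<Sum>s\<in>S. (f s)\<^sup>2)) + 2 * (f s * sum f S)"
  proof -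
    have "(a + b)\<^sup>2 - (a\<^sup>2 + c) = (b\<^sup>2 - c) + 2 * (a * b)" for a b c :: mpoly
      by (simp add: power2_sum mult.assoc)
    then show ?thesis unfolding sum.insert[OF insert.hyps] .
  qed
  also have "\<dots> \<in> red_ideal"
  proof (rule red_ideal_add)
    show "(sum f S)\<^sup>2 - (\<Sum>s\<in>S. (f s)\<^sup>2) \<in> red_ideal"
      using insert.IH insert.prems by blast
    show "2 * (f s * sum f S) \<in> red_ideal"
      by (intro two_mult_red_ideal int_polys(5) int_polys_sum insert.prems) simp_all
  qed
  finally show ?case .
qed (simp add: red_ideal_zero)

text \<open>Modulo the ideal the polynomial ring has characteristic 2, so squares only involve even exponents.\<close>
lemma squares_sqfree_independent:
  assumes U: "finite U" and c: "\<And>T. T \<subseteq> U \<Longrightarrow> c T \<in> int_polys"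
    and sum: "(\<Sum>T\<in>Pow U. (c T)\<^sup>2 * Poly_Mapping.single (sqfree_exp T) 1) \<in> red_ideal" and T0: "T0 \<subseteq> U"
  shows "c T0 \<in> red_ideal"
proof -
  \<comment> \<open>The Frobenius image, with squared coefficients and doubled exponents; it is
    congruent to the square of p.\<close>
  define fr where "fr = (\<lambda>p :: mpoly. \<Sum>a\<in>Poly_Mapping.keys p. Poly_Mapping.single (a + a) ((Poly_Mapping.lookup p a)\<^sup>2))"
  have fr: "p\<^sup>2 - fr p \<in> red_ideal" if "p \<in> int_polys" for p
  proof -
    have "Poly_Mapping.single m (Poly_Mapping.lookup p m) \<in> int_polys" for m
      using that by (intro int_polys(6)) (simp add: int_polys_def)
    then have "(\<Sum>m\<in>Poly_Mapping.keys p. Poly_Mapping.single m (Poly_Mapping.lookup p m))\<^sup>2 -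
        (\<Sum>m\<in>Poly_Mapping.keys p. (Poly_Mapping.single m (Poly_Mapping.lookup p m))\<^sup>2) \<in> red_ideal"
      by (intro square_sum_red_ideal finite_keys)
    then show ?thesis
      unfolding mpoly_sum_single by (simp add: fr_def power2_eq_square mult_single)
  qed
  have single1: "Poly_Mapping.single m 1 \<in> int_polys" for m using int_polys(6) subringD(1) by blast
  have "(\<Sum>T\<in>Pow U. (c T)\<^sup>2 * Poly_Mapping.single (sqfree_exp T) 1) -
      (\<Sum>T\<in>Pow U. Poly_Mapping.single (sqfree_exp T) 1 * ((c T)\<^sup>2 - fr (c T))) \<in> red_ideal"
    by (intro red_ideal_diff sum red_ideal_sum red_ideal_mult single1 fr c) auto
  then have frs: "(\<Sum>T\<in>Pow U. fr (c T) * Poly_Mapping.single (sqfree_exp T) 1) \<in> red_ideal"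
    by (simp add: sum_subtractf[symmetric] algebra_simps)
  \<comment> \<open>At the exponent \<open>a + a + sqfree_exp T0\<close> only the pair of a and T0
    contributes, so the coefficient of the sum there is exactly this square.\<close>
  have "(Poly_Mapping.lookup (c T0) a)\<^sup>2 \<in> max_ideal" for a
  proof -
    have "Poly_Mapping.lookup (\<Sum>T\<in>Pow U. fr (c T) * Poly_Mapping.single (sqfree_exp T) 1) (a + a + sqfree_exp T0) =
        (\<Sum>T\<in>Pow U. \<Sum>b\<in>Poly_Mapping.keys (c T). if b = a \<and> T = T0 then (Poly_Mapping.lookup (c T) b)\<^sup>2 else 0)"
      unfolding fr_def sum_distrib_right lookup_sum mult_single lookup_single when_def
      using U T0 by (intro sum.cong refl) (auto simp: double_plus_sqfree_exp_eq_iff finite_subset)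
    also have "\<dots> = (\<Sum>T\<in>Pow U. if T = T0 then (Poly_Mapping.lookup (c T) a)\<^sup>2 else 0)"
    proof (intro sum.cong refl)
      fix T
      show "(\<Sum>b\<in>Poly_Mapping.keys (c T). if b = a \<and> T = T0 then (Poly_Mapping.lookup (c T) b)\<^sup>2 else 0) =
          (if T = T0 then (Poly_Mapping.lookup (c T) a)\<^sup>2 else 0)"
        by (cases "T = T0") (auto simp: in_keys_iff)
    qed
    also have "\<dots> = (Poly_Mapping.lookup (c T0) a)\<^sup>2" using U T0 by simp
    finally show ?thesis using frs unfolding red_ideal_def mem_Collect_eq by (metis (no_types, lifting))
  qed
  then show ?thesis using c[OF T0] max_ideal_square by (simp add: red_ideal_def int_polys_def)
qed

text \<open>In characteristic 2 the value sets of the \<open>2 ^ card U\<close> pure parts are hyperplanes with zero intersection: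
  \<open>coef E T\<close> is the square root of the coordinate of the value at the squarefree monomial \<open>T\<close>, and evaluating
  the resulting multilinear polynomial at the indicator vector of \<open>E\<close> gives zero.\<close>
lemma common_value_pure_parts_red_ideal:
  assumes U: "finite U" and u: "\<And>S E. S \<subseteq> U \<Longrightarrow> E \<subseteq> U \<Longrightarrow> u S E \<in> int_polys"
    and Z: "\<And>E. E \<subseteq> U \<Longrightarrow> (\<Sum>S\<in>Pow U - {{}}. shifted_prod E S * (u S E)\<^sup>2) = Z"
    and SE: "S \<subseteq> U" "S \<noteq> {}" "E \<subseteq> U"
  shows "u S E \<in> red_ideal"
proof -
  \<comment> \<open>\<open>C E T\<close> holds the nonempty S for which the monomial of T occurs in
    \<open>shifted_prod E S\<close>. By Frobenius, the squares of their \<open>u S E\<close> add up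
    to the square of \<open>coef E T\<close>.\<close>
  define C where "C = (\<lambda>E T. {S \<in> Pow U - {{}}. T \<subseteq> S \<and> S \<subseteq> T \<union> E})"
  define coef where "coef = (\<lambda>E T. \<Sum>S\<in>C E T. u S E)"
  have finC: "finite (C E T)" for E T using U by (simp add: C_def)
  have coef_in: "coef E T \<in> int_polys" if "E \<subseteq> U" for E T
    unfolding coef_def using that by (intro int_polys_sum u) (auto simp: C_def)
  have single1: "Poly_Mapping.single m 1 \<in> int_polys" for m using int_polys(6) subringD(1) by blast
  have expand: "(\<Sum>T\<in>Pow U. (coef E T)\<^sup>2 * Poly_Mapping.single (sqfree_exp T) 1) - Z \<in> red_ideal" if E: "E \<subseteq> U" for E
  proof -
    have "Z = (\<Sum>S\<in>Pow U - {{}}. \<Sum>T\<in>Pow S. if S \<subseteq> T \<union> E then Poly_Mapping.single (sqfree_exp T) 1 * (u S E)\<^sup>2 else 0)"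
      unfolding Z[OF E, symmetric]
    proof (intro sum.cong refl)
      fix S assume "S \<in> Pow U - {{}}"
      then have "finite S" using U finite_subset by auto
      then show "shifted_prod E S * (u S E)\<^sup>2 =
          (\<Sum>T\<in>Pow S. if S \<subseteq> T \<union> E then Poly_Mapping.single (sqfree_exp T) 1 * (u S E)\<^sup>2 else 0)"
        by (simp add: shifted_prod_expand sum_distrib_right if_distrib[of "\<lambda>x. x * _"] cong: if_cong)
    qed
    also have "\<dots> = (\<Sum>S\<in>Pow U - {{}}. \<Sum>T\<in>Pow U. if T \<subseteq> S \<and> S \<subseteq> T \<union> E then Poly_Mapping.single (sqfree_exp T) 1 * (u S E)\<^sup>2 else 0)"
      using U by (intro sum.cong refl sum.mono_neutral_cong_left) auto
    also have "\<dots> = (\<Sum>T\<in>Pow U. \<Sum>S\<in>Pow U - {{}}. if T \<subseteq> S \<and> S \<subseteq> T \<union> E then Poly_Mapping.single (sqfree_exp T) 1 * (u S E)\<^sup>2 else 0)"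
      by (rule sum.swap)
    also have "\<dots> = (\<Sum>T\<in>Pow U. (\<Sum>S\<in>C E T. (u S E)\<^sup>2) * Poly_Mapping.single (sqfree_exp T) 1)"
      unfolding C_def sum_distrib_right using U by (simp add: sum.If_cases mult.commute Int_def conj_ac)
    finally have "(\<Sum>T\<in>Pow U. (coef E T)\<^sup>2 * Poly_Mapping.single (sqfree_exp T) 1) - Z =
        (\<Sum>T\<in>Pow U. Poly_Mapping.single (sqfree_exp T) 1 * ((coef E T)\<^sup>2 - (\<Sum>S\<in>C E T. (u S E)\<^sup>2)))"
      by (simp add: sum_subtractf[symmetric] algebra_simps)
    also have "\<dots> \<in> red_ideal"
      unfolding coef_def using E finC
      by (intro red_ideal_sum red_ideal_mult single1 square_sum_red_ideal u) (auto simp: C_def)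
    finally show ?thesis .
  qed
  have indep: "coef E T - coef {} T \<in> red_ideal" if E: "E \<subseteq> U" and T: "T \<subseteq> U" for E T
  proof (rule squares_sqfree_independent[OF U _ _ T, of "\<lambda>T. coef E T - coef {} T"])
    show "coef E T - coef {} T \<in> int_polys" for T using coef_in E by (intro int_polys) auto
    \<comment> \<open>The square of a difference is the difference of squares up to an even term,
      and \<open>Z\<close> cancels.\<close>
    have eq: "(\<Sum>T\<in>Pow U. (coef E T - coef {} T)\<^sup>2 * Poly_Mapping.single (sqfree_exp T) 1) =
      (((\<Sum>T\<in>Pow U. (coef E T)\<^sup>2 * Poly_Mapping.single (sqfree_exp T) 1) - Z) -
       ((\<Sum>T\<in>Pow U. (coef {} T)\<^sup>2 * Poly_Mapping.single (sqfree_exp T) 1) - Z)) +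
      (\<Sum>T\<in>Pow U. 2 * ((coef {} T * (coef {} T - coef E T)) * Poly_Mapping.single (sqfree_exp T) 1))"
    proof -
      have "(x - y)\<^sup>2 * z = x\<^sup>2 * z - y\<^sup>2 * z + 2 * (y * (y - x) * z)" for x y z :: mpoly
        by (simp add: power2_eq_square algebra_simps)
      then show ?thesis by (simp only: sum.distrib sum_subtractf) simp
    qed
    show "(\<Sum>T\<in>Pow U. (coef E T - coef {} T)\<^sup>2 * Poly_Mapping.single (sqfree_exp T) 1) \<in> red_ideal"
      unfolding eq using E
      by (intro red_ideal_add red_ideal_diff expand red_ideal_sum two_mult_red_ideal int_polys coef_in subringD) auto
  qed
  \<comment> \<open>The sum is the value at the indicator of \<open>E\<close>. Each nonempty S
    \<subseteq> E is counted once for each of its 2 ^ card S subsets T, an even number of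
    times.\<close>
  have even: "(\<Sum>T\<in>Pow E. coef E T) \<in> red_ideal" if E: "E \<subseteq> U" for E
  proof -
    have finE: "finite E" using E U finite_subset by blast
    have "(\<Sum>T\<in>Pow E. coef E T) = (\<Sum>T\<in>Pow E. \<Sum>S\<in>Pow E - {{}}. if T \<subseteq> S then u S E else 0)"
    proof (intro sum.cong refl)
      fix T assume "T \<in> Pow E"
      then have "C E T = {S \<in> Pow E - {{}}. T \<subseteq> S}" using E by (auto simp: C_def)
      then show "coef E T = (\<Sum>S\<in>Pow E - {{}}. if T \<subseteq> S then u S E else 0)"
        unfolding coef_def using finE by (simp only: sum.inter_filter finite_Pow_iff finite_Diff)
    qed
    also have "\<dots> = (\<Sum>S\<in>Pow E - {{}}. \<Sum>T\<in>Pow E. if T \<subseteq> S then u S E else 0)"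
      by (rule sum.swap)
    also have "\<dots> = (\<Sum>S\<in>Pow E - {{}}. 2 * (of_nat (2 ^ (card S - 1)) * u S E))"
    proof (intro sum.cong refl)
      fix S assume S: "S \<in> Pow E - {{}}"
      then have finS: "finite S" "card S > 0" using finE finite_subset by (auto simp: card_gt_0_iff)
      have "(\<Sum>T\<in>Pow E. if T \<subseteq> S then u S E else 0) = (\<Sum>T\<in>Pow S. u S E)"
        using S finE by (intro sum.mono_neutral_cong_right) auto
      also have "\<dots> = of_nat (2 ^ card S) * u S E" by (simp add: card_Pow finS)
      also have "(2::nat) ^ card S = 2 * 2 ^ (card S - 1)" using finS(2) by (cases "card S") auto
      finally show "(\<Sum>T\<in>Pow E. if T \<subseteq> S then u S E else 0) = 2 * (of_nat (2 ^ (card S - 1)) * u S E)"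
        by (simp add: mult.assoc)
    qed
    also have "\<dots> \<in> red_ideal"
    proof (intro red_ideal_sum two_mult_red_ideal int_polys u E)
      fix S assume "S \<in> Pow E - {{}}"
      then show "S \<subseteq> U" using E by auto
      show "of_nat (2 ^ (card S - 1)) \<in> int_polys"
        by (rule of_nat_int_polys)
    qed
    finally show ?thesis .
  qed
  \<comment> \<open>As the coefficients agree for all E, those of the empty set satisfy the
    evaluation at every vertex of the cube; induction on E solves this triangular system.\<close>
  have coef0: "coef {} E \<in> red_ideal" if E: "E \<subseteq> U" for E
    using finite_subset[OF E U] E
  proof (induction E rule: finite_psubset_induct)
    case (psubset E)
    have "(\<Sum>T\<in>Pow E. coef E T) - (\<Sum>T\<in>Pow E. coef E T - coef {} T) \<in> red_ideal"
      using psubset by (intro red_ideal_diff even red_ideal_sum indep) auto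
    then have "(\<Sum>T\<in>Pow E. coef {} T) \<in> red_ideal" by (simp add: sum_subtractf)
    moreover have "(\<Sum>T\<in>Pow E. coef {} T) = coef {} E + (\<Sum>T\<in>Pow E - {E}. coef {} T)"
      using psubset.hyps by (intro sum.remove) auto
    moreover have "(\<Sum>T\<in>Pow E - {E}. coef {} T) \<in> red_ideal"
      using psubset by (intro red_ideal_sum psubset.IH) auto
    ultimately show ?case using red_ideal_diff by (metis add_diff_cancel_right')
  qed
  have coef: "coef E T \<in> red_ideal" if "E \<subseteq> U" "T \<subseteq> U" for E T
    using red_ideal_add[OF indep[OF that] coef0[OF that(2)]] by simp
  \<comment> \<open>Downward from the largest sets: \<open>coef E S\<close> is \<open>u S E\<close>
    plus terms at proper supersets of S.\<close>
  show ?thesis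
    using SE
  proof (induction "card (U - S)" arbitrary: S rule: less_induct)
    case less
    have "coef E S = u S E + (\<Sum>S'\<in>C E S - {S}. u S' E)"
      unfolding coef_def using finC less.prems by (intro sum.remove) (auto simp: C_def)
    moreover have "(\<Sum>S'\<in>C E S - {S}. u S' E) \<in> red_ideal"
    proof (intro red_ideal_sum less.hyps)
      fix S' assume "S' \<in> C E S - {S}"
      then have S': "S \<subset> S'" "S' \<subseteq> U" "S' \<noteq> {}" by (auto simp: C_def)
      then show "card (U - S') < card (U - S)" using U by (intro psubset_card_mono) auto
      show "S' \<subseteq> U" "S' \<noteq> {}" using S' by auto
    qed (rule less.prems)
    ultimately show ?case using coef[OF less.prems(3,1)] red_ideal_diff by (metis add_diff_cancel_right')
  qed
qed

text \<open>An element of least valuation; dividing by it makes finitely many coefficients integral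
  with a unit among them.\<close>

lemma ex_dividing_all:
  assumes "finite X" "X \<noteq> {}" "0 \<notin> X"
  shows "\<exists>k\<in>X. \<forall>x\<in>X. x / k \<in> W"
  using assms
proof (induction X rule: finite_ne_induct)
  case (singleton x)
  then show ?case using subringD(1) by simp
next
  case (insert y X)
  then obtain k where k: "k \<in> X" "\<forall>x\<in>X. x / k \<in> W" by auto
  have nz: "k \<noteq> 0" "y \<noteq> 0" using k(1) insert.prems by auto
  show ?case
  proof (cases "y / k \<in> W")
    case True
    then show ?thesis using k by auto
  next
    case False
    then have ky: "k / y \<in> W" using total[of "y / k"] by simp
    have "x / y \<in> W" if "x \<in> X" for x
      using subringD(4)[OF k(2)[rule_format, OF that] ky] nz by simp
    then show ?thesis using nz subringD(1) by (intro bexI[of _ y]) auto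
  qed
qed

end

section \<open>Pfister forms without a common factor\<close>

lemma length_pfister_list: "length (pfister_list as) = 2 ^ length as"
  by (induction as) (simp_all add: length_tensor_list)

lemma pfister_list_nth_0: "pfister_list as ! 0 = 1"
  by (induction as) (simp_all add: nth_tensor_list length_pfister_list)

context subfield_set
begin

text \<open>A reflection moves a vector of value 1 to the first basis vector; it moves a vector
  orthogonal to it into the pure part.\<close>
lemma pure_part_represents:
  fixes d e f :: "nat \<Rightarrow> 'a"
  assumes two: "(2::'a) \<noteq> 0" and N: "N > 0" "d 0 = 1"
    and in_F: "\<And>l. l < N \<Longrightarrow> e l \<in> F" "\<And>l. l < N \<Longrightarrow> f l \<in> F"
    and ee: "(\<Sum>l<N. e l * e l * d l) = 1" and ff: "(\<Sum>l<N. f l * f l * d l) = y"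
    and ef: "(\<Sum>l<N. e l * f l * d l) = 0"
  shows "\<exists>v. (\<forall>l<N. v l \<in> F) \<and> (\<Sum>l\<in>{1..<N}. d l * (v l)\<^sup>2) = y"
proof -
  \<comment> \<open>The reflection is in e - s e_0, where e_0 is the first basis vector; this vector
    has value 2 w, and the sign s ensures w \<noteq> 0. The image of f has coordinate 0 at index 0
    and f l + t * e l at every other l.\<close>
  define s :: 'a where "s = (if e 0 = 1 then - 1 else 1)"
  define w where "w = 1 - s * e 0"
  have s: "s * s = 1" "s \<in> F" by (auto simp: s_def)
  have w: "w \<noteq> 0" using two by (auto simp: w_def s_def)
  define t where "t = s * f 0 / w"
  have f0: "f 0 = s * t * w" using w s(1) by (simp add: t_def flip: mult.assoc)
  have t_in: "t \<in> F" using in_F N(1) s(2) by (simp add: t_def w_def)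
  have split: "(\<Sum>l<N. g l) = g 0 + (\<Sum>l\<in>{1..<N}. g l)" for g :: "nat \<Rightarrow> 'a"
    using N(1) by (simp add: lessThan_atLeast0 sum.atLeast_Suc_lessThan)
  have A: "(\<Sum>l\<in>{1..<N}. e l * e l * d l) = 1 - e 0 * e 0"
    and B: "(\<Sum>l\<in>{1..<N}. e l * f l * d l) = - (e 0 * f 0)"
    and C: "(\<Sum>l\<in>{1..<N}. f l * f l * d l) = y - f 0 * f 0"
    using ee ef ff N(2) split by (simp_all add: algebra_simps eq_neg_iff_add_eq_0)
  have "(\<Sum>l\<in>{1..<N}. d l * (f l + t * e l)\<^sup>2) =
      (\<Sum>l\<in>{1..<N}. f l * f l * d l + 2 * t * (e l * f l * d l) + t * t * (e l * e l * d l))"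
    by (rule sum.cong) (auto simp: power2_eq_square algebra_simps)
  also have "\<dots> = (y - f 0 * f 0) + 2 * t * (- (e 0 * f 0)) + t * t * (1 - e 0 * e 0)"
    unfolding sum.distrib sum_distrib_left[symmetric] A B C ..
  also have "\<dots> = y"
  proof (cases "e 0 = 1")
    case True
    then show ?thesis unfolding f0 w_def by (simp add: s_def algebra_simps)
  next
    case False
    then show ?thesis unfolding f0 w_def by (simp add: s_def algebra_simps)
  qed
  finally show ?thesis
    using in_F t_in by (intro exI[of _ "\<lambda>l. f l + t * e l"]) simp
qed

text \<open>Columns 0 and k of the isometry are orthogonal vectors with values 1 and -c, as
  \<open>pure_part_represents\<close> requires.\<close>

lemma slot_represented_by_pure_part:
  assumes two: "(2::'a) \<noteq> 0" and xs: "length xs = 2 ^ (length ps + 2)" "xs ! 0 = 1"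
    and iso: "isometric_over F (diag_form xs) (kron (pfister (c # ps)) (pf1 b))"
  shows "\<exists>v. (\<forall>l<length xs. v l \<in> F) \<and> (\<Sum>l\<in>{1..<length xs}. xs ! l * (v l)\<^sup>2) = - c"
proof -
  define P where "P = pfister_list ps"
  define ys where "ys = tensor_list (tensor_list [1, - c] P) [1, - b]"
  \<comment> \<open>The leftmost factor is <1, -c>, so its entry -c comes after the 2 * 2 ^ length
    ps entries that belong to 1.\<close>
  define k :: nat where "k = 2 * 2 ^ length ps"
  have P: "length P = 2 ^ length ps" "P ! 0 = 1" by (simp_all add: P_def length_pfister_list pfister_list_nth_0)
  have ys: "length ys = length xs" "ys ! 0 = 1" "ys ! k = - c"
    by (simp_all add: ys_def length_tensor_list nth_tensor_list P xs k_def flip: numeral_2_eq_2)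
  have k: "0 < k" "k < length xs" by (simp_all add: k_def xs)
  have "isometric_over F (diag_form xs) (diag_form ys)"
    using iso unfolding pfister_eq_diag_form pf1_def kron_diag_form by (simp add: ys_def P_def)
  then obtain M where M: "\<And>i j. i < length xs \<Longrightarrow> j < length xs \<Longrightarrow> M i j \<in> F"
    "\<And>i j. i < length xs \<Longrightarrow> j < length xs \<Longrightarrow>
      (\<Sum>l<length xs. M l i * M l j * xs ! l) = (if i = j then ys ! i else 0)"
    using isometric_over_diag_formD[of F xs ys] ys(1) by metis
  show ?thesis
  proof (rule pure_part_represents[OF two, of "length xs" "(!) xs" "\<lambda>l. M l 0" "\<lambda>l. M l k"])
    have "0 < length xs" using k by linarith
    from M(2)[OF this this] show "(\<Sum>l<length xs. M l 0 * M l 0 * xs ! l) = 1" using ys(2) by simp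
    show "(\<Sum>l<length xs. M l k * M l k * xs ! l) = - c" using M(2)[of k k] k ys by simp
    from M(2)[OF \<open>0 < length xs\<close> k(2)] show "(\<Sum>l<length xs. M l 0 * M l k * xs ! l) = 0"
      using k(1) by simp
  qed (use M k xs in auto)
qed

end

section \<open>The forms indexed by the vertices of the cube\<close>

fun subset_list :: "nat \<Rightarrow> nat set list" where
  "subset_list 0 = [{}]"
| "subset_list (Suc n) = subset_list n @ map (insert n) (subset_list n)"

lemma length_subset_list: "length (subset_list n) = 2 ^ n"
  by (induction n) simp_all

lemma set_subset_list: "set (subset_list n) = Pow {..<n}"
  by (induction n) (simp_all add: lessThan_Suc Pow_insert)

lemma distinct_subset_list: "distinct (subset_list n)"
proof (induction n)
  case (Suc n)
  have "n \<notin> S" if "S \<in> Pow {..<n}" for S using that by auto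
  then have "inj_on (insert n) (Pow {..<n})" "Pow {..<n} \<inter> insert n ` Pow {..<n} = {}"
    by (auto intro!: inj_onI simp: insert_ident)
  then show ?case using Suc by (simp add: distinct_map set_subset_list)
qed simp

lemma subset_list_nth_0: "subset_list n ! 0 = {}"
  by (induction n) (simp_all add: nth_append length_subset_list)

text \<open>\<open>rev\<close> puts the slot of largest index first, so that the entries of
  \<open>pfister_list\<close> come in the order of \<open>subset_list\<close>.\<close>

definition slots :: "nat \<Rightarrow> nat set \<Rightarrow> ratfun list" where
  "slots n E = map (\<lambda>i. - fract_of (Poly_Mapping.single (Poly_Mapping.single i 1) 1 + (if i \<in> E then 1 else 0))) (rev [0..<n])"

lemma pfister_list_slots: "pfister_list (slots n E) = map (\<lambda>S. fract_of (shifted_prod E S)) (subset_list n)"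
proof (induction n)
  case 0
  show ?case by (simp add: slots_def shifted_prod_def)
next
  case (Suc n)
  define x where "x = (Poly_Mapping.single (Poly_Mapping.single n 1) 1 + (if n \<in> E then 1 else 0) :: mpoly)"
  have "shifted_prod E (insert n S) = x * shifted_prod E S" if "S \<in> set (subset_list n)" for S
  proof -
    have "finite S" "n \<notin> S" using that finite_subset[of S "{..<n}"] by (auto simp: set_subset_list)
    then show ?thesis by (simp add: shifted_prod_def x_def)
  qed
  moreover have "slots (Suc n) E = (- fract_of x) # slots n E" by (simp add: slots_def x_def)
  ultimately show ?case by (simp add: tensor_list_def Suc)
qed

lemma slots_in: "set (slots n E) \<subseteq> rat_fun_field n - {0}" "length (slots n E) = n"
proof -
  have "fract_of (Poly_Mapping.single (Poly_Mapping.single i 1) 1 + (if i \<in> E then 1 else 0)) \<in> rat_fun_field n"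
    if "i < n" for i
  proof (rule fract_of_in_rat_fun_field, rule polys_in_add)
    show "Poly_Mapping.single (Poly_Mapping.single i 1) 1 \<in> polys_in n" using that by (simp add: polys_in_iff)
  qed simp
  moreover have "Poly_Mapping.single (Poly_Mapping.single i 1) 1 + (if i \<in> E then 1 else 0) \<noteq> (0::mpoly)" for i :: nat
  proof
    assume "Poly_Mapping.single (Poly_Mapping.single i 1) 1 + (if i \<in> E then 1 else 0) = (0::mpoly)"
    from arg_cong[OF this, of "\<lambda>p. Poly_Mapping.lookup p (Poly_Mapping.single i 1)"]
    moreover have "Poly_Mapping.single i (1::nat) \<noteq> 0"
      by (metis lookup_single_eq lookup_zero zero_neq_one)
    ultimately show False by (simp add: lookup_add lookup_one split: if_splits)
  qed
  ultimately show "set (slots n E) \<subseteq> rat_fun_field n - {0}" by (auto simp: slots_def simp del: fract_of_simps(2))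
qed (simp add: slots_def)

lemma bij_betw_subset_list: "bij_betw ((!) (subset_list n)) {1..<2 ^ n} (Pow {..<n} - {{}})"
proof -
  have "bij_betw ((!) (subset_list n)) ({..<2 ^ n} - {0}) (Pow {..<n} - {subset_list n ! 0})"
    using bij_betw_nth[OF distinct_subset_list, of "{..<2 ^ n}" n "Pow {..<n}"]
    by (intro bij_betw_DiffI) (auto simp: length_subset_list set_subset_list subset_list_nth_0 bij_betw_def)
  moreover have "{..<2 ^ n} - {0} = {1..<2 ^ n :: nat}" by auto
  ultimately show ?thesis by (simp add: subset_list_nth_0)
qed

text \<open>List positions are translated into subsets; position 0, which the pure part omits, is
  the empty set.\<close>

lemma slot_represented_by_slots:
  assumes iso: "isometric_over (rat_fun_field n) (pfister (slots n E)) (kron (pfister (c # ps)) (pf1 b))"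
    and n: "n = length ps + 2"
  shows "\<exists>w. (\<forall>S\<in>Pow {..<n}. w S \<in> rat_fun_field n) \<and>
    (\<Sum>S\<in>Pow {..<n} - {{}}. fract_of (shifted_prod E S) * (w S)\<^sup>2) = - c"
proof -
  interpret isotropic_field "rat_fun_field n" "2 ^ n" by (rule isotropic_rat_fun_field)
  define xs where "xs = pfister_list (slots n E)"
  have len: "length xs = 2 ^ n" by (simp add: xs_def pfister_list_slots length_subset_list)
  have xs0: "xs ! 0 = 1" by (simp only: xs_def pfister_list_nth_0)
  obtain v where v: "\<And>l. l < 2 ^ n \<Longrightarrow> v l \<in> rat_fun_field n" "(\<Sum>l\<in>{1..<2 ^ n}. xs ! l * (v l)\<^sup>2) = - c"
    using rff.slot_represented_by_pure_part[OF two, where xs = xs and ps = ps and c = c and b = b and n = n] iso len xs0 n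
    by (auto simp: pfister_eq_diag_form xs_def)
  define k where "k = inv_into {..<2 ^ n} ((!) (subset_list n))"
  have inj: "inj_on ((!) (subset_list n)) {..<2 ^ n}"
    using distinct_subset_list[of n] length_subset_list[of n] by (auto simp: inj_on_def nth_eq_iff_index_eq)
  have img: "(!) (subset_list n) ` {..<2 ^ n} = Pow {..<n}"
  proof -
    have "(!) (subset_list n) ` {..<length (subset_list n)} = set (subset_list n)"
      by (auto simp: set_conv_nth)
    then show ?thesis by (simp only: length_subset_list set_subset_list)
  qed
  have k_in: "k S < 2 ^ n" if "S \<in> Pow {..<n}" for S
    using inv_into_into[of S "(!) (subset_list n)" "{..<2 ^ n}"] that img by (auto simp: k_def)
  have k_nth: "k (subset_list n ! l) = l" if "l < 2 ^ n" for l
    unfolding k_def using inj that by (intro inv_into_f_f) auto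
  have "(\<Sum>S\<in>Pow {..<n} - {{}}. fract_of (shifted_prod E S) * (v (k S))\<^sup>2) =
     (\<Sum>l\<in>{1..<2 ^ n}. fract_of (shifted_prod E (subset_list n ! l)) * (v (k (subset_list n ! l)))\<^sup>2)"
    by (rule sum.reindex_bij_betw[OF bij_betw_subset_list, symmetric])
  also have "\<dots> = (\<Sum>l\<in>{1..<2 ^ n}. xs ! l * (v l)\<^sup>2)"
    by (rule sum.cong) (auto simp: k_nth xs_def pfister_list_slots length_subset_list)
  also have "\<dots> = - c" by (rule v(2))
  finally show ?thesis using v(1) k_in by (intro exI[of _ "\<lambda>S. v (k S)"]) auto
qed

lemma not_linked_2_power:
  assumes n: "n \<ge> 2"
  shows "\<not> linked (rat_fun_field n) (2 ^ n) n"
proof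
  define F where "F = rat_fun_field n"
  define U where "U = {..<n}"
  assume "linked (rat_fun_field n) (2 ^ n) n"
  moreover define \<phi>s where "\<phi>s = map (\<lambda>E. pfister (slots n E)) (subset_list n)"
  have "length \<phi>s = 2 ^ n \<and> (\<forall>\<phi>\<in>set \<phi>s. is_pfister_over F n \<phi>)"
  proof (intro conjI ballI)
    show "length \<phi>s = 2 ^ n" by (simp add: \<phi>s_def length_subset_list)
    fix \<phi> assume "\<phi> \<in> set \<phi>s"
    then obtain E where "\<phi> = pfister (slots n E)" by (auto simp: \<phi>s_def)
    then show "is_pfister_over F n \<phi>"
      unfolding is_pfister_over_def F_def using slots_in by (intro exI[of _ "slots n E"] conjI)
  qed
  ultimately have "share_common_factor F n \<phi>s" unfolding linked_def F_def by blast
  then obtain \<pi> bs where \<pi>: "is_pfister_over F (n - 1) \<pi>" "length bs = length \<phi>s"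
    and iso: "\<And>j. j < length \<phi>s \<Longrightarrow> isometric_over F (\<phi>s ! j) (kron \<pi> (pf1 (bs ! j)))"
    unfolding share_common_factor_def by blast
  obtain qs where qs: "length qs = n - 1" "set qs \<subseteq> F - {0}" "\<pi> = pfister qs"
    using \<pi>(1) unfolding is_pfister_over_def by blast
  \<comment> \<open>Here n \<ge> 2 enters: the common factor has at least one slot.\<close>
  then obtain c ps where cps: "qs = c # ps" using n by (cases qs) auto
  have c: "c \<noteq> 0" and len: "n = length ps + 2" using qs n by (auto simp: cps)
  have "\<forall>E\<in>Pow U. \<exists>w. (\<forall>S\<in>Pow U. w S \<in> F) \<and>
    (\<Sum>S\<in>Pow U - {{}}. fract_of (shifted_prod E S) * (w S)\<^sup>2) = - c"
  proof
    fix E assume "E \<in> Pow U"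
    then have "E \<in> set (subset_list n)" by (simp add: set_subset_list U_def)
    then obtain j where j: "j < length (subset_list n)" "subset_list n ! j = E" by (auto simp: in_set_conv_nth)
    then have "isometric_over F (pfister (slots n E)) (kron (pfister (c # ps)) (pf1 (bs ! j)))"
      using iso[of j] by (simp add: \<phi>s_def qs(3) cps)
    then show "\<exists>w. (\<forall>S\<in>Pow U. w S \<in> F) \<and> (\<Sum>S\<in>Pow U - {{}}. fract_of (shifted_prod E S) * (w S)\<^sup>2) = - c"
      unfolding F_def U_def using slot_represented_by_slots[OF _ len] by blast
  qed
  from bchoice[OF this] obtain w where w: "\<And>E S. E \<in> Pow U \<Longrightarrow> S \<in> Pow U \<Longrightarrow> w E S \<in> F"
    "\<And>E. E \<in> Pow U \<Longrightarrow> (\<Sum>S\<in>Pow U - {{}}. fract_of (shifted_prod E S) * (w E S)\<^sup>2) = - c" by blast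
  have "\<exists>q p. q \<noteq> 0 \<and> q \<in> polys_in n \<and> (\<forall>s\<in>Pow U \<times> Pow U. p s \<in> polys_in n \<and> fract_of (p s) = fract_of q * (case s of (E, S) \<Rightarrow> w E S))"
    using w(1) by (intro common_denominator) (auto simp: U_def F_def)
  then obtain q p where q: "q \<noteq> 0"
    and p': "\<forall>s\<in>Pow U \<times> Pow U. p s \<in> polys_in n \<and> fract_of (p s) = fract_of q * (case s of (E, S) \<Rightarrow> w E S)"
    by blast
  have p: "fract_of (p (E, S)) = fract_of q * w E S" if "E \<in> Pow U" "S \<in> Pow U" for E S
    using p' that by auto
  \<comment> \<open>With one denominator q for all E the values become polynomials, and these agree
    because each of them is -c q^2.\<close>
  define Z where "Z = (\<lambda>E. \<Sum>S\<in>Pow U - {{}}. shifted_prod E S * (p (E, S))\<^sup>2)"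
  have Z: "fract_of (Z E) = - (fract_of q)\<^sup>2 * c" if E: "E \<in> Pow U" for E
  proof -
    have "fract_of (Z E) = (\<Sum>S\<in>Pow U - {{}}. (fract_of q)\<^sup>2 * (fract_of (shifted_prod E S) * (w E S)\<^sup>2))"
      unfolding Z_def fract_of_sum using p[OF E] by (intro sum.cong) (auto simp: power_mult_distrib)
    also have "\<dots> = (fract_of q)\<^sup>2 * - c" unfolding sum_distrib_left[symmetric] w(2)[OF E] ..
    finally show ?thesis by simp
  qed
  have Z_const: "Z E = Z {}" if "E \<in> Pow U" for E
  proof -
    have "fract_of (Z E) = fract_of (Z {})" using Z[OF that] Z[of "{}"] by simp
    then show ?thesis by (simp only: fract_of_simps(5))
  qed
  \<comment> \<open>This provides a nonzero coefficient among the \<open>p (E, S)\<close>, without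
    which nothing could be normalised.\<close>
  have "Z {} \<noteq> 0"
  proof
    assume "Z {} = 0"
    then show False using Z[of "{}"] c q by simp
  qed
  obtain W :: "complex set" where W: "subring_set W" "2 \<in> W" "inverse 2 \<notin> W" "\<And>t. t \<in> W \<or> inverse t \<in> W"
    using ex_dyadic_valuation_ring by blast
  interpret dyadic_valuation_ring W by unfold_locales (use W in auto)
  define X where "X = (\<Union>(E, S)\<in>Pow U \<times> (Pow U - {{}}). Poly_Mapping.lookup (p (E, S)) ` Poly_Mapping.keys (p (E, S)))"
  have "finite X" "0 \<notin> X" by (auto simp: X_def U_def in_keys_iff)
  moreover have "X \<noteq> {}"
  proof
    assume "X = {}"
    then have "p ({}, S) = 0" if "S \<in> Pow U - {{}}" for S using that by (force simp: X_def)
    then have "Z {} = 0" by (simp add: Z_def)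
    then show False using \<open>Z {} \<noteq> 0\<close> by simp
  qed
  ultimately obtain \<kappa> where \<kappa>: "\<kappa> \<in> X" "\<And>x. x \<in> X \<Longrightarrow> x / \<kappa> \<in> W" using ex_dividing_all[of X] by blast
  have \<kappa>0: "\<kappa> \<noteq> 0" using \<kappa>(1) \<open>0 \<notin> X\<close> by auto
  \<comment> \<open>\<open>X\<close> collects coefficients for nonempty S only, so division by
    \<open>\<kappa>\<close> is controlled only there; the default 0 keeps \<open>u {} E\<close>
    integral.\<close>
  define u where "u = (\<lambda>S E. if S = {} then 0 else Poly_Mapping.single 0 (inverse \<kappa>) * p (E, S))"
  have lookup_u: "Poly_Mapping.lookup (u S E) m = Poly_Mapping.lookup (p (E, S)) m / \<kappa>" if "S \<noteq> {}" for S E m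
    using that by (simp add: u_def lookup_single_times divide_inverse mult.commute)
  obtain E S where ES: "E \<in> Pow U" "S \<in> Pow U - {{}}" "\<kappa> \<in> Poly_Mapping.lookup (p (E, S)) ` Poly_Mapping.keys (p (E, S))"
    using \<kappa>(1) unfolding X_def by auto
  have "u S E \<in> red_ideal"
  proof (rule common_value_pure_parts_red_ideal[of U u "(Poly_Mapping.single 0 (inverse \<kappa>))\<^sup>2 * Z {}"])
    show "finite U" by (simp add: U_def)
    show "u S E \<in> int_polys" if SE: "S \<subseteq> U" "E \<subseteq> U" for S E
    proof (cases "S = {}")
      case True
      then show ?thesis using int_polys(2) by (simp add: u_def)
    next
      case False
      have "Poly_Mapping.lookup (p (E, S)) m / \<kappa> \<in> W" for m
      proof (cases "m \<in> Poly_Mapping.keys (p (E, S))")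
        case True
        then have "Poly_Mapping.lookup (p (E, S)) m \<in> X" unfolding X_def using SE False by blast
        then show ?thesis by (rule \<kappa>(2))
      next
        case False
        then show ?thesis using subring_setD(2)[OF subring] by (simp add: in_keys_iff)
      qed
      then show ?thesis using lookup_u[OF False] by (simp add: int_polys_def)
    qed
    show "(\<Sum>S\<in>Pow U - {{}}. shifted_prod E S * (u S E)\<^sup>2) = (Poly_Mapping.single 0 (inverse \<kappa>))\<^sup>2 * Z {}" if "E \<subseteq> U" for E
    proof -
      have "(\<Sum>S\<in>Pow U - {{}}. shifted_prod E S * (u S E)\<^sup>2) =
          (\<Sum>S\<in>Pow U - {{}}. (Poly_Mapping.single 0 (inverse \<kappa>))\<^sup>2 * (shifted_prod E S * (p (E, S))\<^sup>2))"
        by (rule sum.cong) (auto simp: u_def power_mult_distrib mult.left_commute)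
      also have "\<dots> = (Poly_Mapping.single 0 (inverse \<kappa>))\<^sup>2 * Z E" by (simp add: Z_def sum_distrib_left)
      finally show ?thesis using Z_const[of E] that by simp
    qed
  qed (use ES in auto)
  \<comment> \<open>\<open>\<kappa>\<close> is itself a coefficient of \<open>p (E, S)\<close>, so
    \<open>u S E\<close> has a coefficient 1, which is not in the maximal ideal.\<close>
  moreover obtain m where "Poly_Mapping.lookup (p (E, S)) m = \<kappa>" using ES(3) by blast
  then have "Poly_Mapping.lookup (u S E) m = 1" using lookup_u[of S E m] ES(2) \<kappa>0 by auto
  ultimately show False using max_ideal_simps(2) unfolding red_ideal_def by (metis (mono_tags, lifting) mem_Collect_eq)
qed

theorem theoremB:
  fixes n :: nat
  assumes "n \<ge> 2"
  shows "linked (rat_fun_field n) 3 n \<and> \<not> linked (rat_fun_field n) (2 ^ n) n"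
proof
  interpret isotropic_field "rat_fun_field n" "2 ^ n" by (rule isotropic_rat_fun_field)
  show "linked (rat_fun_field n) 3 n" by (rule linked_3) (use assms in auto)
  show "\<not> linked (rat_fun_field n) (2 ^ n) n" using assms by (rule not_linked_2_power)
qed

end
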